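(* Let $\phi=\frac{1+\sqrt5}{2}$, $\ell=\log\phi$ and $\lambda=\log 2$. Then \[ \sum_{n=0}^{\infty} \frac{(-1)^{n}}{(2n+1)^3 \binom{2n}{n}} = -\frac{4 \operatorname{Li}_3\bigl(\phi^{-3}\bigr)}{3}-4 \operatorname{Li}_2 \bigl(\phi^{-3}\bigr) \ell+\operatorname{Li}_3\bigl(\phi^{-1}\bigr)-\frac{25\ell^3}{3} +6 \lambda\ell^2 + \frac{\pi^2 \ell}{10} +\frac{12 \zeta(3)}{5}-\frac{\pi^2 \lambda}{3}, \] and this number lies in $\mathfrak Z_3(10)$.
   Context: $\operatorname{Li}_s(z)=\sum_{n\ge1} z^n/n^s$ for $|z|\le1$, $s\ge2$; $\zeta(3)=\sum_{n\ge1}n^{-3}$. For positive integers $s_1,\dots,s_m$ and complex $z_1,\dots,z_m$, $\operatorname{Li}_{s_1,\dots,s_m}(z_1,\dots,z_m)=\sum_{n_1>\cdots>n_m\ge1} \frac{z_1^{n_1}\cdots z_m^{n_m}}{n_1^{s_1}\cdots n_m^{s_m}}$ (when convergent). For positive integers $k,N$, $\mathfrak Z_k(N)$ is the $\mathbb Q$-linear span of all $\operatorname{Li}_{s_1,\dots,s_m}(z_1,\dots,z_m)$ with $s_j\in\mathbb Z_{>0}$, $\sum_j s_j=k$, $z_j^N=1$ for all $j$, and $(s_1,z_1)\neq(1,1)$. *)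

theory Defs
  imports "HOL-Analysis.Analysis"
begin

definition polylog :: "nat \<Rightarrow> real \<Rightarrow> real" where
  "polylog s x = (\<Sum>n. x ^ (n+1) / real (n+1) ^ s)"

definition zeta3 :: real where
  "zeta3 = (\<Sum>n. 1 / real (n+1) ^ 3)"

fun mpl_trunc :: "(nat \<times> complex) list \<Rightarrow> nat \<Rightarrow> complex" where
  "mpl_trunc [] N = 1"
| "mpl_trunc ((s,z) # L) N =
     (\<Sum>n\<in>{1..<N}. z ^ n / of_nat n ^ s * mpl_trunc L n)"

text \<open>The multiple polylogarithm value is the limit of the truncated sums
  (the nested series summed in order of the outermost index n_1).\<close>
definition mpl :: "(nat \<times> complex) list \<Rightarrow> complex" where
  "mpl L = lim (\<lambda>N. mpl_trunc L N)"

definition admissible :: "nat \<Rightarrow> nat \<Rightarrow> (nat \<times> complex) list \<Rightarrow> bool" where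
  "admissible k N L \<longleftrightarrow> L \<noteq> [] \<and>
     (\<forall>(s,z)\<in>set L. s > 0 \<and> z ^ N = 1) \<and>
     sum_list (map fst L) = k \<and>
     hd L \<noteq> (1, 1) \<and>
     convergent (\<lambda>M. mpl_trunc L M)"

definition MZV_space :: "nat \<Rightarrow> nat \<Rightarrow> complex set" where
  "MZV_space k N = {x. \<exists>m (c :: nat \<Rightarrow> rat) (Ls :: nat \<Rightarrow> (nat \<times> complex) list).
      (\<forall>i<m. admissible k N (Ls i)) \<and>
      x = (\<Sum>i<m. of_rat (c i) * mpl (Ls i))}"

end

theory Submission
  imports Defs "HOL-Real_Asymp.Real_Asymp"
begin

text \<open>
  Write \<open>S\<close> for the series and \<open>v = phi\<^sup>-\<^sup>3\<close>. Substituting \<open>y = 2 v / (1 - v\<^sup>2)\<close> in the generating function of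
  \<open>(- 4)\<^sup>n / binom(2n, n)\<close>, which is an \<open>arsinh\<close>, turns two integrations \<open>dy / y\<close> into trilogarithms at
  \<open>v\<close>, \<open>- v\<close>, \<open>1 - v\<close> and \<open>1 / (1 + v)\<close>; the value \<open>v = phi\<^sup>-\<^sup>3\<close> gives \<open>y = 1/2\<close>. These are reduced to
  the values at \<open>phi\<^sup>-\<^sup>3\<close> and \<open>phi\<^sup>-\<^sup>1\<close> by Landen's three-term relation, a relation between \<open>w\<close> and
  \<open>(1 - w) / (1 + w)\<close> at \<open>w = 1 / phi\<close>, and the specialisation \<open>y = 1/2\<close> of Kummer's two-variable
  equation at \<open>x = phi\<^sup>-\<^sup>2\<close>.

  For the membership, let \<open>a\<close>, \<open>b\<close>, \<open>d\<close>, \<open>e\<close> be roots of unity with \<open>a b = d e\<close> and put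
  \<open>R t = (d + e - a - b) t / ((1 - a t) (1 - b t))\<close>. Then \<open>1 - R t\<close> also factors into \<open>1 - c t\<close> with \<open>c\<close> a
  root of unity, so \<open>Li s (R t)\<close> is an iterated integral with letters \<open>dt / t\<close> and \<open>c dt / (1 - c t)\<close>,
  and its limit for \<open>t \<rightarrow> 1\<close> is a combination of multiple polylogarithms at roots of unity. Suitable
  tenth roots of unity give \<open>R 1 = phi\<^sup>-\<^sup>1\<close> and \<open>R 1 = phi\<^sup>-\<^sup>3\<close>. Products are handled by the stuffle
  relation for the truncated sums.
\<close>

section \<open>Power series and polylogarithms\<close>

text \<open>Functional equations are proved by differentiation, one weight at a time. Each argument
  enters through its logarithmic derivative, a combination of a few simple fractions. In the
  derivative of a trilogarithmic identity the coefficient of each fraction must vanish, and that is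
  a dilogarithmic identity to be proved beforehand. \<open>Li\<close> is only ever the series,
  without analytic continuation, so the ranges in the statements keep all arguments in the closed
  unit disc. The obstacle for the membership is that \<open>phi\<close> is not a root of unity, so
  Li_3 at its powers is not visibly in the span. The condition a b = d e makes the quadratic terms
  agree, giving 1 - R t = (1 - d t)(1 - e t) / ((1 - a t)(1 - b t)). Requiring a, b, d, e to differ
  from 1 keeps away the excluded leading pair (1, 1), and norm (R t) < 1 on [0, 1] keeps the
  polylogarithm inside its series. Membership of the sum is then read off the closed form.\<close>

definition poly_bounded :: "(nat \<Rightarrow> 'a::real_normed_field) \<Rightarrow> bool" where
  "poly_bounded a \<longleftrightarrow> (\<exists>C k. \<forall>n. norm (a n) \<le> C * real (Suc n) ^ k)"

lemma poly_boundedI: "(\<And>n. norm (a n) \<le> C * real (Suc n) ^ k) \<Longrightarrow> poly_bounded a"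
  by (auto simp: poly_bounded_def)

lemma poly_bounded_times_n:
  assumes "poly_bounded a"
  shows "poly_bounded (\<lambda>n. of_nat n * a n)"
proof -
  obtain C k where C: "\<And>n. norm (a n) \<le> C * real (Suc n) ^ k"
    using assms by (auto simp: poly_bounded_def)
  show ?thesis
  proof (rule poly_boundedI)
    fix n
    have "norm (of_nat n * a n) = real n * norm (a n)"
      by (simp add: norm_mult)
    also have "\<dots> \<le> real (Suc n) * (C * real (Suc n) ^ k)"
      by (intro mult_mono C) auto
    finally show "norm (of_nat n * a n) \<le> C * real (Suc n) ^ Suc k"
      by (simp add: mult_ac)
  qed
qed

text \<open>Induction on \<open>k\<close>: termwise differentiation keeps the radius of convergence,
  and the coefficients it produces dominate the next power of \<open>Suc n\<close>.\<close>

lemma summable_poly_times_power: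
  fixes x :: real
  assumes "\<bar>x\<bar> < 1"
  shows "summable (\<lambda>n. real (Suc n) ^ k * x ^ n)"
  using assms
proof (induction k arbitrary: x)
  case 0
  then show ?case by (simp add: summable_geometric)
next
  case (Suc k)
  have "summable (\<lambda>n. diffs (\<lambda>n. real (Suc n) ^ k) n * \<bar>x\<bar> ^ n)"
    by (rule termdiff_converges[where K = 1]) (use Suc in auto)
  then show ?case
  proof (rule summable_comparison_test'[where N = 0])
    fix n :: nat
    have "real (Suc n) ^ k \<le> real (Suc (Suc n)) ^ k"
      by (intro power_mono) auto
    then have "real (Suc n) * real (Suc n) ^ k * \<bar>x\<bar> ^ n
        \<le> real (Suc n) * real (Suc (Suc n)) ^ k * \<bar>x\<bar> ^ n"
      by (intro mult_right_mono mult_left_mono) auto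
    then show "norm (real (Suc n) ^ Suc k * x ^ n) \<le> diffs (\<lambda>n. real (Suc n) ^ k) n * \<bar>x\<bar> ^ n"
      by (simp add: diffs_def abs_mult power_abs)
  qed
qed

lemma poly_bounded_summable:
  fixes x :: "'a::{real_normed_field,banach}"
  assumes "poly_bounded a" "norm x < 1"
  shows "summable (\<lambda>n. a n * x ^ n)"
proof -
  obtain C k where C: "\<And>n. norm (a n) \<le> C * real (Suc n) ^ k"
    using assms by (auto simp: poly_bounded_def)
  have "summable (\<lambda>n. C * (real (Suc n) ^ k * norm x ^ n))"
    using assms by (intro summable_mult summable_poly_times_power) auto
  then show ?thesis
  proof (rule summable_comparison_test'[where N = 0])
    fix n :: nat
    show "norm (a n * x ^ n) \<le> C * (real (Suc n) ^ k * norm x ^ n)"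
      using mult_right_mono[OF C[of n], of "norm x ^ n"]
      by (simp add: norm_mult norm_power mult_ac)
  qed
qed

lemma powser_isCont:
  fixes x :: "'a::{real_normed_field,banach}"
  assumes "poly_bounded a" "norm x < 1"
  shows "isCont (\<lambda>x. \<Sum>n. a n * x ^ n) x"
  using termdiffs_strong'[of 1 a x] assms poly_bounded_summable[OF assms(1)]
  by (blast intro: DERIV_isCont)

text \<open>The derivative is expressed by the Euler operator x d/dx, which multiplies the n-th
  coefficient by n and so turns \<open>licoeff (Suc s)\<close> into \<open>licoeff s\<close>.
  Dividing by \<open>x\<close> afterwards is what excludes 0.\<close>

lemma powser_deriv:
  fixes x :: "'a::{real_normed_field,banach}"
  assumes a: "poly_bounded a" and x: "norm x < 1" "x \<noteq> 0"
  shows "((\<lambda>x. \<Sum>n. a n * x ^ n) has_field_derivative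
           (\<Sum>n. (of_nat n * a n) * x ^ n) / x) (at x)"
proof -
  have s: "summable (\<lambda>n. (of_nat n * a n) * x ^ n)"
    by (intro poly_bounded_summable poly_bounded_times_n assms)
  have "(\<Sum>n. (of_nat n * a n) * x ^ n) = (\<Sum>n. (of_nat (Suc n) * a (Suc n)) * x ^ Suc n)"
    using suminf_split_head[OF s] by simp
  also have "\<dots> = (\<Sum>n. diffs a n * x ^ n * x)"
    by (simp add: diffs_def mult_ac)
  also have "\<dots> = (\<Sum>n. diffs a n * x ^ n) * x"
    by (intro suminf_mult2[symmetric] termdiff_converges[where K = 1] x poly_bounded_summable a)
  finally have "(\<Sum>n. (of_nat n * a n) * x ^ n) / x = (\<Sum>n. diffs a n * x ^ n)"
    using x by simp
  then show ?thesis
    using termdiffs_strong'[of 1 a x] x poly_bounded_summable[OF a] by simp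
qed

text \<open>Generic in the field: the closed form concerns real arguments, the membership complex
  ones.\<close>

definition Li :: "nat \<Rightarrow> 'a \<Rightarrow> 'a::{real_normed_field,banach}" where
  "Li s z = (\<Sum>n. z ^ (n + 1) / of_nat (n + 1) ^ s)"

lemma polylog_eq_Li: "polylog s x = Li s x"
  by (simp add: polylog_def Li_def)

lemma zeta3_eq_Li: "zeta3 = Li 3 1"
  by (simp add: zeta3_def Li_def)

lemma Li_0 [simp]: "Li s 0 = 0"
  by (simp add: Li_def)

text \<open>The constant term is set by hand because for \<open>s = 0\<close> the quotient at
  \<open>n = 0\<close> would be 1.\<close>

definition licoeff :: "nat \<Rightarrow> nat \<Rightarrow> 'a::real_normed_field" where
  "licoeff s n = (if n = 0 then 0 else 1 / of_nat n ^ s)"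

lemma norm_licoeff_le: "norm (licoeff s n :: 'a::real_normed_field) \<le> 1"
proof (cases "n = 0")
  case False
  then have "(1::real) \<le> real n ^ s"
    by (intro one_le_power) auto
  then show ?thesis
    using False by (auto simp: licoeff_def norm_divide norm_power divide_simps)
qed (simp add: licoeff_def)

lemma licoeff_bounded: "poly_bounded (licoeff s :: nat \<Rightarrow> 'a::real_normed_field)"
  by (rule poly_boundedI[of _ 1 0]) (simp add: norm_licoeff_le)

lemma licoeff_times_n: "of_nat n * licoeff (Suc s) n = (licoeff s n :: 'a::real_normed_field)"
  by (simp add: licoeff_def)

lemma Li_powser:
  assumes "norm z < 1"
  shows "Li s z = (\<Sum>n. licoeff s n * z ^ n)"
proof -
  have "summable (\<lambda>n. licoeff s n * z ^ n)"
    by (intro poly_bounded_summable licoeff_bounded assms)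
  from suminf_split_head[OF this] show ?thesis
    by (simp add: Li_def licoeff_def)
qed

lemma Li_deriv_at:
  assumes z: "norm z < 1" "z \<noteq> 0"
  shows "(Li (Suc s) has_field_derivative Li s z / z) (at z)"
proof -
  have "eventually (\<lambda>w. w \<in> ball 0 1) (nhds z)"
    using z by (intro eventually_nhds_in_open) auto
  then have ev: "eventually (\<lambda>w. Li (Suc s) w = (\<Sum>n. licoeff (Suc s) n * w ^ n)) (nhds z)"
    by eventually_elim (auto intro: Li_powser)
  have "((\<lambda>w. \<Sum>n. licoeff (Suc s) n * w ^ n) has_field_derivative
           (\<Sum>n. (of_nat n * licoeff (Suc s) n) * z ^ n) / z) (at z)"
    by (intro powser_deriv licoeff_bounded z)
  also have "(\<Sum>n. (of_nat n * licoeff (Suc s) n) * z ^ n) = Li s z"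
    unfolding licoeff_times_n using z by (simp add: Li_powser)
  finally show ?thesis
    by (subst DERIV_cong_ev[OF refl ev refl])
qed

lemma Li_deriv [derivative_intros]:
  assumes "(g has_field_derivative g') (at x within A)" "norm (g x) < 1" "g x \<noteq> 0"
  shows "((\<lambda>x. Li (Suc s) (g x)) has_field_derivative Li s (g x) / g x * g') (at x within A)"
  using DERIV_chain2[OF Li_deriv_at assms(1)] assms(2,3) by blast

lemma isCont_Li:
  assumes "norm z < 1"
  shows "isCont (Li s) z"
proof -
  have "eventually (\<lambda>w. w \<in> ball 0 1) (nhds z)"
    using assms by (intro eventually_nhds_in_open) auto
  then have ev: "eventually (\<lambda>w. Li s w = (\<Sum>n. licoeff s n * w ^ n)) (nhds z)"
    by eventually_elim (auto intro: Li_powser)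
  show ?thesis
    by (subst isCont_cong[OF ev]) (intro powser_isCont licoeff_bounded assms)
qed

lemma summable_inverse_squares: "summable (\<lambda>n. 1 / real (n + 1) ^ 2)"
  using inverse_squares_sums by (simp add: sums_iff add_ac)

lemma norm_Li_term_le:
  fixes z :: "'a::real_normed_field"
  assumes "norm z \<le> 1" "s \<ge> 2"
  shows "norm (z ^ (n + 1) / of_nat (n + 1) ^ s) \<le> 1 / real (n + 1) ^ 2"
proof -
  have "norm z ^ (n + 1) \<le> 1"
    using assms by (intro power_le_one) auto
  moreover have "real (n + 1) ^ 2 \<le> real (n + 1) ^ s"
    using assms by (intro power_increasing) auto
  ultimately have "norm z ^ (n + 1) / real (n + 1) ^ s \<le> 1 / real (n + 1) ^ 2"
    by (intro frac_le) auto
  then show ?thesis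
    by (simp only: norm_divide norm_power norm_of_nat)
qed

lemma Li_summable:
  assumes "norm z \<le> 1" "s \<ge> 2"
  shows "summable (\<lambda>n. z ^ (n + 1) / of_nat (n + 1) ^ s :: 'a::{real_normed_field,banach})"
  by (rule summable_comparison_test'[OF summable_inverse_squares, of 0]) (rule norm_Li_term_le[OF assms])

text \<open>The Weierstrass test with majorant 1/n^2 reaches the boundary of the disc, so values at
  1 and -1 can serve as constants of integration.\<close>

lemma continuous_on_cball_Li:
  assumes "s \<ge> 2"
  shows "continuous_on (cball 0 1) (Li s :: 'a \<Rightarrow> 'a::{real_normed_field,banach})"
proof -
  have "uniform_limit (cball 0 1) (\<lambda>N z. \<Sum>n<N. z ^ (n + 1) / of_nat (n + 1) ^ s)
          (\<lambda>z::'a. \<Sum>n. z ^ (n + 1) / of_nat (n + 1) ^ s) sequentially"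
    by (rule Weierstrass_m_test[OF _ summable_inverse_squares]) (use assms norm_Li_term_le in auto)
  moreover have "continuous_on (cball 0 1) (\<lambda>z::'a. \<Sum>n<N. z ^ (n + 1) / of_nat (n + 1) ^ s)" for N
    by (intro continuous_intros) (simp del: of_nat_add of_nat_Suc)
  ultimately have "continuous_on (cball 0 1) (\<lambda>z::'a. \<Sum>n. z ^ (n + 1) / of_nat (n + 1) ^ s)"
    using uniform_limit_theorem[OF always_eventually] by (metis (no_types, lifting) sequentially_bot)
  then show ?thesis
    by (simp add: Li_def[abs_def])
qed

lemma continuous_on_Li:
  assumes "s \<ge> 2" "continuous_on A f" "\<And>x. x \<in> A \<Longrightarrow> norm (f x) \<le> 1"
  shows "continuous_on A (\<lambda>x. Li s (f x))"
  by (rule continuous_on_compose2[OF continuous_on_cball_Li[OF assms(1)] assms(2)]) (use assms(3) in auto)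

lemma tendsto_Li:
  assumes "s \<ge> 2" "(f \<longlongrightarrow> l) F" "eventually (\<lambda>x. norm (f x) \<le> 1) F" "norm l \<le> 1"
  shows "((\<lambda>x. Li s (f x)) \<longlongrightarrow> Li s l) F"
  by (rule continuous_on_tendsto_compose[OF continuous_on_cball_Li[OF assms(1)] assms(2)])
     (use assms(3,4) in auto)

lemma Li_zeroth:
  assumes "norm z < 1"
  shows "Li 0 z = z / (1 - z)"
  using suminf_mult[OF summable_geometric[OF assms], of z] suminf_geometric[OF assms]
  by (simp add: Li_def)

lemma Li_one:
  fixes x :: real
  assumes "\<bar>x\<bar> < 1"
  shows "Li 1 x = - ln (1 - x)"
proof -
  have "\<exists>c. \<forall>x\<in>{-1<..<1::real}. Li 1 x + ln (1 - x) = c"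
  proof (rule has_field_derivative_zero_constant)
    fix x :: real assume x: "x \<in> {-1<..<1}"
    have "(Li 1 has_field_derivative 1 / (1 - x)) (at x)"
    proof (cases "x = 0")
      case False
      then show ?thesis
        using Li_deriv_at[of x 0] x by (simp add: Li_zeroth abs_less_iff)
    next
      \<comment> \<open>The derivative rule for \<open>Li\<close> divides by the argument, so the
        origin is treated through the power series, whose linear coefficient is 1.\<close>
      case True
      have "((\<lambda>x::real. \<Sum>n. licoeff 1 n * x ^ n) has_field_derivative (\<Sum>n. diffs (licoeff 1) n * 0 ^ n)) (at 0)"
        by (rule termdiffs_strong'[of 1]) (auto intro!: poly_bounded_summable licoeff_bounded)
      also have "(\<Sum>n. diffs (licoeff 1) n * 0 ^ n) = (1::real)"
        by (subst powser_zero) (simp add: diffs_def licoeff_def)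
      finally have "((\<lambda>x::real. \<Sum>n. licoeff 1 n * x ^ n) has_field_derivative 1) (at 0)" .
      moreover have "eventually (\<lambda>w. w \<in> ball 0 1) (nhds (0::real))"
        by (intro eventually_nhds_in_open) auto
      then have ev: "eventually (\<lambda>w::real. Li 1 w = (\<Sum>n. licoeff 1 n * w ^ n)) (nhds 0)"
        by eventually_elim (auto intro: Li_powser)
      ultimately have "(Li 1 has_field_derivative 1) (at (0::real))"
        by (subst DERIV_cong_ev[OF refl ev refl])
      then show ?thesis
        using True by simp
    qed
    moreover have "((\<lambda>x. ln (1 - x)) has_field_derivative - 1 / (1 - x)) (at x)"
      using x by (auto intro!: derivative_eq_intros)
    ultimately have "((\<lambda>x. Li 1 x + ln (1 - x)) has_field_derivative 1 / (1 - x) + - 1 / (1 - x)) (at x)"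
      by (rule DERIV_add)
    then show "((\<lambda>x. Li 1 x + ln (1 - x)) has_field_derivative 0) (at x within {-1<..<1})"
      by (simp add: has_field_derivative_at_within)
  qed auto
  then obtain c where c: "\<And>x::real. \<bar>x\<bar> < 1 \<Longrightarrow> Li 1 x + ln (1 - x) = c"
    by (metis abs_less_iff greaterThanLessThan_iff minus_less_iff)
  from c[of 0] c[OF assms] show ?thesis
    by simp
qed

section \<open>Functional equations of the dilogarithm and the trilogarithm\<close>

text \<open>For identities containing \<open>ln x\<close>, which is discontinuous at the left end 0:
  the constant is read off from a one-sided limit. Identities continuous up to the left end use
  \<open>DERIV_zero_eq_left\<close> instead.\<close>

lemma DERIV_zero_tendsto_unique:
  fixes f :: "real \<Rightarrow> real"
  assumes x: "a < x" "x \<le> b"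
    and cont: "continuous_on {a<..b} f"
    and deriv: "\<And>y. a < y \<Longrightarrow> y < b \<Longrightarrow> (f has_field_derivative 0) (at y)"
    and lim: "(f \<longlongrightarrow> c) (at_right a)"
  shows "f x = c"
proof -
  have const: "f y = f x" if y: "a < y" "y < x" for y
    by (rule DERIV_isconst_end[OF y(2), symmetric])
       (use y x in \<open>auto intro!: deriv continuous_on_subset[OF cont]\<close>)
  have "eventually (\<lambda>y. f y = f x) (at_right a)"
    using eventually_at_right_real[OF x(1)] by eventually_elim (auto intro: const)
  then have "(f \<longlongrightarrow> f x) (at_right a)"
    by (rule tendsto_eventually)
  then show ?thesis
    using lim tendsto_unique[OF trivial_limit_at_right_real] by blast
qed

lemma DERIV_zero_eq_left:
  fixes f :: "real \<Rightarrow> real"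
  assumes x: "a \<le> x" "x \<le> b"
    and cont: "continuous_on {a..b} f"
    and deriv: "\<And>y. a < y \<Longrightarrow> y < b \<Longrightarrow> (f has_field_derivative 0) (at y)"
  shows "f x = f a"
proof (cases "x = a")
  case False
  then show ?thesis
    by (intro DERIV_isconst_end) (use x in \<open>auto intro!: deriv continuous_on_subset[OF cont]\<close>)
qed simp

lemma Li_dup:
  fixes z :: "'a::{real_normed_field,banach}"
  assumes "norm z \<le> 1" "s \<ge> 2"
  shows "Li s (z\<^sup>2) = 2 ^ (s - 1) * (Li s z + Li s (- z))"
proof -
  define f where "f = (\<lambda>w::'a. \<lambda>n. w ^ (n + 1) / of_nat (n + 1) ^ s)"
  have n: "norm (z\<^sup>2) \<le> 1" "norm (-z) \<le> 1"
    using assms by (auto simp: norm_power power_le_one)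
  have sm: "summable (f z)" "summable (f (-z))" "summable (f (z\<^sup>2))"
    unfolding f_def by (rule Li_summable; use assms n in simp)+
  define g where "g = (\<lambda>n. f z n + f (-z) n)"
  have g: "g sums (Li s z + Li s (-z))"
    unfolding g_def Li_def using sm unfolding f_def by (intro sums_add summable_sums) auto
  have "(\<lambda>n. \<Sum>k\<in>{n*2..<n*2+2}. g k) sums (Li s z + Li s (-z))"
    by (rule sums_group[OF g]) auto
  also have "(\<lambda>n. \<Sum>k\<in>{n*2..<n*2+2}. g k) = (\<lambda>n. 2 / 2 ^ s * f (z\<^sup>2) n)"
  proof
    fix n :: nat
    have "{n*2..<n*2+2} = {2*n, 2*n+1}" by auto
    then have "(\<Sum>k\<in>{n*2..<n*2+2}. g k) = g (2*n) + g (2*n+1)"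
      by simp
    \<comment> \<open>Index \<open>2*n\<close> carries the exponent \<open>2*n+1\<close>: odd powers
      cancel between \<open>z\<close> and \<open>-z\<close>, even powers double.\<close>
    also have "g (2*n) = 0"
      by (simp add: g_def f_def)
    also have "g (2*n+1) = 2 * (z\<^sup>2) ^ (n+1) / (of_nat (2 * (n+1))) ^ s"
    proof -
      have e: "2 * n + 1 + 1 = 2 * (n + 1)" by simp
      have "(- z) ^ (2 * (n+1)) = z ^ (2 * (n+1))"
        by (simp only: power_mult power2_minus)
      then show ?thesis
        unfolding g_def f_def e by (simp only: power_mult) (simp add: add_divide_distrib[symmetric])
    qed
    also have "\<dots> = 2 / 2 ^ s * f (z\<^sup>2) n"
      unfolding f_def of_nat_mult power_mult_distrib by simp
    finally show "(\<Sum>k\<in>{n*2..<n*2+2}. g k) = 2 / 2 ^ s * f (z\<^sup>2) n"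
      by simp
  qed
  finally have "(\<lambda>n. 2 / 2 ^ s * f (z\<^sup>2) n) sums (Li s z + Li s (-z))" .
  moreover have "(\<lambda>n. 2 / 2 ^ s * f (z\<^sup>2) n) sums (2 / 2 ^ s * Li s (z\<^sup>2))"
    unfolding Li_def using sm unfolding f_def by (intro sums_mult summable_sums) auto
  ultimately have "Li s z + Li s (-z) = 2 / 2 ^ s * Li s (z\<^sup>2)"
    by (rule sums_unique2)
  moreover have "(2::'a) ^ s = 2 * 2 ^ (s - 1)"
    using assms by (cases s) auto
  ultimately show ?thesis
    by (simp add: field_simps)
qed

section \<open>Special values, reflection and Landen's relations\<close>

lemma Li_two_one: "Li 2 (1::real) = pi\<^sup>2 / 6"
  using inverse_squares_sums by (simp add: Li_def sums_iff add_ac)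

lemma Li_two_minus_one: "Li 2 (-1::real) = - pi\<^sup>2 / 12"
  using Li_dup[of "1::real" 2] by (simp add: Li_two_one)

lemma Li_three_minus_one: "Li 3 (-1::real) = - 3 / 4 * Li 3 1"
  using Li_dup[of "1::real" 3] by simp

text \<open>Here \<open>d\<close> is the logarithmic derivative of \<open>g\<close> and
  \<open>m\<close> a chosen form of the logarithm. With logarithms expanded into a few basic ones,
  checking that a derivative vanishes becomes polynomial algebra.\<close>

lemma Li_two_dlog:
  fixes g :: "real \<Rightarrow> real"
  assumes "(g has_field_derivative d * g x) (at x)" "\<bar>g x\<bar> < 1" "g x \<noteq> 0" "ln (1 - g x) = m"
  shows "((\<lambda>x. Li 2 (g x)) has_field_derivative - m * d) (at x)"
  using Li_deriv[OF assms(1), of 1] assms(2-4)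
  by (simp add: Li_one[unfolded One_nat_def] numeral_2_eq_2)

lemma Li_three_dlog:
  fixes g :: "real \<Rightarrow> real"
  assumes "(g has_field_derivative d * g x) (at x)" "\<bar>g x\<bar> < 1" "g x \<noteq> 0"
  shows "((\<lambda>x. Li 3 (g x)) has_field_derivative Li 2 (g x) * d) (at x)"
  using Li_deriv[OF assms(1), of 2] assms(2,3) by (simp add: numeral_3_eq_3)

lemma landen_argument_deriv:
  fixes y :: real
  assumes "0 < y" "y < 1"
  shows "((\<lambda>x. x / (x - 1)) has_field_derivative (1 / y + 1 / (1 - y)) * (y / (y - 1))) (at y)"
  using assms by (auto intro!: derivative_eq_intros simp: divide_simps; simp add: algebra_simps)

lemma Li_two_reflection:
  fixes x :: real
  assumes "0 < x" "x < 1"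
  shows "Li 2 x + Li 2 (1 - x) = pi\<^sup>2 / 6 - ln x * ln (1 - x)"
proof -
  have "Li 2 x + Li 2 (1 - x) + ln x * ln (1 - x) = pi\<^sup>2 / 6"
  proof (rule DERIV_zero_tendsto_unique[where a = 0 and b = x and
            f = "\<lambda>x. Li 2 x + Li 2 (1 - x) + ln x * ln (1 - x)"])
    show "continuous_on {0<..x} (\<lambda>x. Li 2 x + Li 2 (1 - x) + ln x * ln (1 - x))"
      using assms by (intro continuous_intros continuous_on_Li) auto
    fix y assume "0 < y" "y < x"
    then have y: "0 < y" "y < 1"
      using assms by auto
    have d1: "((\<lambda>x. Li 2 x) has_field_derivative - ln (1 - y) * (1 / y)) (at y)"
      by (rule Li_two_dlog) (use y in \<open>auto intro!: derivative_eq_intros\<close>)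
    have d2: "((\<lambda>x. Li 2 (1 - x)) has_field_derivative - ln y * (- 1 / (1 - y))) (at y)"
      by (rule Li_two_dlog) (use y in \<open>auto intro!: derivative_eq_intros\<close>)
    have d3: "((\<lambda>x. ln x * ln (1 - x)) has_field_derivative ln (1 - y) / y - ln y / (1 - y)) (at y)"
      using y by (auto intro!: derivative_eq_intros simp: divide_simps)
    show "((\<lambda>x. Li 2 x + Li 2 (1 - x) + ln x * ln (1 - x)) has_field_derivative 0) (at y)"
      by (rule DERIV_cong[OF DERIV_add[OF DERIV_add[OF d1 d2] d3]]) simp
  next
    have "((\<lambda>x::real. ln x * ln (1 - x)) \<longlongrightarrow> 0) (at_right 0)"
      by real_asymp
    moreover have "((\<lambda>x::real. Li 2 x) \<longlongrightarrow> Li 2 0) (at_right 0)"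
      using assms by (intro tendsto_Li) (auto intro!: tendsto_intros simp: eventually_at intro: exI[of _ 1])
    moreover have "eventually (\<lambda>x::real. x \<in> {0<..<1}) (at_right 0)"
      by (rule eventually_at_right_real) simp
    then have "((\<lambda>x::real. Li 2 (1 - x)) \<longlongrightarrow> Li 2 (1 - 0)) (at_right 0)"
      by (intro tendsto_Li tendsto_intros) (auto elim!: eventually_mono)
    ultimately have "((\<lambda>x::real. Li 2 x + Li 2 (1 - x) + ln x * ln (1 - x)) \<longlongrightarrow> Li 2 0 + Li 2 (1 - 0) + 0) (at_right 0)"
      by (intro tendsto_add)
    then show "((\<lambda>x::real. Li 2 x + Li 2 (1 - x) + ln x * ln (1 - x)) \<longlongrightarrow> pi\<^sup>2 / 6) (at_right 0)"
      by (simp add: Li_two_one)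
  qed (use assms in auto)
  then show ?thesis by simp
qed

text \<open>The bound 1/2 is exactly what keeps \<open>x / (x - 1)\<close> at or above -1.\<close>

lemma Li_two_landen:
  fixes x :: real
  assumes "0 \<le> x" "x \<le> 1 / 2"
  shows "Li 2 x + Li 2 (x / (x - 1)) = - (ln (1 - x))\<^sup>2 / 2"
proof -
  let ?f = "\<lambda>x::real. Li 2 x + Li 2 (x / (x - 1)) + (ln (1 - x))\<^sup>2 / 2"
  have "?f x = ?f 0"
  proof (rule DERIV_zero_eq_left[OF assms])
    show "continuous_on {0..1 / 2} ?f"
      by (intro continuous_intros continuous_on_Li) (auto simp: field_simps abs_le_iff)
    fix y :: real assume y: "0 < y" "y < 1 / 2"
    have a: "\<bar>y / (y - 1)\<bar> < 1"
      using y by (auto simp: field_simps abs_less_iff)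
    have "1 - y / (y - 1) = 1 / (1 - y)"
      using y by (simp add: field_simps)
    then have l: "ln (1 - y / (y - 1)) = - ln (1 - y)"
      using y by (simp add: ln_div)
    have d1: "((\<lambda>x. Li 2 x) has_field_derivative - ln (1 - y) * (1 / y)) (at y)"
      by (rule Li_two_dlog) (use y in \<open>auto intro!: derivative_eq_intros\<close>)
    have d2: "((\<lambda>x. Li 2 (x / (x - 1))) has_field_derivative - (- ln (1 - y)) * (1 / y + 1 / (1 - y))) (at y)"
      by (rule Li_two_dlog[OF landen_argument_deriv]) (use y a l in auto)
    have d3: "((\<lambda>x. (ln (1 - x))\<^sup>2 / 2) has_field_derivative - ln (1 - y) * (1 / (1 - y))) (at y)"
      using y by (auto intro!: derivative_eq_intros simp: divide_simps)
    show "(?f has_field_derivative 0) (at y)"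
      by (rule DERIV_cong[OF DERIV_add[OF DERIV_add[OF d1 d2] d3]]) (simp add: algebra_simps)
  qed
  then show ?thesis by simp
qed


text \<open>Reflection and Landen's dilogarithmic relation express every dilogarithm in the
  derivative by \<open>Li 2 y\<close>, whose coefficients \<open>p\<close>, \<open>q\<close> and
  \<open>-(p + q)\<close> then cancel.\<close>

lemma Li_three_three_term:
  fixes x :: real
  assumes "0 < x" "x \<le> 1 / 2"
  shows "Li 3 x + Li 3 (1 - x) + Li 3 (x / (x - 1)) =
           Li 3 1 + ln (1 - x) ^ 3 / 6 + pi\<^sup>2 / 6 * ln (1 - x) - ln x * (ln (1 - x))\<^sup>2 / 2"
proof -
  let ?e = "\<lambda>x::real. ln (1 - x) ^ 3 / 6 + pi\<^sup>2 / 6 * ln (1 - x) - ln x * (ln (1 - x))\<^sup>2 / 2"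
  let ?f = "\<lambda>x::real. Li 3 x + Li 3 (1 - x) + Li 3 (x / (x - 1)) - ?e x"
  have "?f x = Li 3 1"
  proof (rule DERIV_zero_tendsto_unique[OF assms])
    show "continuous_on {0<..1 / 2} ?f"
      by (intro continuous_intros continuous_on_Li) (auto simp: field_simps abs_le_iff)
    fix y :: real assume y: "0 < y" "y < 1 / 2"
    define p q where "p = 1 / y" and "q = 1 / (1 - y)"
    have a: "\<bar>y / (y - 1)\<bar> < 1"
      using y by (auto simp: field_simps abs_less_iff)
    have d1: "((\<lambda>x. Li 3 x) has_field_derivative Li 2 y * p) (at y)"
      by (rule Li_three_dlog) (use y in \<open>auto intro!: derivative_eq_intros simp: p_def\<close>)
    have d2: "((\<lambda>x. Li 3 (1 - x)) has_field_derivative Li 2 (1 - y) * - q) (at y)"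
      by (rule Li_three_dlog) (use y in \<open>auto intro!: derivative_eq_intros simp: q_def\<close>)
    have d3: "((\<lambda>x. Li 3 (x / (x - 1))) has_field_derivative Li 2 (y / (y - 1)) * (p + q)) (at y)"
      unfolding p_def q_def
      by (rule Li_three_dlog[OF landen_argument_deriv]) (use y a in auto)
    have d4: "(?e has_field_derivative
        - (ln (1 - y))\<^sup>2 * q / 2 - pi\<^sup>2 / 6 * q - p * (ln (1 - y))\<^sup>2 / 2 + ln y * ln (1 - y) * q) (at y)"
      using y by (auto intro!: derivative_eq_intros simp: p_def q_def divide_simps; simp add: algebra_simps)
    note D = DERIV_diff[OF DERIV_add[OF DERIV_add[OF d1 d2] d3] d4]
    have e: "Li 2 (1 - y) = pi\<^sup>2 / 6 - ln y * ln (1 - y) - Li 2 y"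
      "Li 2 (y / (y - 1)) = - (ln (1 - y))\<^sup>2 / 2 - Li 2 y"
      using Li_two_reflection[of y] Li_two_landen[of y] y by auto
    show "(?f has_field_derivative 0) (at y)"
      by (rule DERIV_cong[OF D]) (simp add: e algebra_simps power2_eq_square)
  next
    have ev: "eventually (\<lambda>x::real. x \<in> {0<..<1/2}) (at_right 0)"
      by (rule eventually_at_right_real) simp
    have "(?e \<longlongrightarrow> 0) (at_right 0)"
      by real_asymp
    moreover have "((\<lambda>x::real. Li 3 x) \<longlongrightarrow> Li 3 0) (at_right 0)"
      using ev by (intro tendsto_Li tendsto_intros) (auto elim!: eventually_mono)
    moreover have "((\<lambda>x::real. Li 3 (1 - x)) \<longlongrightarrow> Li 3 (1 - 0)) (at_right 0)"
      using ev by (intro tendsto_Li tendsto_intros) (auto elim!: eventually_mono)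
    moreover have "((\<lambda>x::real. Li 3 (x / (x - 1))) \<longlongrightarrow> Li 3 (0 / (0 - 1))) (at_right 0)"
      using ev by (intro tendsto_Li tendsto_intros) (auto elim!: eventually_mono simp: field_simps abs_le_iff)
    ultimately have "(?f \<longlongrightarrow> Li 3 0 + Li 3 (1 - 0) + Li 3 (0 / (0 - 1)) - 0) (at_right 0)"
      by (intro tendsto_add tendsto_diff)
    then show "(?f \<longlongrightarrow> Li 3 1) (at_right 0)"
      by simp
  qed
  then show ?thesis by simp
qed

text \<open>At x = 1/2 the points x and 1 - x coincide and x / (x - 1) is -1, so each relation
  determines the value at 1/2.\<close>

lemma Li_half:
  shows "Li 2 (1 / 2 :: real) = pi\<^sup>2 / 12 - (ln 2)\<^sup>2 / 2"
    and "Li 3 (1 / 2 :: real) = 7 / 8 * Li 3 1 + ln 2 ^ 3 / 6 - pi\<^sup>2 / 12 * ln 2"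
proof -
  have l: "ln (1 / 2 :: real) = - ln 2"
    by (simp add: ln_div)
  show "Li 2 (1 / 2 :: real) = pi\<^sup>2 / 12 - (ln 2)\<^sup>2 / 2"
    using Li_two_reflection[of "1 / 2"] by (simp add: l power2_eq_square)
  show "Li 3 (1 / 2 :: real) = 7 / 8 * Li 3 1 + ln 2 ^ 3 / 6 - pi\<^sup>2 / 12 * ln 2"
    using Li_three_three_term[of "1 / 2"]
    by (simp add: l Li_three_minus_one power2_eq_square power3_eq_cube field_simps)
qed

section \<open>The involution w -> (1 - w) / (1 + w)\<close>

lemma moebius_involution_bounds:
  fixes w :: real
  assumes "0 < w" "w < 1"
  shows "\<bar>(1 - w) / (1 + w)\<bar> < 1" "(1 - w) / (1 + w) > 0"
  using assms by (auto simp: field_simps abs_less_iff)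

lemma moebius_involution_ln:
  fixes w :: real
  assumes "0 < w" "w < 1"
  shows "ln (1 - (1 - w) / (1 + w)) = ln 2 + ln w - ln (1 + w)"
    and "ln (1 + (1 - w) / (1 + w)) = ln 2 - ln (1 + w)"
    and "ln (1 - 1 / (1 + w)) = ln w - ln (1 + w)"
proof -
  have e: "1 - (1 - w) / (1 + w) = 2 * w / (1 + w)" "1 + (1 - w) / (1 + w) = 2 / (1 + w)"
    "1 - 1 / (1 + w) = w / (1 + w)"
    using assms by (simp_all add: field_simps)
  show "ln (1 - (1 - w) / (1 + w)) = ln 2 + ln w - ln (1 + w)"
    "ln (1 + (1 - w) / (1 + w)) = ln 2 - ln (1 + w)"
    "ln (1 - 1 / (1 + w)) = ln w - ln (1 + w)"
    unfolding e using assms by (simp_all add: ln_div ln_mult)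
qed

lemma moebius_involution_deriv:
  fixes w :: real
  assumes "0 < w" "w < 1"
  defines "q \<equiv> 1 / (1 - w)" and "r \<equiv> 1 / (1 + w)"
  shows "((\<lambda>w. (1 - w) / (1 + w)) has_field_derivative (- (q + r)) * ((1 - w) / (1 + w))) (at w)"
    and "((\<lambda>w. 1 / (1 + w)) has_field_derivative - r * (1 / (1 + w))) (at w)"
    and "((\<lambda>w. 1 - w\<^sup>2) has_field_derivative (- q + r) * (1 - w\<^sup>2)) (at w)"
proof -
  have e: "1 - w\<^sup>2 = (1 - w) * (1 + w)"
    by (simp add: algebra_simps power2_eq_square)
  show "((\<lambda>w. (1 - w) / (1 + w)) has_field_derivative (- (q + r)) * ((1 - w) / (1 + w))) (at w)"
    "((\<lambda>w. 1 / (1 + w)) has_field_derivative - r * (1 / (1 + w))) (at w)"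
    using assms by (auto intro!: derivative_eq_intros simp: divide_simps; simp add: algebra_simps)+
  show "((\<lambda>w. 1 - w\<^sup>2) has_field_derivative (- q + r) * (1 - w\<^sup>2)) (at w)"
    unfolding e using assms
    by (auto intro!: derivative_eq_intros simp: divide_simps; simp add: algebra_simps)
qed

text \<open>These are the coefficients of 1 / (1 - w) and of 1 / (1 + w), up to a factor, in the
  derivative of the trilogarithmic relation that follows; each has to vanish separately.\<close>

lemma Li_two_difference_moebius:
  fixes w :: real
  assumes w: "0 \<le> w" "w < 1"
  defines "v \<equiv> (1 - w) / (1 + w)"
  shows "Li 2 v - Li 2 (- v) = 2 * Li 2 (1 - w) - Li 2 (1 - w\<^sup>2) / 2"
    and "Li 2 v - Li 2 (- v) =
           2 * Li 2 (1 / (1 + w)) + Li 2 (1 - w\<^sup>2) / 2 + (ln (1 + w))\<^sup>2 - pi\<^sup>2 / 6"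
proof -
  let ?v = "\<lambda>w::real. (1 - w) / (1 + w)"
  let ?f = "\<lambda>w. Li 2 (?v w) - Li 2 (- ?v w)"
  let ?g = "\<lambda>w. ?f w - 2 * Li 2 (1 - w) + 1 / 2 * Li 2 (1 - w\<^sup>2)"
  let ?h = "\<lambda>w. ?f w - 2 * Li 2 (1 / (1 + w)) - 1 / 2 * Li 2 (1 - w\<^sup>2) - (ln (1 + w))\<^sup>2"
  have c: "continuous_on {0..w} ?g" "continuous_on {0..w} ?h"
    using w by (auto intro!: continuous_intros continuous_on_Li
                  simp: field_simps abs_le_iff power_le_one abs_square_le_1)
  have "(?g has_field_derivative 0) (at y) \<and> (?h has_field_derivative 0) (at y)"
    if y: "0 < y" "y < w" for y
  proof -
    have y': "0 < y" "y < 1"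
      using y w by auto
    have sq: "y\<^sup>2 < 1" "y\<^sup>2 > 0" "1 - y\<^sup>2 \<noteq> 0"
      using y' by (auto simp: abs_square_less_1 power2_eq_1_iff)
    define q r where "q = 1 / (1 - y)" and "r = 1 / (1 + y)"
    note b = moebius_involution_bounds[OF y']
    note l = moebius_involution_ln[OF y']
    note d = moebius_involution_deriv[OF y', folded q_def r_def]
    have d1: "((\<lambda>w. Li 2 (?v w)) has_field_derivative - (ln 2 + ln y - ln (1 + y)) * (- (q + r))) (at y)"
      by (rule Li_two_dlog[OF d(1)]) (use b l y' in auto)
    have d2: "((\<lambda>w. Li 2 (- ?v w)) has_field_derivative - (ln 2 - ln (1 + y)) * (- (q + r))) (at y)"
      by (rule Li_two_dlog) (use b l y' DERIV_minus[OF d(1)] in auto)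
    have d3: "((\<lambda>w. Li 2 (1 - w)) has_field_derivative - ln y * - q) (at y)"
      by (rule Li_two_dlog) (use y' in \<open>auto intro!: derivative_eq_intros simp: q_def\<close>)
    have d4: "((\<lambda>w. Li 2 (1 / (1 + w))) has_field_derivative - (ln y - ln (1 + y)) * - r) (at y)"
      by (rule Li_two_dlog) (use d(2) y' l in \<open>auto simp: r_def\<close>)
    have d5: "((\<lambda>w. Li 2 (1 - w\<^sup>2)) has_field_derivative - (2 * ln y) * (- q + r)) (at y)"
      by (rule Li_two_dlog[OF d(3)]) (use y' sq in \<open>auto simp: ln_realpow\<close>)
    have d6: "((\<lambda>w. (ln (1 + w))\<^sup>2) has_field_derivative 2 * ln (1 + y) * r) (at y)"
      using y' by (auto intro!: derivative_eq_intros simp: r_def)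
    show ?thesis
      using DERIV_add[OF DERIV_diff[OF DERIV_diff[OF d1 d2] DERIV_cmult[OF d3, of 2]] DERIV_cmult[OF d5, of "1 / 2"]]
        DERIV_diff[OF DERIV_diff[OF DERIV_diff[OF DERIV_diff[OF d1 d2] DERIV_cmult[OF d4, of 2]]
           DERIV_cmult[OF d5, of "1 / 2"]] d6]
      by (auto elim!: DERIV_cong simp: algebra_simps)
  qed
  then have "?g w = ?g 0" "?h w = ?h 0"
    using DERIV_zero_eq_left[OF w(1) order.refl c(1)] DERIV_zero_eq_left[OF w(1) order.refl c(2)]
    by blast+
  then show "Li 2 v - Li 2 (- v) = 2 * Li 2 (1 - w) - Li 2 (1 - w\<^sup>2) / 2"
    "Li 2 v - Li 2 (- v) = 2 * Li 2 (1 / (1 + w)) + Li 2 (1 - w\<^sup>2) / 2 + (ln (1 + w))\<^sup>2 - pi\<^sup>2 / 6"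
    by (simp_all add: v_def Li_two_one Li_two_minus_one)
qed

lemma Li_three_difference_moebius:
  fixes w :: real
  assumes w: "0 \<le> w" "w < 1"
  defines "v \<equiv> (1 - w) / (1 + w)"
  shows "Li 3 v - Li 3 (- v) = 2 * Li 3 (1 - w) + 2 * Li 3 (1 / (1 + w)) - Li 3 (1 - w\<^sup>2) / 2
           - 7 / 4 * Li 3 1 - ln (1 + w) ^ 3 / 3 + pi\<^sup>2 / 6 * ln (1 + w)"
proof -
  let ?v = "\<lambda>w::real. (1 - w) / (1 + w)"
  let ?e = "\<lambda>w::real. ln (1 + w) ^ 3 / 3 - pi\<^sup>2 / 6 * ln (1 + w)"
  let ?f = "\<lambda>w. Li 3 (?v w) - Li 3 (- ?v w) - 2 * Li 3 (1 - w) - 2 * Li 3 (1 / (1 + w))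
              + 1 / 2 * Li 3 (1 - w\<^sup>2) + ?e w"
  have "?f w = ?f 0"
  proof (rule DERIV_zero_eq_left[OF w(1) order.refl])
    show "continuous_on {0..w} ?f"
      using w by (auto intro!: continuous_intros continuous_on_Li
                    simp: field_simps abs_le_iff power_le_one abs_square_le_1)
    fix y assume y: "0 < y" "y < w"
    have y': "0 < y" "y < 1"
      using y w by auto
    have sq: "y\<^sup>2 < 1" "y\<^sup>2 > 0" "1 - y\<^sup>2 \<noteq> 0"
      using y' by (auto simp: abs_square_less_1 power2_eq_1_iff)
    define q r where "q = 1 / (1 - y)" and "r = 1 / (1 + y)"
    note b = moebius_involution_bounds[OF y']
    note d = moebius_involution_deriv[OF y', folded q_def r_def]
    have d1: "((\<lambda>w. Li 3 (?v w)) has_field_derivative Li 2 (?v y) * (- (q + r))) (at y)"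
      by (rule Li_three_dlog[OF d(1)]) (use b y' in auto)
    have d2: "((\<lambda>w. Li 3 (- ?v w)) has_field_derivative Li 2 (- ?v y) * (- (q + r))) (at y)"
      by (rule Li_three_dlog) (use b y' DERIV_minus[OF d(1)] in auto)
    have d3: "((\<lambda>w. Li 3 (1 - w)) has_field_derivative Li 2 (1 - y) * - q) (at y)"
      by (rule Li_three_dlog) (use y' in \<open>auto intro!: derivative_eq_intros simp: q_def\<close>)
    have d4: "((\<lambda>w. Li 3 (1 / (1 + w))) has_field_derivative Li 2 (1 / (1 + y)) * - r) (at y)"
      by (rule Li_three_dlog) (use d(2) y' in \<open>auto simp: r_def\<close>)
    have d5: "((\<lambda>w. Li 3 (1 - w\<^sup>2)) has_field_derivative Li 2 (1 - y\<^sup>2) * (- q + r)) (at y)"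
      by (rule Li_three_dlog[OF d(3)]) (use y' sq in auto)
    have d6: "(?e has_field_derivative (ln (1 + y))\<^sup>2 * r - pi\<^sup>2 / 6 * r) (at y)"
      using y' by (auto intro!: derivative_eq_intros simp: r_def divide_simps; simp add: algebra_simps)
    note D = DERIV_add[OF DERIV_add[OF DERIV_diff[OF DERIV_diff[OF DERIV_diff[OF d1 d2]
        DERIV_cmult[OF d3, of 2]] DERIV_cmult[OF d4, of 2]] DERIV_cmult[OF d5, of "1 / 2"]] d6]
    have e: "2 * Li 2 (1 - y) = Li 2 (?v y) - Li 2 (- ?v y) + Li 2 (1 - y\<^sup>2) / 2"
      "2 * Li 2 (1 / (1 + y)) = Li 2 (?v y) - Li 2 (- ?v y) - Li 2 (1 - y\<^sup>2) / 2 - (ln (1 + y))\<^sup>2 + pi\<^sup>2 / 6"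
      using Li_two_difference_moebius[of y] y' by auto
    show "(?f has_field_derivative 0) (at y)"
    proof (rule DERIV_cong[OF D])
      have "Li 2 (?v y) * (- (q + r)) - Li 2 (- ?v y) * (- (q + r)) - 2 * (Li 2 (1 - y) * - q)
            - 2 * (Li 2 (1 / (1 + y)) * - r) + 1 / 2 * (Li 2 (1 - y\<^sup>2) * (- q + r))
            + ((ln (1 + y))\<^sup>2 * r - pi\<^sup>2 / 6 * r)
          = Li 2 (?v y) * (- (q + r)) - Li 2 (- ?v y) * (- (q + r)) + (2 * Li 2 (1 - y)) * q
            + (2 * Li 2 (1 / (1 + y))) * r + 1 / 2 * (Li 2 (1 - y\<^sup>2) * (- q + r))
            + ((ln (1 + y))\<^sup>2 * r - pi\<^sup>2 / 6 * r)"
        by simp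
      also have "\<dots> = 0"
        unfolding e by (simp add: algebra_simps)
      finally show "Li 2 (?v y) * (- (q + r)) - Li 2 (- ?v y) * (- (q + r)) - 2 * (Li 2 (1 - y) * - q)
            - 2 * (Li 2 (1 / (1 + y)) * - r) + 1 / 2 * (Li 2 (1 - y\<^sup>2) * (- q + r))
            + ((ln (1 + y))\<^sup>2 * r - pi\<^sup>2 / 6 * r) = 0" .
    qed
  qed
  then show ?thesis
    by (simp add: v_def Li_three_minus_one)
qed

section \<open>Kummer's equation with second variable 1/2\<close>

lemma kummer_bounds:
  fixes y :: real
  assumes "0 \<le> y" "y < 1 / 2"
  shows "\<bar>y / (2 * (1 - y)\<^sup>2)\<bar> < 1" "\<bar>y / 2\<bar> < 1" "\<bar>2 * y\<bar> < 1" "\<bar>y / (1 - y)\<bar> < 1"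
    "\<bar>y / (2 * (y - 1))\<bar> < 1" "\<bar>1 / (2 * (1 - y))\<bar> < 1" "\<bar>y\<bar> < 1" "\<bar>y - 1\<bar> \<le> 1"
proof -
  \<comment> \<open>The product expands to 2 (1 - y)^2 - y, the gap between denominator and
    numerator of the first argument.\<close>
  have "(2 - y) * (1 - 2 * y) > 0"
    using assms by (intro mult_pos_pos) auto
  then have "y < 2 * (1 - y)\<^sup>2"
    by (simp add: algebra_simps power2_eq_square)
  then show "\<bar>y / (2 * (1 - y)\<^sup>2)\<bar> < 1"
    using assms by simp
qed (use assms in \<open>auto simp: field_simps abs_less_iff\<close>)

lemma kummer_ln:
  fixes y :: real
  assumes "0 \<le> y" "y < 1 / 2"
  defines "L \<equiv> ln (1 - y)" and "P \<equiv> ln (2 - y)" and "Q \<equiv> ln (1 - 2 * y)"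
  shows "ln (1 - y / (2 * (1 - y)\<^sup>2)) = P + Q - ln 2 - 2 * L"
    and "ln (1 - y / 2) = P - ln 2"
    and "ln (1 - y / (1 - y)) = Q - L"
    and "ln (1 - y / (2 * (y - 1))) = P - ln 2 - L"
    and "ln (1 - 1 / (2 * (1 - y))) = Q - ln 2 - L"
proof -
  have e: "1 - y / (2 * (1 - y)\<^sup>2) = (2 - y) * (1 - 2 * y) / (2 * (1 - y)\<^sup>2)"
    "1 - y / 2 = (2 - y) / 2" "1 - y / (1 - y) = (1 - 2 * y) / (1 - y)"
    "1 - y / (2 * (y - 1)) = (2 - y) / (2 * (1 - y))"
    "1 - 1 / (2 * (1 - y)) = (1 - 2 * y) / (2 * (1 - y))"
    using assms(1,2) by (simp_all add: divide_simps) (simp_all add: algebra_simps power2_eq_square)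
  show "ln (1 - y / (2 * (1 - y)\<^sup>2)) = P + Q - ln 2 - 2 * L"
    "ln (1 - y / 2) = P - ln 2"
    "ln (1 - y / (1 - y)) = Q - L"
    "ln (1 - y / (2 * (y - 1))) = P - ln 2 - L"
    "ln (1 - 1 / (2 * (1 - y))) = Q - ln 2 - L"
    unfolding e L_def P_def Q_def using assms(1,2) by (simp_all add: ln_div ln_mult ln_realpow del: right_diff_distrib_numeral)
qed

text \<open>Every argument is a constant times a product of powers of y and 1 - y, so its
  logarithmic derivative is an integer combination of \<open>p\<close> and \<open>q\<close>.\<close>

lemma kummer_deriv:
  fixes y :: real
  assumes "0 < y" "y < 1 / 2"
  defines "p \<equiv> 1 / y" and "q \<equiv> 1 / (1 - y)"
  shows "((\<lambda>y. y / (2 * (1 - y)\<^sup>2)) has_field_derivative (p + 2 * q) * (y / (2 * (1 - y)\<^sup>2))) (at y)"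
    and "((\<lambda>y. y / 2) has_field_derivative p * (y / 2)) (at y)"
    and "((\<lambda>y. 2 * y) has_field_derivative p * (2 * y)) (at y)"
    and "((\<lambda>y. y / (1 - y)) has_field_derivative (p + q) * (y / (1 - y))) (at y)"
    and "((\<lambda>y. y / (2 * (y - 1))) has_field_derivative (p + q) * (y / (2 * (y - 1)))) (at y)"
    and "((\<lambda>y. 1 / (2 * (1 - y))) has_field_derivative q * (1 / (2 * (1 - y)))) (at y)"
    and "((\<lambda>y. y - 1) has_field_derivative - q * (y - 1)) (at y)"
    and "((\<lambda>y. y) has_field_derivative p * y) (at y)"
proof -
  have d: "((\<lambda>y. y / (2 * (1 - y)\<^sup>2)) has_field_derivative
          (1 * (2 * (1 - y)\<^sup>2) - y * (2 * (2 * (1 - y) * - 1))) / ((2 * (1 - y)\<^sup>2) * (2 * (1 - y)\<^sup>2))) (at y)"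
    using assms(1,2) by (intro DERIV_divide DERIV_ident) (auto intro!: derivative_eq_intros)
  have e: "(1 * (2 * u\<^sup>2) - y * (2 * (2 * u * - 1))) / ((2 * u\<^sup>2) * (2 * u\<^sup>2))
      = (1 / y + 2 * (1 / u)) * (y / (2 * u\<^sup>2))" if "u \<noteq> 0" for u
    using assms(1,2) that
    by (simp add: divide_simps) (simp add: algebra_simps power2_eq_square power4_eq_xxxx)
  show "((\<lambda>y. y / (2 * (1 - y)\<^sup>2)) has_field_derivative (p + 2 * q) * (y / (2 * (1 - y)\<^sup>2))) (at y)"
    unfolding p_def q_def by (rule DERIV_cong[OF d e]) (use assms(1,2) in simp)
  show "((\<lambda>y. y / (1 - y)) has_field_derivative (p + q) * (y / (1 - y))) (at y)"
    unfolding p_def q_def using assms(1,2)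
    by (auto intro!: derivative_eq_intros simp: divide_simps; simp add: algebra_simps)
  show "((\<lambda>y. y / (2 * (y - 1))) has_field_derivative (p + q) * (y / (2 * (y - 1)))) (at y)"
    unfolding p_def q_def using assms(1,2)
    by (auto intro!: derivative_eq_intros simp: divide_simps; simp add: algebra_simps)
  show "((\<lambda>y. 1 / (2 * (1 - y))) has_field_derivative q * (1 / (2 * (1 - y)))) (at y)"
    unfolding q_def using assms(1,2)
    by (auto intro!: derivative_eq_intros simp: divide_simps; simp add: algebra_simps)
  show "((\<lambda>y. y - 1) has_field_derivative - q * (y - 1)) (at y)"
    unfolding q_def using assms(1,2) by (auto intro!: derivative_eq_intros simp: divide_simps)
qed (use assms(1,2) in \<open>auto intro!: derivative_eq_intros simp: p_def\<close>)

text \<open>The coefficients of \<open>1 / x\<close> and \<open>1 / (1 - x)\<close> in the derivative of the trilogarithmic identity below.\<close>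

lemma Li_two_kummer:
  fixes x :: real
  assumes x: "0 \<le> x" "x < 1 / 2"
  shows "Li 2 (x / (2 * (1 - x)\<^sup>2)) + Li 2 (x / 2) + Li 2 (2 * x) - 2 * Li 2 (x / (1 - x))
           - 2 * Li 2 (x / (2 * (x - 1))) - 2 * Li 2 x = 0"
    and "Li 2 (x / (2 * (1 - x)\<^sup>2)) - Li 2 (x / (1 - x)) - Li 2 (x / (2 * (x - 1)))
           - Li 2 (1 / (2 * (1 - x))) + Li 2 (x - 1) = - (ln (1 - x))\<^sup>2 / 2 - pi\<^sup>2 / 6 + (ln 2)\<^sup>2 / 2"
proof -
  let ?g = "\<lambda>x::real. Li 2 (x / (2 * (1 - x)\<^sup>2)) + Li 2 (x / 2) + Li 2 (2 * x) - 2 * Li 2 (x / (1 - x))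
           - 2 * Li 2 (x / (2 * (x - 1))) - 2 * Li 2 x"
  let ?h = "\<lambda>x::real. Li 2 (x / (2 * (1 - x)\<^sup>2)) - Li 2 (x / (1 - x)) - Li 2 (x / (2 * (x - 1)))
           - Li 2 (1 / (2 * (1 - x))) + Li 2 (x - 1) + (ln (1 - x))\<^sup>2 / 2"
  have b: "0 \<le> y \<and> y < 1 / 2" if "y \<in> {0..x}" for y
    using that x by auto
  have c: "continuous_on {0..x} ?g" "continuous_on {0..x} ?h"
    using x by (intro continuous_intros continuous_on_Li; use kummer_bounds[OF conjunct1[OF b] conjunct2[OF b]] in force)+
  have "(?g has_field_derivative 0) (at y) \<and> (?h has_field_derivative 0) (at y)"
    if y: "0 < y" "y < x" for y
  proof -
    have y': "0 < y" "0 \<le> y" "y < 1 / 2"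
      using y x by auto
    define p q where "p = 1 / y" and "q = 1 / (1 - y)"
    define L P Q where "L = ln (1 - y)" and "P = ln (2 - y)" and "Q = ln (1 - 2 * y)"
    note b = kummer_bounds[OF y'(2,3)]
    note l = kummer_ln[OF y'(2,3), folded L_def P_def Q_def]
    note d = kummer_deriv[OF y'(1,3), folded p_def]
    have d1: "((\<lambda>y. Li 2 (y / (2 * (1 - y)\<^sup>2))) has_field_derivative - (P + Q - ln 2 - 2 * L) * (p + 2 * q)) (at y)"
      by (rule Li_two_dlog) (use d b l y' in \<open>auto simp: q_def\<close>)
    have d2: "((\<lambda>y. Li 2 (y / 2)) has_field_derivative - (P - ln 2) * p) (at y)"
      by (rule Li_two_dlog) (use d b l y' in auto)
    have d3: "((\<lambda>y. Li 2 (2 * y)) has_field_derivative - Q * p) (at y)"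
      by (rule Li_two_dlog) (use d b y' in \<open>auto simp: Q_def\<close>)
    have d4: "((\<lambda>y. Li 2 (y / (1 - y))) has_field_derivative - (Q - L) * (p + q)) (at y)"
      by (rule Li_two_dlog) (use d b l y' in \<open>auto simp: q_def\<close>)
    have d5: "((\<lambda>y. Li 2 (y / (2 * (y - 1)))) has_field_derivative - (P - ln 2 - L) * (p + q)) (at y)"
      by (rule Li_two_dlog) (use d(5) b(5) l(4) y' in \<open>auto simp: q_def\<close>)
    have d6: "((\<lambda>y. Li 2 (1 / (2 * (1 - y)))) has_field_derivative - (Q - ln 2 - L) * q) (at y)"
      unfolding q_def by (rule Li_two_dlog) (use d(6) b(6) l(5) y' in \<open>auto\<close>)
    have d7: "((\<lambda>y. Li 2 (y - 1)) has_field_derivative - P * - q) (at y)"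
      by (rule Li_two_dlog) (use d(7) y' in \<open>auto simp: P_def q_def\<close>)
    have d8: "((\<lambda>y. Li 2 y) has_field_derivative - L * p) (at y)"
      by (rule Li_two_dlog) (use d(8) y' in \<open>auto simp: L_def\<close>)
    have d9: "((\<lambda>y. (ln (1 - y))\<^sup>2 / 2) has_field_derivative - L * q) (at y)"
      using y' by (auto intro!: derivative_eq_intros simp: q_def L_def divide_simps)
    show ?thesis
      using DERIV_diff[OF DERIV_diff[OF DERIV_diff[OF DERIV_add[OF DERIV_add[OF d1 d2] d3]
          DERIV_cmult[OF d4, of 2]] DERIV_cmult[OF d5, of 2]] DERIV_cmult[OF d8, of 2]]
        DERIV_add[OF DERIV_add[OF DERIV_diff[OF DERIV_diff[OF DERIV_diff[OF d1 d4] d5] d6] d7] d9]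
      by (auto elim!: DERIV_cong simp: algebra_simps)
  qed
  \<comment> \<open>At 0 all terms of \<open>?g\<close> vanish, and those of \<open>?h\<close> leave
    Li_2(-1) - Li_2(1/2), which gives the constant.\<close>
  then have "?g x = ?g 0" "?h x = ?h 0"
    using DERIV_zero_eq_left[OF x(1) order.refl c(1)] DERIV_zero_eq_left[OF x(1) order.refl c(2)]
    by blast+
  then show "Li 2 (x / (2 * (1 - x)\<^sup>2)) + Li 2 (x / 2) + Li 2 (2 * x) - 2 * Li 2 (x / (1 - x))
           - 2 * Li 2 (x / (2 * (x - 1))) - 2 * Li 2 x = 0"
    "Li 2 (x / (2 * (1 - x)\<^sup>2)) - Li 2 (x / (1 - x)) - Li 2 (x / (2 * (x - 1)))
           - Li 2 (1 / (2 * (1 - x))) + Li 2 (x - 1) = - (ln (1 - x))\<^sup>2 / 2 - pi\<^sup>2 / 6 + (ln 2)\<^sup>2 / 2"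
    by (simp_all add: Li_half Li_two_minus_one)
qed

lemma Li_three_kummer:
  fixes x :: real
  assumes x: "0 \<le> x" "x < 1 / 2"
  shows "Li 3 (x / (2 * (1 - x)\<^sup>2)) + Li 3 (x / 2) + Li 3 (2 * x) - 2 * Li 3 (x / (1 - x))
           - 2 * Li 3 (x / (2 * (x - 1))) - 2 * Li 3 (1 / (2 * (1 - x))) - 2 * Li 3 (x - 1) - 2 * Li 3 x
         = ln (1 - x) ^ 3 / 3 + (pi\<^sup>2 / 3 - (ln 2)\<^sup>2) * ln (1 - x) - 2 * Li 3 (1 / 2) - 2 * Li 3 (- 1)"
proof -
  let ?e = "\<lambda>x::real. ln (1 - x) ^ 3 / 3 + (pi\<^sup>2 / 3 - (ln 2)\<^sup>2) * ln (1 - x)"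
  let ?f = "\<lambda>x::real. Li 3 (x / (2 * (1 - x)\<^sup>2)) + Li 3 (x / 2) + Li 3 (2 * x) - 2 * Li 3 (x / (1 - x))
           - 2 * Li 3 (x / (2 * (x - 1))) - 2 * Li 3 (1 / (2 * (1 - x))) - 2 * Li 3 (x - 1) - 2 * Li 3 x - ?e x"
  have b: "0 \<le> y \<and> y < 1 / 2" if "y \<in> {0..x}" for y
    using that x by auto
  have "?f x = ?f 0"
  proof (rule DERIV_zero_eq_left[OF x(1) order.refl])
    show "continuous_on {0..x} ?f"
      using x by (intro continuous_intros continuous_on_Li; use kummer_bounds[OF conjunct1[OF b] conjunct2[OF b]] in force)
    fix y assume y: "0 < y" "y < x"
    have y': "0 < y" "0 \<le> y" "y < 1 / 2"
      using y x by auto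
    define p q where "p = 1 / y" and "q = 1 / (1 - y)"
    note b = kummer_bounds[OF y'(2,3)]
    note d = kummer_deriv[OF y'(1,3), folded p_def]
    have d1: "((\<lambda>y. Li 3 (y / (2 * (1 - y)\<^sup>2))) has_field_derivative Li 2 (y / (2 * (1 - y)\<^sup>2)) * (p + 2 * q)) (at y)"
      by (rule Li_three_dlog) (use d b y' in \<open>auto simp: q_def\<close>)
    have d2: "((\<lambda>y. Li 3 (y / 2)) has_field_derivative Li 2 (y / 2) * p) (at y)"
      by (rule Li_three_dlog) (use d b y' in auto)
    have d3: "((\<lambda>y. Li 3 (2 * y)) has_field_derivative Li 2 (2 * y) * p) (at y)"
      by (rule Li_three_dlog) (use d b y' in auto)
    have d4: "((\<lambda>y. Li 3 (y / (1 - y))) has_field_derivative Li 2 (y / (1 - y)) * (p + q)) (at y)"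
      by (rule Li_three_dlog) (use d b y' in \<open>auto simp: q_def\<close>)
    have d5: "((\<lambda>y. Li 3 (y / (2 * (y - 1)))) has_field_derivative Li 2 (y / (2 * (y - 1))) * (p + q)) (at y)"
      by (rule Li_three_dlog) (use d(5) b(5) y' in \<open>auto simp: q_def\<close>)
    have d6: "((\<lambda>y. Li 3 (1 / (2 * (1 - y)))) has_field_derivative Li 2 (1 / (2 * (1 - y))) * q) (at y)"
      unfolding q_def by (rule Li_three_dlog) (use d(6) b(6) y' in \<open>auto\<close>)
    have d7: "((\<lambda>y. Li 3 (y - 1)) has_field_derivative Li 2 (y - 1) * - q) (at y)"
      by (rule Li_three_dlog) (use d(7) y' in \<open>auto simp: q_def\<close>)
    have d8: "((\<lambda>y. Li 3 y) has_field_derivative Li 2 y * p) (at y)"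
      by (rule Li_three_dlog) (use d(8) y' in auto)
    have d9: "(?e has_field_derivative - (ln (1 - y))\<^sup>2 * q - (pi\<^sup>2 / 3 - (ln 2)\<^sup>2) * q) (at y)"
      using y' by (auto intro!: derivative_eq_intros simp: q_def divide_simps; simp add: algebra_simps)
    note D = DERIV_diff[OF DERIV_diff[OF DERIV_diff[OF DERIV_diff[OF DERIV_diff[OF DERIV_diff[OF
        DERIV_add[OF DERIV_add[OF d1 d2] d3] DERIV_cmult[OF d4, of 2]] DERIV_cmult[OF d5, of 2]]
        DERIV_cmult[OF d6, of 2]] DERIV_cmult[OF d7, of 2]] DERIV_cmult[OF d8, of 2]] d9]
    \<comment> \<open>In the derivative \<open>Li 2 (2 * y)\<close> occurs only with
      \<open>p\<close> and \<open>Li 2 (y - 1)\<close> only with \<open>q\<close>; eliminating these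
      two therefore annihilates both coefficients.\<close>
    have e: "Li 2 (2 * y) = - Li 2 (y / (2 * (1 - y)\<^sup>2)) - Li 2 (y / 2) + 2 * Li 2 (y / (1 - y))
           + 2 * Li 2 (y / (2 * (y - 1))) + 2 * Li 2 y"
      "Li 2 (y - 1) = - Li 2 (y / (2 * (1 - y)\<^sup>2)) + Li 2 (y / (1 - y)) + Li 2 (y / (2 * (y - 1)))
           + Li 2 (1 / (2 * (1 - y))) - (ln (1 - y))\<^sup>2 / 2 - pi\<^sup>2 / 6 + (ln 2)\<^sup>2 / 2"
      using Li_two_kummer[OF y'(2,3)] by linarith+
    show "(?f has_field_derivative 0) (at y)"
      by (rule DERIV_cong[OF D], unfold e) (simp add: algebra_simps)
  qed
  then show ?thesis
    by simp
qed

section \<open>The central binomial series\<close>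

text \<open>The coefficients of \<open>arsinh y / sqrt (1 + y\<^sup>2)\<close> and of its primitives with respect to \<open>dy / y\<close>.\<close>

definition ccoeff :: "nat \<Rightarrow> real" where
  "ccoeff m = (- 1) ^ m * 4 ^ m / real ((2 * m) choose m)"

definition acoeff :: "nat \<Rightarrow> nat \<Rightarrow> real" where
  "acoeff k n = (if odd n then ccoeff (n div 2) / real n ^ k else 0)"

definition aseries :: "nat \<Rightarrow> real \<Rightarrow> real" where
  "aseries k y = (\<Sum>n. acoeff k n * y ^ n)"

lemma ccoeff_0 [simp]: "ccoeff 0 = 1"
  by (simp add: ccoeff_def)

text \<open>The ratio is written as 1 + 1/(2m+1) because with n = 2m+1 it becomes
  \<open>acoeff 0 (n + 2) = - (acoeff 0 n + acoeff 1 n)\<close>, the source of the differential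
  equation below.\<close>

lemma ccoeff_Suc: "ccoeff (Suc m) = - ccoeff m * (1 + 1 / real (2 * m + 1))"
proof -
  have "Suc m * ((2 * Suc m) choose (Suc m)) = 2 * (2 * m + 1) * ((2 * m) choose m)"
  proof -
    have "Suc m * ((2 * Suc m) choose (Suc m)) = Suc (2 * m + 1) * ((2 * m + 1) choose m)"
      using Suc_times_binomial_eq[of "2 * m + 1" m] by (simp add: mult.commute)
    also have "\<dots> = 2 * (Suc m * ((2 * m + 1) choose m))"
      by simp
    also have "(2 * m + 1) choose m = (2 * m + 1) choose (Suc m)"
      using binomial_symmetric[of "Suc m" "Suc (2 * m)"] by simp
    also have "Suc m * ((2 * m + 1) choose (Suc m)) = (2 * m + 1) * ((2 * m) choose m)"
      using Suc_times_binomial_eq[of "2 * m" m] by (simp only: mult.commute Suc_eq_plus1)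
    finally show ?thesis
      by (simp only: mult.assoc)
  qed
  then have "real (Suc m * ((2 * Suc m) choose (Suc m))) = real (2 * (2 * m + 1) * ((2 * m) choose m))"
    by (rule arg_cong)
  moreover define B C where "B = real ((2 * m) choose m)" and "C = real ((2 * Suc m) choose (Suc m))"
  ultimately have C: "C = 2 * real (2 * m + 1) * B / real (Suc m)"
    by (simp only: of_nat_mult B_def C_def) (simp add: field_simps)
  have "B > 0"
    by (simp add: B_def)
  then show ?thesis
    unfolding ccoeff_def B_def[symmetric] C_def[symmetric] C
    by (simp add: divide_simps) (simp add: algebra_simps)
qed

lemma abs_ccoeff_le: "\<bar>ccoeff m\<bar> \<le> 2 * real m + 1"
proof (cases "m = 0")
  case False
  have "4 ^ m / (2 * real m) \<le> real ((2 * m) choose m)"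
    using False by (intro central_binomial_lower_bound) auto
  moreover have "real ((2 * m) choose m) > 0"
    by simp
  ultimately have "4 ^ m / real ((2 * m) choose m) \<le> 2 * real m"
    using False by (simp add: divide_simps mult_ac)
  then show ?thesis
    by (simp add: ccoeff_def abs_mult power_abs)
qed simp

lemma acoeff_bounded: "poly_bounded (acoeff k)"
proof (rule poly_boundedI)
  fix n
  show "norm (acoeff k n) \<le> 1 * real (Suc n) ^ 1"
  proof (cases "odd n")
    case True
    then have n: "real n \<ge> 1" "2 * real (n div 2) + 1 = real n"
      by (auto elim!: oddE)
    have "\<bar>ccoeff (n div 2)\<bar> / real n ^ k \<le> real n / 1"
      using n abs_ccoeff_le[of "n div 2"] by (intro frac_le one_le_power) auto
    then show ?thesis
      using True n by (simp add: acoeff_def)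
  qed (simp add: acoeff_def)
qed

lemma acoeff_times_n: "real n * acoeff (Suc k) n = acoeff k n"
  by (cases "n = 0") (auto simp: acoeff_def)

lemma aseries_0 [simp]: "aseries k 0 = 0"
  unfolding aseries_def by (subst powser_zero) (simp add: acoeff_def)

lemma aseries_dlog:
  assumes "(g has_field_derivative d * g x) (at x)" "\<bar>g x\<bar> < 1" "g x \<noteq> 0"
  shows "((\<lambda>x. aseries (Suc k) (g x)) has_field_derivative aseries k (g x) * d) (at x)"
proof -
  have "(aseries (Suc k) has_field_derivative aseries k (g x) / g x) (at (g x))"
    using powser_deriv[OF acoeff_bounded[of "Suc k"], of "g x"] assms(2,3)
    by (simp add: aseries_def[abs_def] acoeff_times_n)
  from DERIV_chain2[OF this assms(1)] show ?thesis
    using assms(3) by simp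
qed

lemma continuous_on_aseries [continuous_intros]:
  assumes "continuous_on A g" "\<And>x. x \<in> A \<Longrightarrow> \<bar>g x\<bar> < 1"
  shows "continuous_on A (\<lambda>x. aseries k (g x))"
proof -
  have "continuous_on {-1<..<1} (aseries k)"
    unfolding aseries_def[abs_def]
    by (intro continuous_at_imp_continuous_on ballI powser_isCont acoeff_bounded) auto
  then show ?thesis
    by (rule continuous_on_compose2[OF _ assms(1)]) (use assms(2) in \<open>auto simp: abs_less_iff minus_less_iff\<close>)
qed

text \<open>As \<open>aseries 0\<close> is y times the derivative of f = \<open>aseries 1\<close>,
  this is (1 + y^2) f' + y f = 1, multiplied by y.\<close>

lemma aseries_ode:
  assumes "\<bar>y\<bar> < 1"
  shows "(1 + y\<^sup>2) * aseries 0 y + y\<^sup>2 * aseries 1 y = y"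
proof -
  have s: "summable (\<lambda>n. acoeff k n * y ^ n)" for k
    using assms by (intro poly_bounded_summable acoeff_bounded) auto
  have rec: "acoeff 0 (n + 2) = - (acoeff 0 n + acoeff 1 n)" for n
  proof (cases "odd n")
    case True
    then obtain m where "n = 2 * m + 1"
      by (elim oddE)
    then show ?thesis
      by (simp add: acoeff_def ccoeff_Suc field_simps)
  qed (simp add: acoeff_def)
  have "aseries 0 y = (\<Sum>n. acoeff 0 (n + 2) * y ^ (n + 2)) + (\<Sum>n<2. acoeff 0 n * y ^ n)"
    unfolding aseries_def by (rule suminf_split_initial_segment[OF s])
  also have "(\<Sum>n<2. acoeff 0 n * y ^ n) = y"
    by (simp add: numeral_2_eq_2 acoeff_def)
  also have "(\<Sum>n. acoeff 0 (n + 2) * y ^ (n + 2)) = (\<Sum>n. - y\<^sup>2 * (acoeff 0 n * y ^ n + acoeff 1 n * y ^ n))"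
    unfolding rec by (simp add: power_add algebra_simps power2_eq_square)
  also have "\<dots> = - y\<^sup>2 * (aseries 0 y + aseries 1 y)"
    unfolding aseries_def by (subst suminf_mult) (use s in \<open>auto intro!: summable_add suminf_add[symmetric]\<close>)
  finally show ?thesis
    by (simp add: algebra_simps)
qed

text \<open>The integrating factor is sqrt (1 + y^2): by the differential equation the derivative of
  the product is 1 / sqrt (1 + y^2), that of \<open>arsinh\<close>.\<close>

lemma aseries_one_eq:
  assumes "0 \<le> y" "y < 1"
  shows "aseries 1 y * sqrt (1 + y\<^sup>2) = arsinh y"
proof -
  let ?f = "\<lambda>y. aseries 1 y * sqrt (1 + y\<^sup>2) - arsinh y"
  have "?f y = ?f 0"
  proof (rule DERIV_zero_eq_left[OF assms(1) order.refl])
    show "continuous_on {0..y} ?f"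
      using assms by (intro continuous_intros) auto
    fix x assume x: "0 < x" "x < y"
    define s where "s = sqrt (1 + x\<^sup>2)"
    have pos: "1 + x\<^sup>2 > 0"
      by (simp add: add_pos_nonneg)
    then have s: "s > 0" "s * s = 1 + x\<^sup>2"
      by (auto simp: s_def)
    have d1: "((\<lambda>y. aseries 1 y) has_field_derivative aseries 0 x * (1 / x)) (at x)"
      unfolding One_nat_def by (rule aseries_dlog) (use x assms in auto)
    have d2: "((\<lambda>y. sqrt (1 + y\<^sup>2)) has_field_derivative x / s) (at x)"
      using pos by (auto intro!: derivative_eq_intros simp: s_def field_simps)
    have d3: "(arsinh has_field_derivative 1 / s) (at x)"
      by (auto intro!: derivative_eq_intros simp: s_def add.commute)
    show "(?f has_field_derivative 0) (at x)"
    proof (rule DERIV_cong[OF DERIV_diff[OF DERIV_mult[OF d1 d2] d3]])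
      have "aseries 0 x * (1 / x) * s + x / s * aseries 1 x - 1 / s =
            (s * s * aseries 0 x + x\<^sup>2 * aseries 1 x - x) / (x * s)"
        using x s(1) by (simp add: divide_simps) (simp add: algebra_simps power2_eq_square)
      also have "\<dots> = 0"
        using aseries_ode[of x] x assms s by simp
      finally show "aseries 0 x * (1 / x) * sqrt (1 + x\<^sup>2) + x / s * aseries 1 x - 1 / s = 0"
        by (simp add: s_def)
    qed
  qed
  then show ?thesis by simp
qed

section \<open>The substitution y = 2 v / (1 - v^2)\<close>

lemma double_arg_bounds:
  fixes v :: real
  assumes "0 \<le> v" "v \<le> 1 / 4"
  shows "\<bar>2 * v / (1 - v\<^sup>2)\<bar> < 1" "v\<^sup>2 < 1"
proof -
  \<comment> \<open>The range up to 1/4 contains phi^-3 = 0.236..., and on it the argument is at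
    most 8/15.\<close>
  have "v * v \<le> 1 / 4 * (1 / 4)"
    using assms by (intro mult_mono) auto
  then show "\<bar>2 * v / (1 - v\<^sup>2)\<bar> < 1" "v\<^sup>2 < 1"
    using assms by (auto simp: power2_eq_square field_simps abs_less_iff)
qed

lemma double_arg_deriv:
  fixes v :: real
  assumes "0 < v" "v < 1"
  shows "((\<lambda>v. 2 * v / (1 - v\<^sup>2)) has_field_derivative
           (1 / v + 1 / (1 - v) - 1 / (1 + v)) * (2 * v / (1 - v\<^sup>2))) (at v)"
proof -
  have e: "1 - x\<^sup>2 = (1 - x) * (1 + x)" for x :: real
    by (simp add: algebra_simps power2_eq_square)
  show ?thesis
    unfolding e using assms
    by (auto intro!: derivative_eq_intros simp: divide_simps; simp add: algebra_simps)
qed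

text \<open>The substitution makes 1 + y^2 the square of (1 + v^2) / (1 - v^2) and
  \<open>arsinh y\<close> equal to 2 artanh v. Since dy / y is (1 + v^2) / (1 - v^2) times dv / v,
  the square root disappears.\<close>

lemma aseries_one_double_arg:
  fixes v :: real
  assumes "0 < v" "v \<le> 1 / 4"
  shows "aseries 1 (2 * v / (1 - v\<^sup>2)) * (1 / v + 1 / (1 - v) - 1 / (1 + v)) = (ln (1 + v) - ln (1 - v)) / v"
proof -
  define y where "y = 2 * v / (1 - v\<^sup>2)"
  have v: "1 - v\<^sup>2 > 0" "1 - v\<^sup>2 = (1 - v) * (1 + v)" "1 - v > 0" "1 + v > 0"
    using double_arg_bounds[of v] assms by (auto simp: algebra_simps power2_eq_square)
  have y: "0 \<le> y" "y < 1"
    using double_arg_bounds[of v] assms v by (auto simp: y_def abs_less_iff)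
  have "1 + y\<^sup>2 = ((1 + v\<^sup>2) / (1 - v\<^sup>2))\<^sup>2"
    unfolding y_def using v(1) by (simp add: power_divide divide_simps) (simp add: algebra_simps power2_eq_square)
  then have sq: "sqrt (1 + y\<^sup>2) = (1 + v\<^sup>2) / (1 - v\<^sup>2)"
    using v by (simp add: real_sqrt_abs)
  have "y + sqrt (y\<^sup>2 + 1) = (2 * v + (1 + v\<^sup>2)) / (1 - v\<^sup>2)"
    using sq by (simp add: y_def add.commute add_divide_distrib)
  also have "\<dots> = (1 + v) / (1 - v)"
    unfolding v(2) using v(3,4) by (simp add: divide_simps) (simp add: algebra_simps power2_eq_square)
  finally have "arsinh y = ln (1 + v) - ln (1 - v)"
    using v by (simp add: arsinh_real_def ln_div)
  then have "aseries 1 y * ((1 + v\<^sup>2) / (1 - v\<^sup>2)) = ln (1 + v) - ln (1 - v)"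
    using aseries_one_eq[OF y] sq by simp
  moreover have "1 / v + 1 / (1 - v) - 1 / (1 + v) = (1 + v\<^sup>2) / (1 - v\<^sup>2) / v"
    unfolding v(2) using v(3,4) assms by (simp add: divide_simps) (simp add: algebra_simps power2_eq_square)
  moreover have "aseries 1 y * ((1 + v\<^sup>2) / (1 - v\<^sup>2) / v) = aseries 1 y * ((1 + v\<^sup>2) / (1 - v\<^sup>2)) / v"
    by simp
  ultimately show ?thesis
    by (simp only: y_def)
qed

lemma aseries_two_double_arg:
  fixes v :: real
  assumes v: "0 \<le> v" "v \<le> 1 / 4"
  shows "aseries 2 (2 * v / (1 - v\<^sup>2)) = Li 2 v - Li 2 (- v)"
proof -
  let ?f = "\<lambda>v. aseries 2 (2 * v / (1 - v\<^sup>2)) - (Li 2 v - Li 2 (- v))"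
  have b: "\<bar>2 * x / (1 - x\<^sup>2)\<bar> < 1" "1 - x\<^sup>2 \<noteq> 0" "x\<^sup>2 \<noteq> 1" if "x \<in> {0..v}" for x
    using double_arg_bounds[of x] that v by auto
  have "?f v = ?f 0"
  proof (rule DERIV_zero_eq_left[OF v(1) order.refl])
    show "continuous_on {0..v} ?f"
      using v by (intro continuous_intros continuous_on_Li b) (use b(3) v in auto)
    fix x assume x: "0 < x" "x < v"
    have d1: "((\<lambda>v. aseries 2 (2 * v / (1 - v\<^sup>2))) has_field_derivative
        aseries 1 (2 * x / (1 - x\<^sup>2)) * (1 / x + 1 / (1 - x) - 1 / (1 + x))) (at x)"
      unfolding numeral_2_eq_2 One_nat_def
      by (rule aseries_dlog) (use b[of x] double_arg_deriv[of x] x v in \<open>auto simp: numeral_2_eq_2\<close>)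
    have d2: "((\<lambda>v. Li 2 v) has_field_derivative - ln (1 - x) * (1 / x)) (at x)"
      by (rule Li_two_dlog) (use x v in auto)
    have d3: "((\<lambda>v. Li 2 (- v)) has_field_derivative - ln (1 + x) * (1 / x)) (at x)"
      by (rule Li_two_dlog) (use x v in \<open>auto intro!: derivative_eq_intros\<close>)
    show "(?f has_field_derivative 0) (at x)"
      by (rule DERIV_cong[OF DERIV_diff[OF d1 DERIV_diff[OF d2 d3]]])
         (use aseries_one_double_arg[of x] x v in \<open>simp add: diff_divide_distrib\<close>)
  qed
  then show ?thesis by simp
qed

text \<open>The part of dy / y with dv / v integrates to the trilogarithms at \<open>v\<close> and
  \<open>- v\<close>. The rest, integrated by parts against ln (1 - v^2) = \<open>M + P\<close>,
  leaves the integral of (P^2 - M^2) / v; the last two brackets are primitives of P^2 / v and M^2 /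
  v.\<close>

lemma aseries_three_double_arg:
  fixes v :: real
  assumes v: "0 < v" "v \<le> 1 / 4"
  defines "P \<equiv> ln (1 + v)" and "M \<equiv> ln (1 - v)"
  shows "aseries 3 (2 * v / (1 - v\<^sup>2)) = Li 3 v - Li 3 (- v) - (Li 2 v - Li 2 (- v)) * (M + P)
           + (ln v * P\<^sup>2 - 2 / 3 * P ^ 3 - 2 * (P * Li 2 (1 / (1 + v))) - 2 * Li 3 (1 / (1 + v)))
           - (ln v * M\<^sup>2 + 2 * (M * Li 2 (1 - v)) - 2 * Li 3 (1 - v))"
proof -
  let ?y = "\<lambda>v::real. 2 * v / (1 - v\<^sup>2)"
  let ?k = "\<lambda>v::real. (Li 2 v - Li 2 (- v)) * (ln (1 - v) + ln (1 + v))"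
  let ?g = "\<lambda>v::real. ln v * (ln (1 + v))\<^sup>2 - 2 / 3 * ln (1 + v) ^ 3"
  let ?h = "\<lambda>v::real. ln v * (ln (1 - v))\<^sup>2"
  let ?a = "\<lambda>v::real. ln (1 + v) * Li 2 (1 / (1 + v))"
  let ?b = "\<lambda>v::real. ln (1 - v) * Li 2 (1 - v)"
  let ?f = "\<lambda>v. aseries 3 (?y v) - (Li 3 v - Li 3 (- v)) + ?k v
       - (?g v - 2 * ?a v - 2 * Li 3 (1 / (1 + v))) + (?h v + 2 * ?b v - 2 * Li 3 (1 - v))"
  have b: "\<bar>?y x\<bar> < 1" "1 - x\<^sup>2 \<noteq> 0" "x\<^sup>2 \<noteq> 1" if "x \<in> {0..1 / 4}" for x
    using double_arg_bounds[of x] that v by auto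
  have "?f v = 0"
  proof (rule DERIV_zero_tendsto_unique[OF v])
    have "continuous_on {0<..1 / 4} (\<lambda>v. aseries 3 (?y v))"
      by (intro continuous_intros b) (use b(3) in auto)
    moreover have "continuous_on {0<..1 / 4} (\<lambda>v::real. ln v)"
        "continuous_on {0<..1 / 4} (\<lambda>v::real. ln (1 + v))" "continuous_on {0<..1 / 4} (\<lambda>v::real. ln (1 - v))"
      by (intro continuous_intros; force)+
    moreover have "continuous_on {0<..1 / 4} (\<lambda>v::real. Li s v)"
        "continuous_on {0<..1 / 4} (\<lambda>v::real. Li s (- v))"
        "continuous_on {0<..1 / 4} (\<lambda>v::real. Li s (1 - v))"
        "continuous_on {0<..1 / 4} (\<lambda>v::real. Li s (1 / (1 + v)))" if "s \<ge> 2" for s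
      using that by (intro continuous_on_Li continuous_intros; auto)+
    ultimately show "continuous_on {0<..1 / 4} ?f"
      by (intro continuous_on_add continuous_on_diff continuous_on_mult continuous_on_power continuous_on_const) simp_all
    fix x :: real assume x: "0 < x" "x < 1 / 4"
    define p q r where "p = 1 / x" and "q = 1 / (1 - x)" and "r = 1 / (1 + x)"
    have l: "ln (1 - 1 / (1 + x)) = ln x - ln (1 + x)"
      using moebius_involution_ln(3)[of x] x by simp
    note r = moebius_involution_deriv(2)[of x]
    have d1: "((\<lambda>v. aseries 3 (?y v)) has_field_derivative aseries 2 (?y x) * (p + q - r)) (at x)"
      unfolding numeral_3_eq_3 numeral_2_eq_2 p_def q_def r_def
      by (rule aseries_dlog) (use b[of x] double_arg_deriv[of x] x in \<open>auto simp: numeral_2_eq_2\<close>)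
    have d2: "((\<lambda>v. Li 2 v) has_field_derivative - ln (1 - x) * p) (at x)"
      unfolding p_def by (rule Li_two_dlog) (use x in auto)
    have d3: "((\<lambda>v. Li 2 (- v)) has_field_derivative - ln (1 + x) * p) (at x)"
      unfolding p_def by (rule Li_two_dlog) (use x in \<open>auto intro!: derivative_eq_intros\<close>)
    have d4: "((\<lambda>v. Li 3 v) has_field_derivative Li 2 x * p) (at x)"
      unfolding p_def by (rule Li_three_dlog) (use x in auto)
    have d5: "((\<lambda>v. Li 3 (- v)) has_field_derivative Li 2 (- x) * p) (at x)"
      unfolding p_def by (rule Li_three_dlog) (use x in \<open>auto intro!: derivative_eq_intros\<close>)
    have d6: "((\<lambda>v. ln (1 - v)) has_field_derivative - q) (at x)"
      using x by (auto intro!: derivative_eq_intros simp: q_def)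
    have d7: "((\<lambda>v. ln (1 + v)) has_field_derivative r) (at x)"
      using x by (auto intro!: derivative_eq_intros simp: r_def)
    have d8: "(?g has_field_derivative p * (ln (1 + x))\<^sup>2 + 2 * ln x * ln (1 + x) * r - 2 * (ln (1 + x))\<^sup>2 * r) (at x)"
      using x by (auto intro!: derivative_eq_intros simp: r_def p_def divide_simps; simp add: algebra_simps)
    have d9: "(?h has_field_derivative p * (ln (1 - x))\<^sup>2 - 2 * ln x * ln (1 - x) * q) (at x)"
      using x by (auto intro!: derivative_eq_intros simp: q_def p_def)
    have d10: "((\<lambda>v. Li 2 (1 / (1 + v))) has_field_derivative - (ln x - ln (1 + x)) * - r) (at x)"
      unfolding r_def by (rule Li_two_dlog) (use x r l in auto)
    have d11: "((\<lambda>v. Li 3 (1 / (1 + v))) has_field_derivative Li 2 (1 / (1 + x)) * - r) (at x)"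
      unfolding r_def by (rule Li_three_dlog) (use x r in auto)
    have d12: "((\<lambda>v. Li 2 (1 - v)) has_field_derivative - ln x * - q) (at x)"
      unfolding q_def by (rule Li_two_dlog) (use x in \<open>auto intro!: derivative_eq_intros\<close>)
    have d13: "((\<lambda>v. Li 3 (1 - v)) has_field_derivative Li 2 (1 - x) * - q) (at x)"
      unfolding q_def by (rule Li_three_dlog) (use x in \<open>auto intro!: derivative_eq_intros\<close>)
    note D = DERIV_add[OF DERIV_diff[OF DERIV_add[OF DERIV_diff[OF d1 DERIV_diff[OF d4 d5]]
        DERIV_mult[OF DERIV_diff[OF d2 d3] DERIV_add[OF d6 d7]]]
        DERIV_diff[OF DERIV_diff[OF d8 DERIV_cmult[OF DERIV_mult[OF d7 d10], of 2]] DERIV_cmult[OF d11, of 2]]]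
        DERIV_diff[OF DERIV_add[OF d9 DERIV_cmult[OF DERIV_mult[OF d6 d12], of 2]] DERIV_cmult[OF d13, of 2]]]
    have e: "aseries 2 (?y x) = Li 2 x - Li 2 (- x)"
      using aseries_two_double_arg[of x] x by simp
    show "(?f has_field_derivative 0) (at x)"
      by (rule DERIV_cong[OF D], unfold e) (simp add: algebra_simps power2_eq_square)
  next
    have "eventually (\<lambda>x::real. x \<in> {0<..<1/4}) (at_right 0)"
      by (rule eventually_at_right_real) simp
    then have ev: "eventually (\<lambda>x::real. 0 < x \<and> x < 1 / 4) (at_right 0)"
      by (auto elim: eventually_mono)
    have "continuous_on {0..1/4} (\<lambda>v. aseries 3 (?y v))"
      by (intro continuous_intros b) (use b(3) v in auto)
    then have t0: "((\<lambda>v. aseries 3 (?y v)) \<longlongrightarrow> aseries 3 (?y 0)) (at_right 0)"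
      by (intro continuous_on_Icc_at_rightD[of 0 "1/4"]) auto
    have t1: "(?g \<longlongrightarrow> 0) (at_right 0)" "(?h \<longlongrightarrow> 0) (at_right 0)"
      by real_asymp+
    have t2: "((\<lambda>v::real. ln (1 + v)) \<longlongrightarrow> 0) (at_right 0)" "((\<lambda>v::real. ln (1 - v)) \<longlongrightarrow> 0) (at_right 0)"
      by real_asymp+
    have t3: "((\<lambda>v::real. Li s v) \<longlongrightarrow> Li s 0) (at_right 0)"
        "((\<lambda>v::real. Li s (- v)) \<longlongrightarrow> Li s (- 0)) (at_right 0)"
        "((\<lambda>v::real. Li s (1 - v)) \<longlongrightarrow> Li s (1 - 0)) (at_right 0)"
        "((\<lambda>v::real. Li s (1 / (1 + v))) \<longlongrightarrow> Li s (1 / (1 + 0))) (at_right 0)" if "s \<ge> 2" for s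
      using ev that by (intro tendsto_Li tendsto_intros; auto elim!: eventually_mono)+
    note t = t1 t2 t3[of 2, OF order.refl] t3[of 3, simplified]
    \<comment> \<open>Both primitives tend to -2 Li_3(1), and these constants cancel in the
      difference.\<close>
    have "(?f \<longlongrightarrow> aseries 3 (?y 0) - (Li 3 0 - Li 3 0) + (Li 2 0 - Li 2 (- 0)) * (0 + 0)
       - (0 - 2 * (0 * Li 2 (1 / (1 + 0))) - 2 * Li 3 1) + (0 + 2 * (0 * Li 2 (1 - 0)) - 2 * Li 3 1)) (at_right 0)"
      using t by (intro tendsto_add tendsto_diff tendsto_mult t0 tendsto_const) simp_all
    then show "(?f \<longlongrightarrow> 0) (at_right 0)"
      by simp
  qed
  then show ?thesis
    unfolding P_def M_def by linarith
qed

text \<open>At y = 1/2 the factor 4^n of \<open>ccoeff n\<close> meets (1/2)^(2n+1), so a factor 1/2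
  is left over.\<close>

lemma central_binomial_series_eq:
  "(\<Sum>n. (-1) ^ n / (real (2*n+1) ^ 3 * real ((2*n) choose n))) = 2 * aseries 3 (1 / 2)"
proof -
  have s: "summable (\<lambda>n. acoeff 3 n * (1 / 2) ^ n)"
    by (intro poly_bounded_summable acoeff_bounded) auto
  then have "(\<lambda>n. acoeff 3 n * (1 / 2) ^ n) sums aseries 3 (1 / 2)"
    by (simp add: aseries_def summable_sums)
  then have "(\<lambda>n. acoeff 3 (2 * n + 1) * (1 / 2) ^ (2 * n + 1)) sums aseries 3 (1 / 2)"
    by (subst sums_mono_reindex) (auto simp: strict_mono_def acoeff_def elim!: oddE)
  then have "(\<lambda>n. 2 * (acoeff 3 (2 * n + 1) * (1 / 2) ^ (2 * n + 1))) sums (2 * aseries 3 (1 / 2))"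
    by (rule sums_mult)
  also have "(\<lambda>n. 2 * (acoeff 3 (2 * n + 1) * (1 / 2) ^ (2 * n + 1))) =
      (\<lambda>n. (-1) ^ n / (real (2*n+1) ^ 3 * real ((2*n) choose n)))"
  proof
    fix n
    have "(1 / 2 :: real) ^ (2 * n) = 1 / 4 ^ n"
      by (simp add: power_mult power_divide)
    then show "2 * (acoeff 3 (2 * n + 1) * (1 / 2) ^ (2 * n + 1)) =
        (-1) ^ n / (real (2*n+1) ^ 3 * real ((2*n) choose n))"
      by (simp add: acoeff_def ccoeff_def)
  qed
  finally show ?thesis
    by (simp add: sums_iff)
qed

text \<open>Linear elimination of the trilogarithms other than \<open>Li 3 (phi\<^sup>-\<^sup>3)\<close> and \<open>Li 3 (phi\<^sup>-\<^sup>1)\<close>; the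
  parameter \<open>p\<close> is \<open>pi\<^sup>2\<close> and \<open>Y\<close> is \<open>Li 2 (phi\<^sup>-\<^sup>3)\<close>.\<close>

lemma golden_elimination:
  fixes V W C D E F A B G H M Z Y l lam p S :: real
  assumes T1: "V + C + E = Z + (lam - 2 * l) ^ 3 / 6 + p / 6 * (lam - 2 * l) + 3 * l * (lam - 2 * l)\<^sup>2 / 2"
    and T2: "F + D + W = Z + (l - lam) ^ 3 / 6 + p / 6 * (l - lam) - (- 2 * l - lam) * (l - lam)\<^sup>2 / 2"
    and T3: "G + A + B = Z - l ^ 3 / 6 - p / 6 * l + l * l\<^sup>2"
    and dup: "G = 4 * (A + B)"
    and R: "V - W = 2 * G + 2 * A - A / 2 - 7 / 4 * Z - l ^ 3 / 3 + p / 6 * l"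
    and K: "H + F + C - 2 * A - 2 * E - 2 * D - 2 * B - 2 * G =
       - (l ^ 3) / 3 - (p / 3 - lam\<^sup>2) * l - 2 * H - 2 * M"
    and half: "H = 7 / 8 * Z + lam ^ 3 / 6 - p / 12 * lam"
    and M: "M = - 3 / 4 * Z"
    and S: "S = V - W - (p / 12 - 3 / 2 * l\<^sup>2) * (2 * lam - 3 * l)
      + (- 3 * l * (lam - l)\<^sup>2 - 2 / 3 * (lam - l) ^ 3
         - 2 * ((lam - l) * (p / 6 - (- 2 * l - lam) * (l - lam) + (l - lam)\<^sup>2 / 2 + Y - (p / 12 - 3 / 2 * l\<^sup>2))) - 2 * D)
      - (- 3 * l * (lam - 2 * l)\<^sup>2 + 2 * ((lam - 2 * l) * (p / 6 + 3 * l * (lam - 2 * l) - Y)) - 2 * C)"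
  shows "2 * S = - 4 * V / 3 - 4 * Y * l + A - 25 * l ^ 3 / 3 + 6 * lam * l\<^sup>2
            + p * l / 10 + 12 * Z / 5 - p * lam / 3"
proof -
  \<comment> \<open>The factors come from matching trilogarithms: \<open>E\<close>, \<open>F\<close>
    and \<open>C\<close> fix 8/3, -4/3 and 4/3 for \<open>T1\<close>, \<open>T2\<close> and
    \<open>K\<close>, then \<open>V\<close> fixes 2/3 for \<open>R\<close>, and \<open>G\<close> and
    \<open>B\<close> together fix 56/15 and 4/15 for \<open>T3\<close> and \<open>dup\<close>;
    \<open>H\<close> and \<open>M\<close> give the last two.\<close>
  have "2 * S - (- 4 * V / 3 - 4 * Y * l + A - 25 * l ^ 3 / 3 + 6 * lam * l\<^sup>2
            + p * l / 10 + 12 * Z / 5 - p * lam / 3) =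
      8 / 3 * ((V + C + E) - (Z + (lam - 2 * l) ^ 3 / 6 + p / 6 * (lam - 2 * l) + 3 * l * (lam - 2 * l)\<^sup>2 / 2))
    - 4 / 3 * ((F + D + W) - (Z + (l - lam) ^ 3 / 6 + p / 6 * (l - lam) - (- 2 * l - lam) * (l - lam)\<^sup>2 / 2))
    + 56 / 15 * ((G + A + B) - (Z - l ^ 3 / 6 - p / 6 * l + l * l\<^sup>2))
    + 4 / 15 * (G - 4 * (A + B))
    + 2 / 3 * ((V - W) - (2 * G + 2 * A - A / 2 - 7 / 4 * Z - l ^ 3 / 3 + p / 6 * l))
    + 4 / 3 * ((H + F + C - 2 * A - 2 * E - 2 * D - 2 * B - 2 * G) -
        (- (l ^ 3) / 3 - (p / 3 - lam\<^sup>2) * l - 2 * H - 2 * M))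
    - 4 * (H - (7 / 8 * Z + lam ^ 3 / 6 - p / 12 * lam))
    - 8 / 3 * (M - (- 3 / 4 * Z))"
    unfolding S by (simp add: field_simps power2_eq_square power3_eq_cube)
  also have "\<dots> = 0"
    unfolding assms(1-8)[THEN eq_iff_diff_eq_0[THEN iffD1]] by simp
  finally show ?thesis
    by simp
qed

text \<open>With \<open>u\<close> = 1/phi and u^2 = 1 - u, each trilogarithm argument other than 1,
  and one minus it, is up to sign a product of powers of 2 and u: for instance 1 + v = 2 u, 1 - v =
  2 u^2, 1 + u = 1/u. Hence all logarithms reduce to \<open>l\<close> and
  \<open>lam\<close>.\<close>

lemma golden_series_eq:
  fixes phi l lam :: real
  assumes phi_def: "phi = (1 + sqrt 5) / 2" and l_def: "l = ln phi" and lam_def: "lam = ln 2"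
  shows "2 * aseries 3 (1 / 2) = - 4 * Li 3 (phi powi (-3)) / 3 - 4 * Li 2 (phi powi (-3)) * l
             + Li 3 (phi powi (-1)) - 25 * l ^ 3 / 3 + 6 * lam * l ^ 2
             + pi ^ 2 * l / 10 + 12 * Li 3 1 / 5 - pi ^ 2 * lam / 3"
proof -
  have phi: "phi > 0" "phi\<^sup>2 = phi + 1"
    by (auto simp: phi_def power2_eq_square field_simps add_pos_nonneg)
  define u where "u = 1 / phi"
  have u: "u > 0" "u\<^sup>2 = 1 - u"
    using phi by (auto simp: u_def field_simps power2_eq_square)
  have u_eq: "u = phi - 1"
    using phi by (simp add: u_def field_simps power2_eq_square)
  \<comment> \<open>The bound 9/4 yields u < 5/8, that is v \<le> 1/4; the bound 2 yields u > 1/2,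
    so that v is positive and 1 - u lies in the range of Kummer's equation.\<close>
  have "sqrt 4 < sqrt 5" "sqrt 5 < sqrt ((9 / 4)\<^sup>2)"
    by (intro real_sqrt_less_mono; simp add: power2_eq_square)+
  then have "2 < sqrt 5" "sqrt 5 < 9 / 4"
    by simp_all
  then have ub: "u > 1 / 2" "u < 5 / 8"
    by (auto simp: u_eq phi_def)
  have lnu: "ln u = - l"
    using phi by (simp add: u_def l_def ln_div)
  define v where "v = 2 * u - 1"
  have uu: "u * u = 1 - u"
    using u by (simp add: power2_eq_square)
  have "u ^ 3 = u * (u * u)"
    by (simp add: power3_eq_cube)
  also have "\<dots> = u - u * u"
    unfolding uu by (simp add: uu right_diff_distrib)
  finally have u3: "u ^ 3 = v"
    using uu by (simp add: v_def)
  have p3: "phi powi (-3) = v" and p1: "phi powi (-1) = u"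
    using u3 by (simp_all add: u_def power_int_minus field_simps)
  have v: "0 < v" "v \<le> 1 / 4"
    using ub by (auto simp: v_def)
  have lnv: "ln v = - 3 * l"
    using u lnu by (simp add: u3[symmetric] ln_realpow)
  have inv2u: "1 / (2 * u) = (1 + u) / 2" "1 / (1 + u) = u" "(1 - u) / (1 + u) = v"
    using ub uu by (simp_all add: field_simps v_def) 
  have "1 + v = 2 * u" "1 - v = 2 * (1 - u)" "1 - u = u * u"
    using uu by (simp_all add: v_def)
  then have ln: "ln (1 + v) = lam - l" "ln (1 - v) = lam - 2 * l" "ln (1 - u) = - 2 * l" "ln (1 + u) = l"
  proof -
    show "ln (1 + v) = lam - l"
      using \<open>1 + v = 2 * u\<close> u lnu by (simp add: ln_mult lam_def)
    show l1: "ln (1 - u) = - 2 * l"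
      unfolding \<open>1 - u = u * u\<close> using u lnu by (simp add: ln_mult)
    show "ln (1 - v) = lam - 2 * l"
      unfolding \<open>1 - v = 2 * (1 - u)\<close> using ub l1 by (subst ln_mult) (auto simp: lam_def)
    have "ln u + ln (1 + u) = ln (u * (1 + u))"
      using u by (simp add: ln_mult)
    also have "u * (1 + u) = 1"
      using uu by (simp add: algebra_simps)
    finally show "ln (1 + u) = l"
      using lnu by simp
  qed
  let ?z = "(1 - u) / 2"
  have v3: "v = u * (1 - u)" "v * v = 5 - 8 * u"
    unfolding v_def using uu by algebra+
  have z: "1 - ?z = 1 / (2 * u)" "?z / (?z - 1) = - v" "v / (v - 1) = - (u / 2)"
    "2 * (1 - u) = 1 - v"
  proof -
    show "1 - ?z = 1 / (2 * u)"
      unfolding inv2u by (simp add: field_simps)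
    have "?z / (?z - 1) = - ((1 - u) / (1 + u))"
      using ub by (simp add: divide_simps) (simp add: algebra_simps)
    then show "?z / (?z - 1) = - v"
      by (simp only: inv2u)
    have "v - 1 = - 2 * (1 - u)"
      by (simp add: v_def)
    then have "v / (v - 1) = u * (1 - u) / (- 2 * (1 - u))"
      using v3(1) by metis
    also have "\<dots> = - (u / 2)"
      using ub by (simp add: divide_simps) (simp add: algebra_simps)
    finally show "v / (v - 1) = - (u / 2)" .
  qed (simp add: v_def)
  have A: "(1 - u) / (2 * u\<^sup>2) = 1 / 2" "(1 - u) / (- (2 * u)) = - (u / 2)"
    "(1 - u) / (- u) = - u" "(1 - u) / u = u" "(1 - u) / (2 * u) = u / 2" "1 - u\<^sup>2 = u" "1 / (1 + v) = 1 / (2 * u)" "2 * v / (1 - v\<^sup>2) = 1 / 2"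
    using ub u(2) v3(2) by (auto simp: field_simps power2_eq_square v_def)
  have lnz: "ln ?z = - 2 * l - lam" "ln (1 - ?z) = l - lam"
  proof -
    show "ln ?z = - 2 * l - lam"
      using ln(3) ub by (simp add: ln_div lam_def)
    have e: "1 - ?z = (1 + u) / 2"
      by (simp add: field_simps)
    show "ln (1 - ?z) = l - lam"
      unfolding e using ln(4) ub by (simp add: ln_div lam_def)
  qed
  \<comment> \<open>The instances at \<open>v\<close>, \<open>?z\<close> and \<open>1 - u\<close>
    together contain every trilogarithm of the Kummer instance \<open>K\<close> except those at 1/2
    and -1.\<close>
  have T1: "Li 3 v + Li 3 (1 - v) + Li 3 (- (u / 2)) =
      Li 3 1 + (lam - 2 * l) ^ 3 / 6 + pi\<^sup>2 / 6 * (lam - 2 * l) + 3 * l * (lam - 2 * l)\<^sup>2 / 2"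
    using Li_three_three_term[of v] v unfolding z ln lnv by simp
  have T2: "Li 3 ?z + Li 3 (1 / (2 * u)) + Li 3 (- v) =
      Li 3 1 + (l - lam) ^ 3 / 6 + pi\<^sup>2 / 6 * (l - lam) - (- 2 * l - lam) * (l - lam)\<^sup>2 / 2"
    using Li_three_three_term[of ?z] ub unfolding z lnz by (simp add: lnz(2)[unfolded z])
  have T3: "Li 3 (1 - u) + Li 3 u + Li 3 (- u) = Li 3 1 - l ^ 3 / 6 - pi\<^sup>2 / 6 * l + l * l\<^sup>2"
    using Li_three_three_term[of "1 - u"] ub by (simp add: A ln lnu)
  have dup: "Li 3 (1 - u) = 4 * (Li 3 u + Li 3 (- u))" "Li 2 (1 - u) = 2 * (Li 2 u + Li 2 (- u))"
    using Li_dup[of u 3] Li_dup[of u 2] ub u(2) by auto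
  have R: "Li 3 v - Li 3 (- v) = 2 * Li 3 (1 - u) + 2 * Li 3 u - Li 3 u / 2
           - 7 / 4 * Li 3 1 - l ^ 3 / 3 + pi\<^sup>2 / 6 * l"
    using Li_three_difference_moebius[of u] ub by (simp only: inv2u A ln)
  have R2: "Li 2 v - Li 2 (- v) = 2 * Li 2 (1 - u) - Li 2 u / 2"
    using Li_two_difference_moebius(1)[of u] ub by (simp only: inv2u A)
  have K: "Li 3 (1 / 2) + Li 3 ?z + Li 3 (1 - v) - 2 * Li 3 u - 2 * Li 3 (- (u / 2)) - 2 * Li 3 (1 / (2 * u))
       - 2 * Li 3 (- u) - 2 * Li 3 (1 - u) =
       - (l ^ 3) / 3 - (pi\<^sup>2 / 3 - lam\<^sup>2) * l - 2 * Li 3 (1 / 2) - 2 * Li 3 (- 1)"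
    using Li_three_kummer[of "1 - u"] ub by (simp add: v_def A lnu lam_def)
  have half: "Li 3 (1 / 2) = 7 / 8 * Li 3 1 + lam ^ 3 / 6 - pi\<^sup>2 / 12 * lam"
    by (simp add: Li_half lam_def)
  have two: "Li 2 u + Li 2 (1 - u) = pi\<^sup>2 / 6 - 2 * l\<^sup>2" "Li 2 (1 - u) + Li 2 (- u) = - l\<^sup>2 / 2"
    "Li 2 v + Li 2 (1 - v) = pi\<^sup>2 / 6 + 3 * l * (lam - 2 * l)"
    "Li 2 ?z + Li 2 (1 / (2 * u)) = pi\<^sup>2 / 6 - (- 2 * l - lam) * (l - lam)"
    "Li 2 ?z + Li 2 (- v) = - (l - lam)\<^sup>2 / 2"
    subgoal using Li_two_reflection[of u] ub by (simp add: ln lnu power2_eq_square)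
    subgoal using Li_two_landen[of "1 - u"] ub by (simp add: A lnu)
    subgoal using Li_two_reflection[of v] v by (simp add: ln lnv)
    subgoal using Li_two_reflection[of ?z] ub unfolding lnz by (simp add: z(1)[simplified])
    subgoal using Li_two_landen[of ?z] ub unfolding lnz by (simp only: z) simp
    done
  have S: "aseries 3 (1 / 2) = Li 3 v - Li 3 (- v) - (Li 2 v - Li 2 (- v)) * (2 * lam - 3 * l)
      + (- 3 * l * (lam - l)\<^sup>2 - 2 / 3 * (lam - l) ^ 3 - 2 * ((lam - l) * Li 2 (1 / (2 * u))) - 2 * Li 3 (1 / (2 * u)))
      - (- 3 * l * (lam - 2 * l)\<^sup>2 + 2 * ((lam - 2 * l) * Li 2 (1 - v)) - 2 * Li 3 (1 - v))"
    using aseries_three_double_arg[OF v] by (simp add: A ln lnv)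
  \<comment> \<open>Reflection at \<open>u\<close>, Landen at \<open>1 - u\<close> and duplication
    are three linear equations for the dilogarithms at \<open>u\<close>, \<open>- u\<close> and
    \<open>1 - u\<close>. No such evaluation is made for \<open>Li 2 v\<close>, which stays in the
    result.\<close>
  have two': "Li 2 u = pi\<^sup>2 / 10 - l\<^sup>2" "Li 2 (1 - u) = pi\<^sup>2 / 15 - l\<^sup>2"
    subgoal using two(1,2) dup(2) by (simp add: field_simps)
    subgoal using two(1,2) dup(2) by (simp add: field_simps)
    done
  have m: "Li 2 (- v) = Li 2 v - (pi\<^sup>2 / 12 - 3 / 2 * l\<^sup>2)"
    using R2 two' by linarith
  have m': "Li 2 (1 - v) = pi\<^sup>2 / 6 + 3 * l * (lam - 2 * l) - Li 2 v"
    "Li 2 (1 / (2 * u)) = pi\<^sup>2 / 6 - (- 2 * l - lam) * (l - lam) + (l - lam)\<^sup>2 / 2 + Li 2 v - (pi\<^sup>2 / 12 - 3 / 2 * l\<^sup>2)"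
    using two(3-5) m by linarith+
  show ?thesis
    unfolding p3 p1
    by (rule golden_elimination[OF T1 T2 T3 dup(1) R K half Li_three_minus_one])
       (simp add: S m m')
qed

section \<open>Multiple polylogarithms at roots of unity\<close>

text \<open>The three parts correspond to a larger, smaller or equal leading summation index of the
  first factor. A list of lists records multiplicities.\<close>

fun stuffle :: "(nat \<times> complex) list \<Rightarrow> (nat \<times> complex) list \<Rightarrow> (nat \<times> complex) list list" where
  "stuffle [] B = [B]"
| "stuffle (a # A) [] = [a # A]"
| "stuffle ((s, z) # A) ((s', z') # B) =
     map ((#) (s, z)) (stuffle A ((s', z') # B)) @ map ((#) (s', z')) (stuffle ((s, z) # A) B)
     @ map ((#) (s + s', z * z')) (stuffle A B)"

lemma sum_mult_sum_split:
  fixes f g :: "nat \<Rightarrow> 'a::comm_ring_1"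
  shows "(\<Sum>n\<in>{1..<N}. f n) * (\<Sum>n\<in>{1..<N}. g n) =
    (\<Sum>n\<in>{1..<N}. f n * (\<Sum>m\<in>{1..<n}. g m)) + (\<Sum>n\<in>{1..<N}. g n * (\<Sum>m\<in>{1..<n}. f m))
    + (\<Sum>n\<in>{1..<N}. f n * g n)"
proof (induction N)
  case (Suc N)
  show ?case
  proof (cases "N = 0")
    case False
    then have "{1..<Suc N} = insert N {1..<N}"
      by auto
    then show ?thesis
      using Suc by (simp add: algebra_simps)
  qed simp
qed simp

lemma sum_list_mult_sum_swap:
  fixes c :: "nat \<Rightarrow> 'a::comm_ring_1"
  shows "(\<Sum>n\<in>I. c n * (\<Sum>L\<leftarrow>Ls. h L n)) = (\<Sum>L\<leftarrow>Ls. \<Sum>n\<in>I. c n * h L n)"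
  by (induction Ls) (simp_all add: distrib_left sum.distrib)

text \<open>Exact for every truncation, so conditional convergence does no harm. The strict upper
  bound of \<open>mpl_trunc\<close> makes the inner factors at \<open>n\<close> again truncated sums
  of the same kind.\<close>

lemma mpl_trunc_stuffle:
  "mpl_trunc A N * mpl_trunc B N = (\<Sum>L\<leftarrow>stuffle A B. mpl_trunc L N)"
proof (induction A B arbitrary: N rule: stuffle.induct)
  case (3 s z A s' z' B)
  define f where "f = (\<lambda>n. z ^ n / of_nat n ^ s)"
  define g where "g = (\<lambda>n. z' ^ n / of_nat n ^ s')"
  have "mpl_trunc ((s, z) # A) N * mpl_trunc ((s', z') # B) N =
      (\<Sum>n\<in>{1..<N}. f n * mpl_trunc A n) * (\<Sum>n\<in>{1..<N}. g n * mpl_trunc B n)"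
    by (simp add: f_def g_def)
  also have "\<dots> = (\<Sum>n\<in>{1..<N}. f n * (mpl_trunc A n * mpl_trunc ((s', z') # B) n))
      + (\<Sum>n\<in>{1..<N}. g n * (mpl_trunc ((s, z) # A) n * mpl_trunc B n))
      + (\<Sum>n\<in>{1..<N}. f n * g n * (mpl_trunc A n * mpl_trunc B n))"
    unfolding sum_mult_sum_split by (simp add: f_def g_def mult_ac)
  also have "\<dots> = (\<Sum>L\<leftarrow>stuffle ((s, z) # A) ((s', z') # B). mpl_trunc L N)"
    unfolding 3 sum_list_mult_sum_swap
    by (simp add: f_def g_def comp_def power_mult_distrib power_add)
  finally show ?case .
qed simp_all

section \<open>Admissible index lists\<close>

definition root_list :: "nat \<Rightarrow> (nat \<times> complex) list \<Rightarrow> bool" where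
  "root_list N L \<longleftrightarrow> (\<forall>(s, z)\<in>set L. s > 0 \<and> z ^ N = 1)"

lemma root_list_Nil [simp]: "root_list N []"
  and root_list_Cons [simp]: "root_list N ((s, z) # L) \<longleftrightarrow> s > 0 \<and> z ^ N = 1 \<and> root_list N L"
  by (auto simp: root_list_def)

text \<open>Admissibility without the convergence requirement, which turns out to be automatic.\<close>

definition adm :: "nat \<Rightarrow> nat \<Rightarrow> (nat \<times> complex) list \<Rightarrow> bool" where
  "adm k N L \<longleftrightarrow> L \<noteq> [] \<and> root_list N L \<and> sum_list (map fst L) = k \<and> hd L \<noteq> (1, 1)"

lemma stuffle_roots:
  assumes "root_list N A" "root_list N B" "L \<in> set (stuffle A B)"
  shows "root_list N L \<and> sum_list (map fst L) = sum_list (map fst A) + sum_list (map fst B)"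
  using assms
proof (induction A B arbitrary: L rule: stuffle.induct)
  case (3 s z A s' z' B)
  from 3(6) consider M where "L = (s, z) # M" "M \<in> set (stuffle A ((s', z') # B))"
    | M where "L = (s', z') # M" "M \<in> set (stuffle ((s, z) # A) B)"
    | M where "L = (s + s', z * z') # M" "M \<in> set (stuffle A B)"
    by auto
  then show ?case
    using 3(1,2,3)[of "tl L"] 3(4,5) by cases (simp_all add: power_mult_distrib)
qed simp_all

text \<open>The head of a product list is one of the old heads or a merged one, and a merged head
  has first component at least 2, so it is never (1, 1).\<close>

lemma adm_stuffle:
  assumes A: "adm j N A" and B: "adm k N B" and L: "L \<in> set (stuffle A B)"
  shows "adm (j + k) N L"
proof -
  obtain s z A' s' z' B' where AB: "A = (s, z) # A'" "B = (s', z') # B'"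
    using A B unfolding adm_def by (metis list.exhaust surj_pair)
  have "s > 0" "s' > 0" "(s, z) \<noteq> (1, 1)" "(s', z') \<noteq> (1, 1)"
    using A B by (auto simp: adm_def AB)
  moreover have "\<exists>M. L = (s, z) # M \<or> L = (s', z') # M \<or> L = (s + s', z * z') # M"
    using L by (auto simp: AB)
  ultimately have "L \<noteq> []" "hd L \<noteq> (1, 1)"
    by auto
  then show ?thesis
    using stuffle_roots[of N A B L] assms unfolding adm_def by blast
qed

text \<open>Collects the terms of the nested series with outermost index \<open>n\<close>; the same
  sequence gives the value as a series and, with powers of t, the generating function. The empty
  list has no outermost index, hence the value 0.\<close>

fun mcoeff :: "(nat \<times> complex) list \<Rightarrow> nat \<Rightarrow> complex" where
  "mcoeff [] n = 0"
| "mcoeff ((s, z) # L) n = (if n = 0 then 0 else z ^ n / of_nat n ^ s * mpl_trunc L n)"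

lemma mcoeff_0 [simp]: "mcoeff L 0 = 0"
  by (cases "(L, 0::nat)" rule: mcoeff.cases) auto

lemma mpl_trunc_eq_sum_mcoeff:
  assumes "L \<noteq> []"
  shows "mpl_trunc L N = (\<Sum>n<N. mcoeff L n)"
proof -
  obtain s z L' where L: "L = (s, z) # L'"
    using assms by (cases L) auto
  have "(\<Sum>n<N. mcoeff L n) = (\<Sum>n\<in>{1..<N}. mcoeff L n)"
    by (rule sum.mono_neutral_right) (auto simp: not_less_eq_eq)
  also have "\<dots> = mpl_trunc L N"
    by (auto simp: L intro!: sum.cong)
  finally show ?thesis ..
qed

section \<open>Growth of truncated sums and convergence\<close>

definition unimodular :: "(nat \<times> complex) list \<Rightarrow> bool" where
  "unimodular L \<longleftrightarrow> (\<forall>(s, z)\<in>set L. s > 0 \<and> norm z = 1)"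

lemma norm_root_of_unity:
  fixes z :: complex
  assumes "z ^ N = 1" "N > 0"
  shows "norm z = 1"
  using assms by (metis norm_ge_zero norm_one norm_power power_eq_1_iff less_numeral_extra(3))

lemma adm_unimodular: "adm k N L \<Longrightarrow> N > 0 \<Longrightarrow> unimodular L"
  by (auto simp: adm_def unimodular_def root_list_def norm_root_of_unity)

lemma sum_inverse_sqrt_le: "(\<Sum>m\<in>{1..<Suc n}. 1 / sqrt (real m)) \<le> 2 * sqrt (real n)"
proof (induction n)
  case (Suc n)
  define x y where "x = sqrt (real n)" and "y = sqrt (real (Suc n))"
  have xy: "0 \<le> x" "x \<le> y" "y > 0" "y * y - x * x = 1"
    by (auto simp: x_def y_def)
  have "(y - x) * (2 * y) \<ge> (y - x) * (y + x)"
    using xy by (intro mult_left_mono) auto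
  then have "1 \<le> 2 * (y - x) * y"
    using xy by (simp add: algebra_simps)
  then have "2 * x + 1 / y \<le> 2 * y"
    using xy by (simp add: field_simps)
  then show ?case
    using Suc by (simp add: x_def y_def)
qed simp

text \<open>The true growth is at most a power of log n. The cruder square root reproduces itself in
  the induction, each entry costing a factor 2, and still tends to 0 after division by n and is
  summable after division by n^2.\<close>

lemma norm_mpl_trunc_le:
  assumes "unimodular L" "n \<ge> 1"
  shows "norm (mpl_trunc L n) \<le> 2 ^ length L * sqrt (real n)"
  using assms
proof (induction L arbitrary: n)
  case (Cons a L)
  obtain s z where a: "a = (s, z)"
    by (cases a)
  have L: "unimodular L" "s > 0" "norm z = 1"
    using Cons.prems by (auto simp: unimodular_def a)
  obtain k where k: "n = Suc k"
    using Cons.prems by (cases n) auto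
  have "norm (mpl_trunc (a # L) n) \<le> (\<Sum>m\<in>{1..<n}. 2 ^ length L * (1 / sqrt (real m)))"
    unfolding a mpl_trunc.simps
  proof (rule sum_norm_le)
    fix m assume m: "m \<in> {1..<n}"
    have "real m ^ 1 \<le> real m ^ s"
      using m L by (intro power_increasing) auto
    then have "norm (z ^ m / of_nat m ^ s * mpl_trunc L m) \<le> 1 / real m * (2 ^ length L * sqrt (real m))"
      unfolding norm_mult norm_divide norm_power norm_of_nat L(3) power_one
      using m L by (intro mult_mono divide_left_mono Cons.IH) auto
    also have "\<dots> = 2 ^ length L * (1 / sqrt (real m))"
      using m by (simp add: field_simps)
    finally show "norm (z ^ m / of_nat m ^ s * mpl_trunc L m) \<le> 2 ^ length L * (1 / sqrt (real m))" .
  qed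
  also have "\<dots> \<le> 2 ^ length L * (2 * sqrt (real k))"
    unfolding sum_distrib_left[symmetric] k by (intro mult_left_mono sum_inverse_sqrt_le) auto
  also have "\<dots> \<le> 2 ^ length (a # L) * sqrt (real n)"
    by (simp add: k)
  finally show ?case .
qed simp

lemma norm_mcoeff_le:
  assumes "unimodular ((s, z) # L)" "n \<ge> 1"
  shows "norm (mcoeff ((s, z) # L) n) \<le> 2 ^ length L * sqrt (real n) / real n ^ s"
  using assms norm_mpl_trunc_le[of L n]
  by (auto simp: unimodular_def norm_mult norm_divide norm_power field_simps)

lemma mcoeff_bounded:
  assumes "unimodular L"
  shows "poly_bounded (mcoeff L)"
proof (cases L)
  case (Cons a L')
  obtain s z where a: "a = (s, z)"
    by (cases a)
  show ?thesis
  proof (rule poly_boundedI)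
    fix n
    show "norm (mcoeff L n) \<le> 2 ^ length L' * real (Suc n) ^ 1"
    proof (cases "n = 0")
      case False
      then have "norm (mcoeff L n) \<le> 2 ^ length L' * sqrt (real n) / real n ^ s"
        using norm_mcoeff_le[of s z L' n] assms Cons a by simp
      also have "\<dots> \<le> 2 ^ length L' * real (Suc n) / 1"
      proof (intro frac_le mult_left_mono)
        have "real n \<le> (real (Suc n))\<^sup>2"
          by (simp add: power2_eq_square algebra_simps)
        then show "sqrt (real n) \<le> real (Suc n)"
          by (intro real_le_lsqrt) auto
        show "1 \<le> real n ^ s"
          using False by (intro one_le_power) auto
      qed auto
      finally show ?thesis
        by simp
    qed simp
  qed
qed (auto intro: poly_boundedI[of _ 0 0])

lemma inverse_power_sqrt:
  assumes "n \<ge> 1"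
  shows "sqrt (real n) / real n ^ 2 = real n powr (- 3 / 2)"
proof -
  have "sqrt (real n) / real n ^ 2 = real n powr (1 / 2) / real n powr 2"
    using assms by (simp add: powr_half_sqrt)
  also have "\<dots> = real n powr (1 / 2 - 2)"
    by (rule powr_diff[symmetric])
  finally show ?thesis
    by simp
qed

lemma summable_powr_minus_three_halves: "summable (\<lambda>n. real n powr (- 3 / 2))"
  by (subst summable_real_powr_iff) auto

text \<open>For a leading pair \<open>(1, z)\<close> with \<open>z \<noteq> 1\<close> the series converges only conditionally; multiplying by
  \<open>1 - z\<close> (summation by parts) makes it absolutely convergent up to a telescoping series.\<close>

lemma mcoeff_summable:
  assumes L: "unimodular ((s, z) # L)" and sz: "(s, z) \<noteq> (1, 1)"
  shows "summable (mcoeff ((s, z) # L))"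
proof (cases "s \<ge> 2")
  case True
  have "summable (\<lambda>n. 2 ^ length L * real n powr (- 3 / 2))"
    by (intro summable_mult summable_powr_minus_three_halves)
  then show ?thesis
  proof (rule summable_comparison_test'[where N = 1])
    fix n :: nat assume n: "n \<ge> 1"
    have "norm (mcoeff ((s, z) # L) n) \<le> 2 ^ length L * sqrt (real n) / real n ^ s"
      by (rule norm_mcoeff_le[OF L n])
    also have "\<dots> \<le> 2 ^ length L * sqrt (real n) / real n ^ 2"
      using True n by (intro divide_left_mono power_increasing) auto
    also have "\<dots> = 2 ^ length L * real n powr (- 3 / 2)"
      by (simp only: inverse_power_sqrt[OF n] times_divide_eq_right[symmetric])
    finally show "norm (mcoeff ((s, z) # L) n) \<le> 2 ^ length L * real n powr (- 3 / 2)" .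
  qed
next
  case False
  then have s: "s = 1" and z: "z \<noteq> 1" "norm z = 1" and L': "unimodular L"
    using L sz by (auto simp: unimodular_def)
  define C :: real where "C = 2 ^ length L"
  define a where "a = (\<lambda>n. mpl_trunc L n / of_nat n)"
  define b where "b = mcoeff ((s, z) # L)"
  \<comment> \<open>Also true at n = 0, where \<open>a 0\<close> is a division by zero and hence
    0.\<close>
  have b: "b n = z ^ n * a n" for n
    by (simp add: a_def b_def s)
  have trunc: "norm (mpl_trunc L n) \<le> C * sqrt (real n)" if "n \<ge> 1" for n
    using norm_mpl_trunc_le[OF L' that] by (simp add: C_def)
  have step: "norm (mpl_trunc L (Suc n) - mpl_trunc L n) \<le> C * sqrt (real n) / real n" if n: "n \<ge> 1" for n
  proof (cases L)
    case (Cons c L'')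
    obtain s' z' where c: "c = (s', z')"
      by (cases c)
    have "mpl_trunc L (Suc n) - mpl_trunc L n = mcoeff L n"
      by (subst (1 2) mpl_trunc_eq_sum_mcoeff) (auto simp: Cons)
    also have "norm \<dots> \<le> 2 ^ length L'' * sqrt (real n) / real n ^ s'"
      using norm_mcoeff_le[of s' z' L'' n] L' n by (simp add: Cons c)
    also have "\<dots> \<le> C * sqrt (real n) / real n ^ 1"
      using n L' by (intro frac_le mult_right_mono power_increasing) (auto simp: C_def Cons c unimodular_def)
    finally show ?thesis
      by simp
  qed (simp add: C_def)
  have "summable (\<lambda>n. 2 * C * real n powr (- 3 / 2))"
    by (intro summable_mult summable_powr_minus_three_halves)
  then have "summable (\<lambda>n. z * z ^ n * (a (Suc n) - a n))"
  proof (rule summable_comparison_test'[where N = 1])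
    fix n :: nat assume n: "n \<ge> 1"
    \<comment> \<open>The increment splits into the change of the truncated sum and the change of
      1/n; either part is of order n^(-3/2).\<close>
    have "a (Suc n) - a n = (mpl_trunc L (Suc n) - mpl_trunc L n) / of_nat (Suc n)
        - mpl_trunc L n / (of_nat n * of_nat (Suc n))"
      using n by (simp add: a_def divide_simps del: of_nat_Suc) (simp add: algebra_simps)
    then have "norm (a (Suc n) - a n) \<le> norm (mpl_trunc L (Suc n) - mpl_trunc L n) / real (Suc n)
        + norm (mpl_trunc L n) / (real n * real (Suc n))"
      using norm_triangle_ineq4 by (metis norm_divide norm_mult norm_of_nat)
    also have "\<dots> \<le> (C * sqrt (real n) / real n) / real n + C * sqrt (real n) / (real n * real n)"
      using n step[OF n] trunc[OF n] by (intro add_mono frac_le mult_left_mono) (auto simp: C_def)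
    also have "\<dots> = 2 * C * (sqrt (real n) / real n ^ 2)"
      by (simp add: power2_eq_square)
    also have "\<dots> = 2 * C * real n powr (- 3 / 2)"
      by (simp only: inverse_power_sqrt[OF n])
    finally show "norm (z * z ^ n * (a (Suc n) - a n)) \<le> 2 * C * real n powr (- 3 / 2)"
      by (simp add: norm_mult norm_power z)
  qed
  moreover have "b \<longlonglongrightarrow> 0"
  proof (rule Lim_null_comparison)
    show "(\<lambda>n. C * sqrt (real n) / real n) \<longlonglongrightarrow> 0"
      by real_asymp
    show "eventually (\<lambda>n. norm (b n) \<le> C * sqrt (real n) / real n) sequentially"
      using eventually_ge_at_top[of 1]
    proof eventually_elim
      case (elim n)
      then show ?case
        using norm_mcoeff_le[OF L elim] by (simp add: b_def C_def s)
    qed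
  qed
  then have "summable (\<lambda>n. b (Suc n) - b n)"
    by (rule telescope_summable)
  ultimately have "summable (\<lambda>n. z * z ^ n * (a (Suc n) - a n) - (b (Suc n) - b n))"
    by (rule summable_diff)
  also have "(\<lambda>n. z * z ^ n * (a (Suc n) - a n) - (b (Suc n) - b n)) = (\<lambda>n. (1 - z) * b n)"
    by (simp add: b algebra_simps fun_eq_iff)
  finally have "summable b"
    using z by (simp add: summable_cmult_iff)
  then show ?thesis
    by (simp only: b_def)
qed

lemma adm_summable: "adm k N L \<Longrightarrow> N > 0 \<Longrightarrow> summable (mcoeff L)"
  using mcoeff_summable[of "fst (hd L)" "snd (hd L)" "tl L"] adm_unimodular[of k N L]
  by (cases L) (auto simp: adm_def)

lemma adm_LIMSEQ:
  assumes "adm k N L" "N > 0"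
  shows "mpl_trunc L \<longlonglongrightarrow> suminf (mcoeff L)"
proof -
  have "L \<noteq> []"
    using assms by (simp add: adm_def)
  then show ?thesis
    using summable_LIMSEQ[OF adm_summable[OF assms]] mpl_trunc_eq_sum_mcoeff by presburger
qed

lemma adm_mpl: "adm k N L \<Longrightarrow> N > 0 \<Longrightarrow> mpl L = suminf (mcoeff L)"
  unfolding mpl_def by (rule limI) (rule adm_LIMSEQ)

lemma adm_iff_admissible: "N > 0 \<Longrightarrow> admissible k N L \<longleftrightarrow> adm k N L"
  using adm_LIMSEQ[of k N L] by (auto simp: admissible_def adm_def convergent_def root_list_def)

section \<open>The rational span and its products\<close>

lemma MZV_zero: "0 \<in> MZV_space k N"
  unfolding MZV_space_def by (auto intro!: exI[of _ "0::nat"])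

lemma MZV_insert:
  assumes "admissible k N L" "y \<in> MZV_space k N"
  shows "of_rat q * mpl L + y \<in> MZV_space k N"
proof -
  obtain m :: nat and c Ls where m: "\<forall>i<m. admissible k N (Ls i)" "y = (\<Sum>i<m. of_rat (c i) * mpl (Ls i))"
    using assms(2) unfolding MZV_space_def by blast
  define c' where "c' = c(m := q)"
  define Ls' where "Ls' = Ls(m := L)"
  have "(\<Sum>i<Suc m. of_rat (c' i) * mpl (Ls' i)) = of_rat q * mpl L + y"
    by (simp add: c'_def Ls'_def m(2))
  moreover have "\<forall>i<Suc m. admissible k N (Ls' i)"
    using m(1) assms(1) by (auto simp: Ls'_def)
  ultimately show ?thesis
    unfolding MZV_space_def mem_Collect_eq by metis
qed

text \<open>Builds an element one summand at a time, so that closure properties avoid manipulating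
  indexed families.\<close>

lemma MZV_induct [consumes 1, case_names zero insert]:
  assumes "x \<in> MZV_space k N" "P 0"
    and step: "\<And>q L y. admissible k N L \<Longrightarrow> P y \<Longrightarrow> P (of_rat q * mpl L + y)"
  shows "P x"
proof -
  obtain m :: nat and c Ls where m: "\<forall>i<m. admissible k N (Ls i)" and x: "x = (\<Sum>i<m. of_rat (c i) * mpl (Ls i))"
    using assms(1) unfolding MZV_space_def by blast
  have "P (\<Sum>i<n. of_rat (c i) * mpl (Ls i))" if "n \<le> m" for n
    using that by (induction n) (use m in \<open>auto simp: assms(2) add.commute intro!: step\<close>)
  then show ?thesis
    by (simp add: x)
qed

lemma MZV_mpl: "admissible k N L \<Longrightarrow> mpl L \<in> MZV_space k N"
  using MZV_insert[OF _ MZV_zero, of k N L 1] by simp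

lemma MZV_add:
  assumes "x \<in> MZV_space k N" "y \<in> MZV_space k N"
  shows "x + y \<in> MZV_space k N"
  using assms(1) by (induction rule: MZV_induct) (auto simp: add.assoc assms(2) intro: MZV_insert)

lemma MZV_scale:
  assumes "x \<in> MZV_space k N"
  shows "of_rat q * x \<in> MZV_space k N"
  using assms
proof (induction rule: MZV_induct)
  case (insert r L y)
  then show ?case
    using MZV_insert[of k N L "of_rat q * y" "q * r"] by (simp add: of_rat_mult algebra_simps)
qed (simp add: MZV_zero)

lemma MZV_sum_list: "(\<And>x. x \<in> set xs \<Longrightarrow> x \<in> MZV_space k N) \<Longrightarrow> sum_list xs \<in> MZV_space k N"
  by (induction xs) (auto intro: MZV_add MZV_zero)

text \<open>Passage to the limit in the stuffle identity; all product lists are admissible, so the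
  right-hand side converges term by term.\<close>

lemma mpl_mult_in_MZV:
  assumes "adm j N A" "adm k N B" "N > 0"
  shows "mpl A * mpl B \<in> MZV_space (j + k) N"
proof -
  have "(\<lambda>M. mpl_trunc A M * mpl_trunc B M) \<longlonglongrightarrow> mpl A * mpl B"
    using assms adm_LIMSEQ adm_mpl by (intro tendsto_mult) metis+
  moreover have "(\<lambda>M. \<Sum>L\<leftarrow>Ls. mpl_trunc L M) \<longlonglongrightarrow> (\<Sum>L\<leftarrow>Ls. mpl L)"
    if "\<And>L. L \<in> set Ls \<Longrightarrow> adm (j + k) N L" for Ls
    using that
  proof (induction Ls)
    case (Cons L Ls)
    then have "mpl_trunc L \<longlonglongrightarrow> mpl L"
      using adm_LIMSEQ[of "j + k" N L] adm_mpl[of "j + k" N L] assms(3) by simp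
    then show ?case
      using Cons by (auto intro!: tendsto_add)
  qed simp
  then have "(\<lambda>M. \<Sum>L\<leftarrow>stuffle A B. mpl_trunc L M) \<longlonglongrightarrow> (\<Sum>L\<leftarrow>stuffle A B. mpl L)"
    using adm_stuffle assms by blast
  ultimately have "mpl A * mpl B = (\<Sum>L\<leftarrow>stuffle A B. mpl L)"
    unfolding mpl_trunc_stuffle by (rule LIMSEQ_unique)
  also have "\<dots> \<in> MZV_space (j + k) N"
    by (intro MZV_sum_list)
       (use assms adm_stuffle in \<open>auto intro!: MZV_mpl simp: adm_iff_admissible\<close>)
  finally show ?thesis .
qed

lemma MZV_mult:
  assumes "x \<in> MZV_space j N" "y \<in> MZV_space k N" "N > 0"
  shows "x * y \<in> MZV_space (j + k) N"
  using assms(1)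
proof (induction rule: MZV_induct)
  case (insert q A x)
  have "mpl A * y \<in> MZV_space (j + k) N"
    using assms(2)
  proof (induction rule: MZV_induct)
    case (insert r B y)
    then have "of_rat r * (mpl A * mpl B) + mpl A * y \<in> MZV_space (j + k) N"
      using \<open>admissible j N A\<close> assms(3)
      by (intro MZV_add MZV_scale mpl_mult_in_MZV) (auto simp: adm_iff_admissible)
    then show ?case
      by (simp add: algebra_simps)
  qed (simp add: MZV_zero)
  then have "of_rat q * (mpl A * y) + x * y \<in> MZV_space (j + k) N"
    using insert by (intro MZV_add MZV_scale)
  then show ?case
    by (simp add: algebra_simps)
qed (simp add: MZV_zero)

section \<open>Abel's theorem at the point 1\<close>

lemma abel_null_limit:
  fixes c :: "nat \<Rightarrow> complex"
  assumes "c \<longlonglongrightarrow> 0"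
  shows "((\<lambda>t::real. of_real (1 - t) * (\<Sum>n. c n * of_real t ^ n)) \<longlongrightarrow> 0) (at_left 1)"
proof (rule tendstoI)
  fix e :: real assume e: "e > 0"
  obtain N where N: "\<And>n. n \<ge> N \<Longrightarrow> norm (c n) < e / 2"
    using LIMSEQ_D[OF assms, of "e / 2"] e by auto
  \<comment> \<open>The first N terms contribute at most \<open>(1 - t) * B\<close>, the tail at
    most e/2 because the weights (1 - t) t^n sum to 1. The added 1 keeps \<open>B\<close>
    positive.\<close>
  define B where "B = (\<Sum>n<N. norm (c n)) + 1"
  have B: "B > 0"
    by (auto simp: B_def intro!: add_nonneg_pos sum_nonneg)
  have "eventually (\<lambda>t::real. t \<in> {max 0 (1 - e / (2 * B))<..<1}) (at_left 1)"
    using e B by (intro eventually_at_left_real) auto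
  then show "eventually (\<lambda>t::real. dist (of_real (1 - t) * (\<Sum>n. c n * of_real t ^ n)) 0 < e) (at_left 1)"
  proof eventually_elim
    case (elim t)
    then have t: "0 < t" "t < 1" "1 - t < e / (2 * B)"
      by auto
    define d where "d = (\<lambda>n. if n < N then norm (c n) else 0)"
    have d: "d sums (\<Sum>n<N. norm (c n))"
      using sums_If_finite_set[of "{..<N}" "\<lambda>n. norm (c n)"] by (simp add: d_def)
    have g: "(\<lambda>n. e / 2 * t ^ n) sums (e / 2 * (1 / (1 - t)))"
      using t by (intro sums_mult geometric_sums) auto
    have le: "norm (c n * of_real t ^ n) \<le> d n + e / 2 * t ^ n" for n
    proof (cases "n < N")
      case True
      have "norm (c n) * t ^ n \<le> norm (c n) * 1"
        using t by (intro mult_left_mono power_le_one) auto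
      moreover have "e / 2 * t ^ n \<ge> 0"
        using t e by simp
      ultimately have "norm (c n) * t ^ n \<le> norm (c n) + e / 2 * t ^ n"
        by linarith
      then show ?thesis
        using True t by (simp add: d_def norm_mult norm_power)
    next
      case False
      have "norm (c n) * t ^ n \<le> e / 2 * t ^ n"
        using t N[of n] False by (intro mult_right_mono) auto
      then show ?thesis
        using False t by (simp add: d_def norm_mult norm_power)
    qed
    have s: "summable (\<lambda>n. norm (c n * of_real t ^ n))"
      by (rule summable_comparison_test'[OF sums_summable[OF sums_add[OF d g]], of 0]) (use le in simp)
    have "norm (\<Sum>n. c n * of_real t ^ n) \<le> (\<Sum>n. norm (c n * of_real t ^ n))"
      by (rule summable_norm[OF s])
    also have "\<dots> \<le> (\<Sum>n. d n + e / 2 * t ^ n)"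
      using s sums_summable[OF sums_add[OF d g]] by (intro suminf_le le)
    also have "\<dots> = (\<Sum>n<N. norm (c n)) + e / 2 * (1 / (1 - t))"
      by (rule sums_unique[OF sums_add[OF d g], symmetric])
    also have "\<dots> < B + e / 2 * (1 / (1 - t))"
      by (simp add: B_def)
    finally have "(1 - t) * norm (\<Sum>n. c n * of_real t ^ n) < (1 - t) * (B + e / 2 * (1 / (1 - t)))"
      using t by (intro mult_strict_left_mono) auto
    also have "\<dots> = (1 - t) * B + e / 2"
      using t by (simp add: field_simps)
    also have "(1 - t) * B < e / 2"
      using t(3) B by (simp add: field_simps)
    finally have "(1 - t) * norm (\<Sum>n. c n * of_real t ^ n) < e"
      by simp
    moreover have "norm (complex_of_real (1 - t)) = 1 - t"
      using t by (simp only: norm_of_real)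
    ultimately show ?case
      by (simp add: norm_mult del: of_real_diff)
  qed
qed

text \<open>Summation by parts with the remainders \<open>r\<close> gives sum a - (1 - t) times the
  power series of a null sequence. A leading pair (1, z) makes convergence at t = 1 only
  conditional, so dominated convergence would not suffice.\<close>

lemma abel_limit:
  fixes a :: "nat \<Rightarrow> complex"
  assumes a: "summable a"
  shows "((\<lambda>t::real. \<Sum>n. a n * of_real t ^ n) \<longlongrightarrow> suminf a) (at_left 1)"
proof -
  define r where "r = (\<lambda>n. \<Sum>k. a (k + n))"
  have r_Suc: "a n = r n - r (Suc n)" for n
    using suminf_split_head[of "\<lambda>k. a (k + n)"] summable_ignore_initial_segment[OF a, of n]
    by (simp add: r_def)
  have r0: "r 0 = suminf a"
    by (simp add: r_def)
  have "(\<lambda>n. suminf a - (\<Sum>i<n. a i)) \<longlonglongrightarrow> suminf a - suminf a"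
    by (intro tendsto_diff tendsto_const summable_LIMSEQ a)
  then have "r \<longlonglongrightarrow> 0"
    using suminf_minus_initial_segment[OF a] by (simp add: r_def)
  then have r: "(\<lambda>n. r (Suc n)) \<longlonglongrightarrow> 0"
    by (rule LIMSEQ_Suc)
  obtain B where B: "\<And>n. norm (r n) \<le> B"
    using \<open>r \<longlonglongrightarrow> 0\<close> by (meson BseqE convergentI convergent_imp_Bseq)
  have pb: "poly_bounded r" "poly_bounded (\<lambda>n. r (Suc n))"
    using B by (auto intro!: poly_boundedI[of _ B 0])
  have "((\<lambda>t::real. suminf a - of_real (1 - t) * (\<Sum>n. r (Suc n) * of_real t ^ n)) \<longlongrightarrow> suminf a - 0) (at_left 1)"
    by (intro tendsto_diff tendsto_const abel_null_limit r)
  moreover have "eventually (\<lambda>t::real. t \<in> {0<..<1}) (at_left 1)"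
    by (rule eventually_at_left_real) simp
  then have "eventually (\<lambda>t::real. suminf a - of_real (1 - t) * (\<Sum>n. r (Suc n) * of_real t ^ n) =
      (\<Sum>n. a n * of_real t ^ n)) (at_left 1)"
  proof eventually_elim
    case (elim t)
    define w where "w = complex_of_real t"
    have w: "norm w < 1"
      using elim by (simp add: w_def)
    have s: "summable (\<lambda>n. r n * w ^ n)" "summable (\<lambda>n. r (Suc n) * w ^ n)"
      using poly_bounded_summable pb w by blast+
    have "(\<Sum>n. a n * w ^ n) = (\<Sum>n. r n * w ^ n - r (Suc n) * w ^ n)"
      by (simp add: r_Suc algebra_simps)
    also have "\<dots> = (\<Sum>n. r n * w ^ n) - (\<Sum>n. r (Suc n) * w ^ n)"
      using s by (rule suminf_diff[symmetric])
    also have "(\<Sum>n. r n * w ^ n) = suminf a + (\<Sum>n. w * (r (Suc n) * w ^ n))"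
      using suminf_split_head[OF s(1)] by (simp add: r0 mult_ac)
    also have "(\<Sum>n. w * (r (Suc n) * w ^ n)) = w * (\<Sum>n. r (Suc n) * w ^ n)"
      by (rule suminf_mult[OF s(2)])
    finally show ?case
      by (simp add: w_def algebra_simps)
  qed
  ultimately show ?thesis
    using Lim_transform_eventually by force
qed

section \<open>Multiple polylogarithms as functions of a factor t in the first argument\<close>

definition mgen :: "(nat \<times> complex) list \<Rightarrow> complex \<Rightarrow> complex" where
  "mgen L t = (\<Sum>n. mcoeff L n * t ^ n)"

lemma mgen_0 [simp]: "mgen L 0 = 0"
  unfolding mgen_def by (subst powser_zero) simp

lemma isCont_mgen: "unimodular L \<Longrightarrow> norm t < 1 \<Longrightarrow> isCont (mgen L) t"
  unfolding mgen_def[abs_def] by (intro powser_isCont mcoeff_bounded)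

lemma mgen_deriv:
  assumes "unimodular L" "norm t < 1" "t \<noteq> 0"
  shows "(mgen L has_field_derivative (\<Sum>n. of_nat n * mcoeff L n * t ^ n) / t) (at t)"
  unfolding mgen_def[abs_def] using assms by (intro powser_deriv mcoeff_bounded)

lemma mgen_deriv_Suc:
  assumes "unimodular ((s, z) # L)" "norm t < 1" "t \<noteq> 0"
  shows "(mgen ((Suc s, z) # L) has_field_derivative mgen ((s, z) # L) t / t) (at t)"
proof -
  have "of_nat n * mcoeff ((Suc s, z) # L) n = mcoeff ((s, z) # L) n" for n
    by simp
  then show ?thesis
    using mgen_deriv[of "(Suc s, z) # L" t] assms by (simp add: mgen_def unimodular_def)
qed

text \<open>Multiplication by c / (1 - c t) sends an inner index m to each larger n with weight
  c^(n-m). The factor c^n belongs to the new outer entry, and c^(-m) turns the old leading root z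
  into z / c.\<close>

lemma mgen_deriv_Cons:
  assumes L: "unimodular ((s, z) # L)" and c: "norm c = 1" and t: "norm t < 1" "t \<noteq> 0"
  shows "(mgen ((1, c) # (s, z / c) # L) has_field_derivative
           c / (1 - c * t) * mgen ((s, z) # L) t) (at t)"
proof -
  define M where "M = (s, z / c) # L"
  have c0: "c \<noteq> 0"
    using c by auto
  have M: "unimodular ((1, c) # M)" "unimodular M"
    using L c by (auto simp: unimodular_def M_def norm_divide)
  define h where "h = (\<lambda>n. of_nat n * mcoeff ((1, c) # M) n * t ^ n)"
  have h: "h n = c ^ n * t ^ n * mpl_trunc M n" for n
    by (cases "n = 0") (simp_all add: h_def M_def)
  have sh: "summable h"
    unfolding h_def by (intro poly_bounded_summable poly_bounded_times_n mcoeff_bounded M t)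
  have sL: "summable (\<lambda>n. mcoeff ((s, z) # L) n * t ^ n)"
    by (intro poly_bounded_summable mcoeff_bounded L t)
  have "c ^ n * mcoeff M n = mcoeff ((s, z) # L) n" for n
    using c0 by (simp add: M_def power_divide)
  moreover have "mpl_trunc M (Suc n) = mpl_trunc M n + mcoeff M n" for n
    by (subst (1 2) mpl_trunc_eq_sum_mcoeff) (auto simp: M_def)
  \<comment> \<open>Summing this recursion gives (1 - c t) times \<open>suminf h\<close> as c t
    times the old generating function.\<close>
  ultimately have step: "h (Suc n) = c * t * h n + c * t * (mcoeff ((s, z) # L) n * t ^ n)" for n
    unfolding h by (simp add: algebra_simps)
  have "suminf h = (\<Sum>n. h (Suc n))"
    using suminf_split_head[OF sh] by (simp add: h_def)
  also have "\<dots> = c * t * suminf h + c * t * mgen ((s, z) # L) t"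
    unfolding step mgen_def using sh sL
    by (simp add: suminf_add[symmetric] suminf_mult[symmetric] summable_mult)
  finally have "(1 - c * t) * suminf h = c * t * mgen ((s, z) # L) t"
    by (simp add: algebra_simps)
  moreover have "norm (c * t) < 1"
    using c t by (simp add: norm_mult)
  then have "1 - c * t \<noteq> 0"
    by auto
  ultimately have "suminf h / t = c / (1 - c * t) * mgen ((s, z) # L) t"
    using t by (simp add: field_simps)
  then show ?thesis
    using mgen_deriv[OF M(1) t] by (simp add: h_def M_def)
qed

text \<open>So this function plays the part of -log (1 - c t), and no branch of the complex
  logarithm has to be chosen.\<close>

lemma mgen_deriv_single:
  assumes c: "norm c = 1" and t: "norm t < 1" "t \<noteq> 0"
  shows "(mgen [(1, c)] has_field_derivative c / (1 - c * t)) (at t)"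
proof -
  have ct: "norm (c * t) < 1"
    using c t by (simp add: norm_mult)
  define h where "h = (\<lambda>n. of_nat n * mcoeff [(1, c)] n * t ^ n)"
  have "h (Suc n) = c * t * (c * t) ^ n" for n
    by (simp add: h_def power_mult_distrib del: of_nat_Suc)
  moreover have "h 0 = 0"
    by (simp add: h_def)
  moreover have "summable h"
    unfolding h_def using c t
    by (intro poly_bounded_summable poly_bounded_times_n mcoeff_bounded) (auto simp: unimodular_def)
  ultimately have "suminf h = c * t * (1 / (1 - c * t))"
    using suminf_split_head[of h] suminf_mult[OF summable_geometric[OF ct], of "c * t"] suminf_geometric[OF ct]
    by simp
  then have "suminf h / t = c / (1 - c * t)"
    using t by simp
  then show ?thesis
    using mgen_deriv[of "[(1, c)]" t] c t by (simp add: h_def unimodular_def)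
qed

text \<open>The counterpart of \<open>MZV_space\<close> for functions of t. Only admissible lists
  occur, so each member has a limit as t tends to 1.\<close>

inductive mspan :: "nat \<Rightarrow> nat \<Rightarrow> (complex \<Rightarrow> complex) \<Rightarrow> bool" for k N where
  zero: "mspan k N (\<lambda>t. 0)"
| insert: "adm k N L \<Longrightarrow> mspan k N f \<Longrightarrow> mspan k N (\<lambda>t. of_rat q * mgen L t + f t)"

lemma mspan_add:
  assumes "mspan k N f" "mspan k N g"
  shows "mspan k N (\<lambda>t. f t + g t)"
  using assms(1)
proof (induction rule: mspan.induct)
  case (insert L f q)
  then show ?case
    using mspan.insert[of k N L "\<lambda>t. f t + g t" q] by (simp add: add.assoc)
qed (use assms(2) in simp)

lemma mspan_mgen: "adm k N L \<Longrightarrow> mspan k N (mgen L)"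
  using mspan.insert[OF _ mspan.zero, of k N L 1] by simp

lemma mspan_scale:
  assumes "mspan k N f"
  shows "mspan k N (\<lambda>t. of_rat r * f t)"
  using assms
proof (induction rule: mspan.induct)
  case (insert L f q)
  then show ?case
    using mspan.insert[of k N L "\<lambda>t. of_rat r * f t" "r * q"] by (simp add: algebra_simps of_rat_mult)
qed (simp add: mspan.zero)

lemma mspan_integral_dt_over_t:
  assumes "mspan k N f" "N > 0"
  shows "\<exists>g. mspan (Suc k) N g \<and> (\<forall>t. norm t < 1 \<longrightarrow> t \<noteq> 0 \<longrightarrow> (g has_field_derivative f t / t) (at t))"
  using assms(1)
proof (induction rule: mspan.induct)
  case zero
  then show ?case
    by (intro exI[of _ "\<lambda>t. 0"]) (auto intro: mspan.zero)
next
  case (insert L f q)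
  obtain s z L' where L: "L = (s, z) # L'"
    using insert by (cases L) (auto simp: adm_def)
  obtain g where g: "mspan (Suc k) N g"
    "\<And>t. norm t < 1 \<Longrightarrow> t \<noteq> 0 \<Longrightarrow> (g has_field_derivative f t / t) (at t)"
    using insert.IH by blast
  have "adm (Suc k) N ((Suc s, z) # L')"
    using insert.hyps by (auto simp: adm_def L)
  moreover have "((\<lambda>t. of_rat q * mgen ((Suc s, z) # L') t + g t) has_field_derivative
      (of_rat q * mgen L t + f t) / t) (at t)" if "norm t < 1" "t \<noteq> 0" for t
    using DERIV_add[OF DERIV_cmult[OF mgen_deriv_Suc[OF _ that], of s z L' "of_rat q"] g(2)[OF that]]
      adm_unimodular[OF insert.hyps(1) assms(2)]
    by (simp add: L add_divide_distrib)
  ultimately show ?case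
    using mspan.insert[OF _ g(1)] by blast
qed

text \<open>The new leading pair is (1, c), which \<open>c \<noteq> 1\<close> makes
  admissible.\<close>

lemma mspan_integral_root:
  assumes "mspan k N f" "N > 0" "c ^ N = 1" "c \<noteq> 1"
  shows "\<exists>g. mspan (Suc k) N g \<and>
           (\<forall>t. norm t < 1 \<longrightarrow> t \<noteq> 0 \<longrightarrow> (g has_field_derivative c / (1 - c * t) * f t) (at t))"
  using assms(1)
proof (induction rule: mspan.induct)
  case zero
  then show ?case
    by (intro exI[of _ "\<lambda>t. 0"]) (auto intro: mspan.zero)
next
  case (insert L f q)
  have c: "norm c = 1"
    using norm_root_of_unity assms by blast
  obtain s z L' where L: "L = (s, z) # L'"
    using insert by (cases L) (auto simp: adm_def)
  obtain g where g: "mspan (Suc k) N g"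
    "\<And>t. norm t < 1 \<Longrightarrow> t \<noteq> 0 \<Longrightarrow> (g has_field_derivative c / (1 - c * t) * f t) (at t)"
    using insert.IH by blast
  have "adm (Suc k) N ((1, c) # (s, z / c) # L')"
    using insert.hyps assms by (auto simp: adm_def L power_divide)
  moreover have "((\<lambda>t. of_rat q * mgen ((1, c) # (s, z / c) # L') t + g t) has_field_derivative
      c / (1 - c * t) * (of_rat q * mgen L t + f t)) (at t)" if "norm t < 1" "t \<noteq> 0" for t
    using DERIV_add[OF DERIV_cmult[OF mgen_deriv_Cons[OF _ c that], of s z L' "of_rat q"] g(2)[OF that]]
      adm_unimodular[OF insert.hyps(1) assms(2)]
    by (simp add: L algebra_simps)
  ultimately show ?case
    using mspan.insert[OF _ g(1)] by blast
qed

text \<open>Fixes the constants of integration: all primitives built from generating functions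
  vanish at 0.\<close>

lemma mspan_isCont_0:
  assumes "mspan k N f" "N > 0"
  shows "isCont f 0 \<and> f 0 = 0"
  using assms(1) by (induction rule: mspan.induct) (auto intro!: continuous_intros isCont_mgen adm_unimodular[OF _ assms(2)])

lemma mspan_limit:
  assumes "mspan k N f" "N > 0"
  shows "\<exists>l\<in>MZV_space k N. ((\<lambda>t::real. f (of_real t)) \<longlongrightarrow> l) (at_left 1)"
  using assms(1)
proof (induction rule: mspan.induct)
  case zero
  then show ?case
    by (intro bexI[of _ 0]) (auto intro: MZV_zero)
next
  case (insert L f q)
  then obtain l where l: "l \<in> MZV_space k N" "((\<lambda>t::real. f (of_real t)) \<longlongrightarrow> l) (at_left 1)"
    by blast
  have "((\<lambda>t::real. mgen L (of_real t)) \<longlongrightarrow> mpl L) (at_left 1)"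
    unfolding mgen_def adm_mpl[OF insert.hyps(1) assms(2)]
    by (intro abel_limit adm_summable[OF insert.hyps(1) assms(2)])
  then have "((\<lambda>t::real. of_rat q * mgen L (of_real t) + f (of_real t)) \<longlongrightarrow> of_rat q * mpl L + l) (at_left 1)"
    by (intro tendsto_add tendsto_mult tendsto_const l)
  moreover have "of_rat q * mpl L + l \<in> MZV_space k N"
    using insert.hyps(1) assms(2) l by (intro MZV_insert) (simp_all add: adm_iff_admissible)
  ultimately show ?case
    by blast
qed

lemma mspan_log:
  assumes "N > 0" "c ^ N = 1" "c \<noteq> 1"
  shows "mspan 1 N (mgen [(1, c)])"
  using assms by (intro mspan_mgen) (auto simp: adm_def)

section \<open>Polylogarithms of rational functions with poles at roots of unity\<close>

lemma Li_dlog: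
  fixes g :: "'a::{real_normed_field,banach} \<Rightarrow> 'a"
  assumes "(g has_field_derivative d * g x) (at x)" "norm (g x) < 1" "g x \<noteq> 0"
  shows "((\<lambda>x. Li (Suc s) (g x)) has_field_derivative Li s (g x) * d) (at x)"
  using Li_deriv[OF assms(1-3), of s] assms(3) by simp

text \<open>The roots d, e enter only in weight one, through log (1 - R). Each higher weight is an
  integration against dlog R, which involves 1 / t and the kernels of a and b alone. The hypothesis
  \<open>bound\<close> includes t = 1, where the value is finally taken.\<close>

lemma Li_rational_in_MZV:
  fixes a b d e :: complex and N s :: nat
  defines "\<kappa> \<equiv> d + e - a - b"
  assumes N: "N > 0" and roots: "a ^ N = 1" "b ^ N = 1" "d ^ N = 1" "e ^ N = 1"
    and ne: "a \<noteq> 1" "b \<noteq> 1" "d \<noteq> 1" "e \<noteq> 1" and prod: "a * b = d * e" and k: "\<kappa> \<noteq> 0"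
    and bound: "\<And>t::real. 0 \<le> t \<Longrightarrow> t \<le> 1 \<Longrightarrow>
      norm (\<kappa> * of_real t) < norm ((1 - a * of_real t) * (1 - b * of_real t))"
    and s: "s \<ge> 1"
  shows "Li s (\<kappa> / ((1 - a) * (1 - b))) \<in> MZV_space s N"
proof -
  define R where "R = (\<lambda>t. \<kappa> * t / ((1 - a * t) * (1 - b * t)))"
  define dlogR where "dlogR = (\<lambda>t. 1 / t + a / (1 - a * t) + b / (1 - b * t))"
  have nz: "1 - a * of_real t \<noteq> 0" "1 - b * of_real t \<noteq> 0" if "0 \<le> t" "t \<le> 1" for t :: real
    using bound[OF that] by auto
  have R_less: "norm (R (of_real t)) < 1" if "0 \<le> t" "t \<le> 1" for t :: real
    using bound[OF that] nz[OF that] by (simp add: R_def norm_divide divide_less_eq)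
  have R_cont: "isCont R (of_real t)" if "0 \<le> t" "t \<le> 1" for t :: real
    unfolding R_def using nz[OF that] by (intro continuous_intros) auto
  have R_ne: "R (of_real t) \<noteq> 0" if "0 < t" "t < 1" for t :: real
    using that nz[of t] k by (simp add: R_def)
  have R_deriv: "(R has_field_derivative dlogR (of_real t) * R (of_real t)) (at (of_real t))"
    if t: "0 < t" "t < 1" for t :: real
  proof -
    define x where "x = complex_of_real t"
    have x: "x \<noteq> 0" "1 - a * x \<noteq> 0" "1 - b * x \<noteq> 0"
      using t nz[of t] by (auto simp: x_def)
    have eq: "(\<kappa> * (A * B) - \<kappa> * x * (- a * B + - b * A)) / ((A * B) * (A * B)) =
        (1 / x + a / A + b / B) * (\<kappa> * x / (A * B))" if "A \<noteq> 0" "B \<noteq> 0" for A B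
      using x(1) that by (simp add: divide_simps) (simp add: algebra_simps)
    have "((\<lambda>t. (1 - a * t) * (1 - b * t)) has_field_derivative
        - a * (1 - b * x) + - b * (1 - a * x)) (at x)"
      by (auto intro!: derivative_eq_intros simp: algebra_simps)
    moreover have "((\<lambda>t. \<kappa> * t) has_field_derivative \<kappa>) (at x)"
      by (auto intro!: derivative_eq_intros)
    ultimately have "(R has_field_derivative (\<kappa> * ((1 - a * x) * (1 - b * x)) - \<kappa> * x *
        (- a * (1 - b * x) + - b * (1 - a * x))) / (((1 - a * x) * (1 - b * x)) * ((1 - a * x) * (1 - b * x)))) (at x)"
      unfolding R_def using x by (intro DERIV_divide) auto
    then show ?thesis
      unfolding eq[OF x(2,3)] by (simp add: dlogR_def R_def x_def)
  qed
  have Li_R_deriv: "((\<lambda>t. Li (Suc j) (R t)) has_field_derivative Li j (R (of_real t)) * dlogR (of_real t)) (at (of_real t))"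
    if "0 < t" "t < 1" for t :: real and j
    using that by (intro Li_dlog R_deriv R_less R_ne) auto
  \<comment> \<open>Equality of derivatives along the open segment suffices, because it is convex
    and both functions are continuous at 0 with value 0.\<close>
  have unique: "Li (Suc j) (R (of_real t)) = g (of_real t)"
    if g: "mspan i N g" "\<And>t. 0 < t \<Longrightarrow> t < 1 \<Longrightarrow>
        (g has_field_derivative Li j (R (of_real t)) * dlogR (of_real t)) (at (of_real t))"
      and t: "0 < t" "t < 1" for i j g and t :: real
  proof -
    define D where "D = (\<lambda>t. Li (Suc j) (R t) - g t)"
    have "\<exists>c. \<forall>x\<in>complex_of_real ` {0<..<1}. D x = c"
    proof (rule has_field_derivative_zero_constant)
      show "convex (complex_of_real ` {0<..<1})"
        by (intro convex_linear_image bounded_linear.linear bounded_linear_of_real) auto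
      fix x assume "x \<in> complex_of_real ` {0<..<1}"
      then obtain u where u: "0 < u" "u < 1" "x = of_real u"
        by auto
      show "(D has_field_derivative 0) (at x within complex_of_real ` {0<..<1})"
        using DERIV_diff[OF Li_R_deriv[OF u(1,2), of j] g(2)[OF u(1,2)]]
        unfolding D_def u(3) by (simp add: has_field_derivative_at_within)
    qed
    then obtain c where c: "\<And>u. 0 < u \<Longrightarrow> u < 1 \<Longrightarrow> D (of_real u) = c"
      by force
    have "isCont (\<lambda>t. Li (Suc j) (R t)) 0"
    proof (rule isCont_o2[where g = "Li (Suc j)"])
      show "isCont R 0"
        using R_cont[of 0] by simp
      show "isCont (Li (Suc j)) (R 0)"
        by (rule isCont_Li) (simp add: R_def)
    qed
    then have "isCont D 0" "D 0 = 0"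
      using mspan_isCont_0[OF g(1) N] by (auto simp: D_def R_def)
    then have "(D \<longlongrightarrow> 0) (at 0)"
      by (simp add: isCont_def)
    moreover have "filterlim complex_of_real (at 0) (at_right 0)"
      by (auto simp: filterlim_at eventually_at_filter intro!: tendsto_eq_intros)
    ultimately have "((\<lambda>u::real. D (of_real u)) \<longlongrightarrow> 0) (at_right 0)"
      by (rule filterlim_compose)
    moreover have "eventually (\<lambda>u::real. u \<in> {0<..<1}) (at_right 0)"
      by (rule eventually_at_right_real) simp
    then have "eventually (\<lambda>u::real. D (of_real u) = c) (at_right 0)"
      by eventually_elim (simp add: c)
    then have "((\<lambda>u::real. D (of_real u)) \<longlongrightarrow> c) (at_right 0)"
      by (rule tendsto_eventually)
    ultimately have "c = 0"
      using tendsto_unique trivial_limit_at_right_real by blast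
    then show ?thesis
      using c[OF t] by (simp add: D_def)
  qed
  have "\<exists>f. mspan (Suc j) N f \<and> (\<forall>t::real. 0 < t \<longrightarrow> t < 1 \<longrightarrow> Li (Suc j) (R (of_real t)) = f (of_real t))" for j
  proof (induction j)
    case 0
    \<comment> \<open>This is -log (1 - R) with the factored form of 1 - R inserted; it is
      identified with \<open>Li 1\<close> by its derivative.\<close>
    define f where "f = (\<lambda>t. (mgen [(1, d)] t + mgen [(1, e)] t) + (of_rat (-1) * mgen [(1, a)] t + of_rat (-1) * mgen [(1, b)] t))"
    have f: "mspan 1 N f"
      unfolding f_def by (intro mspan_add mspan_scale mspan_log N roots ne)
    have "(f has_field_derivative Li 0 (R (of_real t)) * dlogR (of_real t)) (at (of_real t))"
      if t: "0 < t" "t < 1" for t :: real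
    proof -
      define x where "x = complex_of_real t"
      have x: "norm x < 1" "x \<noteq> 0"
        using t by (auto simp: x_def)
      note n = norm_root_of_unity[OF _ N]
      have "(f has_field_derivative (d / (1 - d * x) + e / (1 - e * x)) +
          (of_rat (-1) * (a / (1 - a * x)) + of_rat (-1) * (b / (1 - b * x)))) (at x)"
        unfolding f_def by (intro DERIV_add DERIV_cmult mgen_deriv_single x n roots)
      moreover have "(d / (1 - d * x) + e / (1 - e * x)) +
          (of_rat (-1) * (a / (1 - a * x)) + of_rat (-1) * (b / (1 - b * x))) = Li 0 (R x) * dlogR x"
      proof -
        define A B D E where "A = 1 - a * x" and "B = 1 - b * x" and "D = 1 - d * x" and "E = 1 - e * x"
        note defs = A_def B_def D_def E_def
        have AB: "A \<noteq> 0" "B \<noteq> 0"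
          using nz[of t] t by (auto simp: A_def B_def x_def)
        have "norm (d * x) < 1" "norm (e * x) < 1"
          using n[OF roots(3)] n[OF roots(4)] x by (auto simp: norm_mult)
        then have DE: "D \<noteq> 0" "E \<noteq> 0"
          by (auto simp: D_def E_def)
        \<comment> \<open>The linear terms agree by the choice of \<open>\<kappa>\<close>, the
          quadratic ones because a b = d e.\<close>
        have X: "A * B - \<kappa> * x = D * E"
          unfolding defs \<kappa>_def using prod by algebra
        have "1 - R x = (A * B - \<kappa> * x) / (A * B)"
          using AB by (simp add: R_def A_def[symmetric] B_def[symmetric] diff_divide_distrib)
        then have "R x / (1 - R x) = \<kappa> * x / (D * E)"
          unfolding X using AB by (simp add: R_def A_def[symmetric] B_def[symmetric])
        moreover have "Li 0 (R x) = R x / (1 - R x)"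
          using R_less[of t] t by (intro Li_zeroth) (simp add: x_def)
        ultimately have Li0: "Li 0 (R x) = \<kappa> * x / (D * E)"
          by simp
        have poly: "(d * E + e * D) * (A * B) - (a * B + b * A) * (D * E) = \<kappa> * (A * B + x * a * B + x * b * A)"
          unfolding defs \<kappa>_def using prod by algebra
        have "(d / (1 - d * x) + e / (1 - e * x)) +
            (of_rat (-1) * (a / (1 - a * x)) + of_rat (-1) * (b / (1 - b * x))) =
            (d / D + e / E) - (a / A + b / B)"
          by (simp add: defs)
        also have "\<dots> =
            ((d * E + e * D) * (A * B) - (a * B + b * A) * (D * E)) / (A * B * (D * E))"
          using AB DE by (simp add: divide_simps)
        also have "\<dots> = \<kappa> * x / (D * E) * (1 / x + a / A + b / B)"
          unfolding poly using AB DE x(2) by (simp add: divide_simps) (simp add: algebra_simps)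
        finally show ?thesis
          unfolding Li0 by (simp only: dlogR_def defs)
      qed
      ultimately show ?thesis
        by (simp add: x_def)
    qed
    then show ?case
      using f unique[of 1 f 0] by auto
  next
    case (Suc j)
    then obtain f where f: "mspan (Suc j) N f" "\<And>t::real. 0 < t \<Longrightarrow> t < 1 \<Longrightarrow> Li (Suc j) (R (of_real t)) = f (of_real t)"
      by blast
    obtain g0 where g0: "mspan (Suc (Suc j)) N g0"
      "\<And>t. norm t < 1 \<Longrightarrow> t \<noteq> 0 \<Longrightarrow> (g0 has_field_derivative f t / t) (at t)"
      using mspan_integral_dt_over_t[OF f(1) N] by blast
    obtain ga where ga: "mspan (Suc (Suc j)) N ga"
      "\<And>t. norm t < 1 \<Longrightarrow> t \<noteq> 0 \<Longrightarrow> (ga has_field_derivative a / (1 - a * t) * f t) (at t)"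
      using mspan_integral_root[OF f(1) N roots(1) ne(1)] by blast
    obtain gb where gb: "mspan (Suc (Suc j)) N gb"
      "\<And>t. norm t < 1 \<Longrightarrow> t \<noteq> 0 \<Longrightarrow> (gb has_field_derivative b / (1 - b * t) * f t) (at t)"
      using mspan_integral_root[OF f(1) N roots(2) ne(2)] by blast
    define g where "g = (\<lambda>t. g0 t + ga t + gb t)"
    have g: "mspan (Suc (Suc j)) N g"
      unfolding g_def by (intro mspan_add g0 ga gb)
    have "(g has_field_derivative Li (Suc j) (R (of_real t)) * dlogR (of_real t)) (at (of_real t))"
      if t: "0 < t" "t < 1" for t :: real
    proof -
      have x: "norm (complex_of_real t) < 1" "complex_of_real t \<noteq> 0"
        using t by auto
      show ?thesis
        unfolding g_def f(2)[OF t]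
        by (rule DERIV_cong[OF DERIV_add[OF DERIV_add[OF g0(2)[OF x] ga(2)[OF x]] gb(2)[OF x]]])
           (simp add: dlogR_def algebra_simps)
    qed
    then show ?case
      using g unique[OF g, of "Suc j"] by blast
  qed
  then obtain f where f: "mspan s N f" "\<And>t::real. 0 < t \<Longrightarrow> t < 1 \<Longrightarrow> Li s (R (of_real t)) = f (of_real t)"
    using s by (cases s) auto
  obtain l where l: "l \<in> MZV_space s N" "((\<lambda>t::real. f (of_real t)) \<longlongrightarrow> l) (at_left 1)"
    using mspan_limit[OF f(1) N] by blast
  \<comment> \<open>At t = 1 the argument still lies in the open disc, so the limit from the left is
    the value itself, and it equals the limit in the span.\<close>
  have "isCont (\<lambda>t::real. Li s (R (of_real t))) 1"
  proof (rule isCont_o2[where g = "Li s"])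
    show "isCont (\<lambda>t. R (complex_of_real t)) 1"
      by (rule isCont_o2[where g = R and f = of_real]) (use R_cont[of 1] in \<open>auto intro: continuous_intros\<close>)
    show "isCont (Li s) (R (complex_of_real 1))"
      using R_less[of 1] by (intro isCont_Li) auto
  qed
  then have "((\<lambda>t::real. Li s (R (of_real t))) \<longlongrightarrow> Li s (R 1)) (at_left 1)"
    by (simp add: isCont_def filterlim_at_split)
  moreover have "eventually (\<lambda>t::real. t \<in> {0<..<1}) (at_left 1)"
    by (rule eventually_at_left_real) simp
  then have "eventually (\<lambda>t::real. Li s (R (of_real t)) = f (of_real t)) (at_left 1)"
    by eventually_elim (simp add: f(2))
  ultimately have "((\<lambda>t::real. f (of_real t)) \<longlongrightarrow> Li s (R 1)) (at_left 1)"
    by (rule Lim_transform_eventually)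
  then have "Li s (R 1) = l"
    by (rule tendsto_unique[OF trivial_limit_at_left_real _ l(2)])
  then show ?thesis
    using l(1) by (simp add: R_def)
qed

section \<open>Tenth roots of unity and the golden ratio\<close>

text \<open>Summability is assumed in place of |x| < 1 so that boundary points are covered: x = -1
  with s = 1 for ln 2, and x = 1 with s = 2 or 3.\<close>

lemma Li_complex_of_real:
  fixes x :: real
  assumes "summable (\<lambda>n. x ^ (n + 1) / real (n + 1) ^ s)"
  shows "Li s (complex_of_real x) = of_real (Li s x)"
proof -
  have "(\<lambda>n. complex_of_real (x ^ (n + 1) / real (n + 1) ^ s)) sums of_real (Li s x)"
    unfolding Li_def by (intro sums_of_real summable_sums assms)
  then show ?thesis
    by (simp add: Li_def sums_iff)
qed

lemma Li_summable_less:
  fixes x :: real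
  assumes "\<bar>x\<bar> < 1"
  shows "summable (\<lambda>n. x ^ (n + 1) / real (n + 1) ^ s)"
proof -
  have "summable (\<lambda>n. licoeff s n * x ^ n)"
    using assms by (intro poly_bounded_summable licoeff_bounded) auto
  then have "summable (\<lambda>n. licoeff s (Suc n) * x ^ Suc n)"
    by (subst summable_Suc_iff)
  then show ?thesis
    by (simp add: licoeff_def)
qed

lemma mpl_single:
  assumes "s > 0" "z ^ N = 1" "N > 0" "(s, z) \<noteq> (1, 1)"
  shows "mpl [(s, z)] = Li s z" "Li s z \<in> MZV_space s N"
proof -
  have adm: "adm s N [(s, z)]"
    using assms by (auto simp: adm_def)
  have "mpl [(s, z)] = suminf (mcoeff [(s, z)])"
    by (rule adm_mpl[OF adm assms(3)])
  also have "\<dots> = (\<Sum>n. mcoeff [(s, z)] (Suc n))"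
    using suminf_split_head[OF adm_summable[OF adm assms(3)]] by simp
  also have "\<dots> = Li s z"
    by (simp add: Li_def)
  finally show "mpl [(s, z)] = Li s z" .
  then show "Li s z \<in> MZV_space s N"
    using MZV_mpl[of s N "[(s, z)]"] adm assms(3) by (simp add: adm_iff_admissible)
qed

lemma ln_2_in_MZV: "complex_of_real (ln 2) \<in> MZV_space 1 10"
proof -
  have "(\<lambda>n. - ((- 1) ^ n / real (Suc n))) sums - ln 2"
    by (intro sums_minus alternating_harmonic_series_sums)
  then have s: "(\<lambda>n. (- 1) ^ (n + 1) / real (n + 1) ^ 1) sums - ln (2::real)"
    by simp
  then have "Li 1 (complex_of_real (- 1)) = of_real (Li 1 (- 1))"
    by (intro Li_complex_of_real) (rule sums_summable)
  also have "Li 1 (- 1 :: real) = - ln 2"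
    using s by (simp add: Li_def sums_iff)
  finally show ?thesis
    using MZV_scale[OF mpl_single(2)[of 1 "- 1" 10], of "- 1"] by simp
qed

lemma pi_squared_in_MZV: "complex_of_real (pi\<^sup>2) \<in> MZV_space 2 10"
proof -
  have "Li 2 (complex_of_real 1) = of_real (Li 2 1)"
    by (intro Li_complex_of_real Li_summable) auto
  then have "of_rat 6 * Li 2 1 = complex_of_real (6 * Li 2 1)"
    by simp
  also have "6 * Li 2 (1::real) = pi\<^sup>2"
    by (simp add: Li_two_one)
  finally show ?thesis
    using MZV_scale[OF mpl_single(2)[of 2 1 10], of 6] by simp
qed

lemma zeta_3_in_MZV: "complex_of_real (Li 3 1) \<in> MZV_space 3 10"
proof -
  have "Li 3 (complex_of_real 1) = of_real (Li 3 1)"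
    by (intro Li_complex_of_real Li_summable) auto
  then show ?thesis
    using mpl_single(2)[of 3 1 10] by simp
qed

locale golden =
  fixes phi :: real
  assumes phi: "phi = (1 + sqrt 5) / 2"
begin

lemma phi_squared: "phi\<^sup>2 = phi + 1"
  by (simp add: phi power2_eq_square field_simps)

lemma phi_bounds: "3 / 2 < phi" "phi < 2"
proof -
  have "sqrt (2\<^sup>2) < sqrt 5" "sqrt 5 < sqrt (3\<^sup>2)"
    by (intro real_sqrt_less_mono; simp)+
  then show "3 / 2 < phi" "phi < 2"
    unfolding phi by simp_all
qed

text \<open>\<open>zeta = exp (pi i / 5)\<close>, in algebraic form.\<close>

definition zeta where "zeta = Complex (phi / 2) (sqrt (1 - phi\<^sup>2 / 4))"

lemma Re_zeta: "Re zeta = phi / 2"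
  by (simp add: zeta_def)

lemma Im_zeta: "(Im zeta)\<^sup>2 = 1 - phi\<^sup>2 / 4"
proof -
  have "phi\<^sup>2 \<le> 2\<^sup>2"
    using phi_bounds by (intro power_mono) auto
  then show ?thesis
    by (simp add: zeta_def)
qed

lemma phi_squared_complex: "complex_of_real phi * of_real phi = of_real phi + 1"
  using phi_squared by (metis of_real_1 of_real_add of_real_mult power2_eq_square)

lemma zeta_squared: "zeta * zeta = of_real phi * zeta - 1"
  using Im_zeta by (simp add: complex_eq_iff Re_zeta power2_eq_square) 

text \<open>Reducing by zeta^2 = phi zeta - 1 and phi^2 = phi + 1 makes every power linear in zeta,
  so later identities are polynomial algebra.\<close>

lemma zeta_powers:
  "zeta ^ 2 = of_real phi * zeta - 1" "zeta ^ 3 = of_real phi * zeta - of_real phi"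
  "zeta ^ 4 = zeta - of_real phi" "zeta ^ 5 = - 1"
proof -
  show 2: "zeta ^ 2 = of_real phi * zeta - 1"
    by (simp add: power2_eq_square zeta_squared)
  show 3: "zeta ^ 3 = of_real phi * zeta - of_real phi"
    unfolding power3_eq_cube using zeta_squared phi_squared_complex by algebra
  show 4: "zeta ^ 4 = zeta - of_real phi"
    unfolding power4_eq_xxxx using zeta_squared phi_squared_complex by algebra
  have "zeta ^ 5 = zeta ^ 4 * zeta"
    by (simp add: eval_nat_numeral)
  also have "\<dots> = - 1"
    unfolding 4 using zeta_squared by algebra
  finally show "zeta ^ 5 = - 1" .
qed

lemma zeta_power_root: "(zeta ^ k) ^ 10 = 1"
proof -
  have "(zeta ^ k) ^ 10 = ((zeta ^ 5) ^ 2) ^ k"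
    by (simp flip: power_mult add: mult.commute)
  then show ?thesis
    by (simp add: zeta_powers)
qed

lemma Re_zeta_powers:
  "Re (zeta ^ 2) = (phi - 1) / 2" "Re (zeta ^ 3) = (1 - phi) / 2" "Re (zeta ^ 4) = - phi / 2"
  unfolding zeta_powers using phi_squared by (simp_all add: Re_zeta power2_eq_square field_simps)

text \<open>Both pairs, zeta^4, zeta^6 and zeta^2, zeta^8, consist of conjugates with product 1, so
  R is real on [0, 1]. Their sums -phi and phi - 1 give the numerator (2 phi - 1) t and the
  denominator 1 + phi t + t^2.\<close>

lemma Li_inverse_phi_in_MZV:
  assumes "s \<ge> 1"
  shows "complex_of_real (Li s (1 / phi)) \<in> MZV_space s 10"
proof -
  let ?f = "complex_of_real phi"
  have b: "zeta ^ 6 = - zeta" "zeta ^ 8 = ?f - ?f * zeta"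
  proof -
    have "zeta ^ 6 = zeta ^ 5 * zeta" "zeta ^ 8 = zeta ^ 5 * zeta ^ 3"
      by (simp_all add: eval_nat_numeral)
    then show "zeta ^ 6 = - zeta" "zeta ^ 8 = ?f - ?f * zeta"
      by (simp_all add: zeta_powers)
  qed
  have k: "zeta ^ 2 + zeta ^ 8 - zeta ^ 4 - zeta ^ 6 = 2 * ?f - 1"
    by (simp add: zeta_powers b)
  have ab: "(1 - zeta ^ 4 * t) * (1 - zeta ^ 6 * t) = 1 + ?f * t + t * t" for t
    unfolding zeta_powers b using zeta_squared by algebra
  have "Li s ((zeta ^ 2 + zeta ^ 8 - zeta ^ 4 - zeta ^ 6) / ((1 - zeta ^ 4) * (1 - zeta ^ 6))) \<in> MZV_space s 10"
  proof (rule Li_rational_in_MZV)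
    have "Re (zeta ^ 6) = - phi / 2" "Re (zeta ^ 8) = (phi - 1) / 2"
      using phi_squared by (simp_all add: b Re_zeta power2_eq_square field_simps)
    then show "zeta ^ 4 \<noteq> 1" "zeta ^ 6 \<noteq> 1" "zeta ^ 2 \<noteq> 1" "zeta ^ 8 \<noteq> 1"
      using Re_zeta_powers phi_bounds by force+
    show "zeta ^ 4 * zeta ^ 6 = zeta ^ 2 * zeta ^ 8"
      by (simp flip: power_add)
    show "zeta ^ 2 + zeta ^ 8 - zeta ^ 4 - zeta ^ 6 \<noteq> 0"
      unfolding k using phi_bounds by (auto simp: complex_eq_iff)
    fix t :: real assume t: "0 \<le> t" "t \<le> 1"
    have "(2 * phi - 1) * t < 1 + phi * t + t * t"
    proof -
      have "(phi - 1) * t \<le> (phi - 1) * 1"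
        using t phi_bounds by (intro mult_left_mono) auto
      also have "\<dots> < 1"
        using phi_bounds by simp
      also have "1 \<le> 1 + t * t"
        by simp
      finally have "phi * t + (phi - 1) * t < phi * t + (1 + t * t)"
        by (rule add_strict_left_mono)
      then show ?thesis
        by (simp add: algebra_simps)
    qed
    moreover have "norm ((2 * ?f - 1) * of_real t) = (2 * phi - 1) * t"
    proof -
      have "(2 * ?f - 1) * of_real t = of_real ((2 * phi - 1) * t)"
        by simp
      then show ?thesis
        using t phi_bounds by (simp only: norm_of_real) simp
    qed
    moreover have "norm (1 + ?f * of_real t + of_real t * of_real t) = 1 + phi * t + t * t"
    proof -
      have "1 + ?f * of_real t + of_real t * of_real t = of_real (1 + phi * t + t * t)"
        by simp
      then show ?thesis
        using t phi_bounds by (simp only: norm_of_real) (simp add: add_nonneg_nonneg)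
    qed
    ultimately show "norm ((zeta ^ 2 + zeta ^ 8 - zeta ^ 4 - zeta ^ 6) * of_real t)
        < norm ((1 - zeta ^ 4 * of_real t) * (1 - zeta ^ 6 * of_real t))"
      unfolding k ab by simp
  qed ((rule zeta_power_root assms | simp)+)
  moreover have "(zeta ^ 2 + zeta ^ 8 - zeta ^ 4 - zeta ^ 6) / ((1 - zeta ^ 4) * (1 - zeta ^ 6)) = of_real (1 / phi)"
  proof -
    have "(2 * phi - 1) / (2 + phi) = 1 / phi"
      using phi_squared phi_bounds by (simp add: field_simps power2_eq_square)
    then have "complex_of_real ((2 * phi - 1) / (2 + phi)) = of_real (1 / phi)"
      by (rule arg_cong)
    then show ?thesis
      using ab[of 1] unfolding k by (simp add: add_ac)
  qed
  ultimately show ?thesis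
    using Li_complex_of_real[OF Li_summable_less[of "1 / phi" s]] phi_bounds by simp
qed

text \<open>Here \<open>2 phi - 3 = phi\<^sup>-\<^sup>3\<close>.\<close>

lemma Li_inverse_phi_cubed_in_MZV:
  assumes "s \<ge> 1"
  shows "complex_of_real (Li s (2 * phi - 3)) \<in> MZV_space s 10"
proof -
  let ?f = "complex_of_real phi"
  have k: "zeta ^ 2 + zeta ^ 5 - zeta ^ 3 - zeta ^ 4 = 2 * ?f - 2 - zeta"
    by (simp add: zeta_powers)
  \<comment> \<open>The exponents satisfy 3 + 4 = 2 + 5, but the pairs are not conjugate: R is not
    real-valued on the segment, although its value at 1 is.\<close>
  have "Li s ((zeta ^ 2 + zeta ^ 5 - zeta ^ 3 - zeta ^ 4) / ((1 - zeta ^ 3) * (1 - zeta ^ 4))) \<in> MZV_space s 10"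
  proof (rule Li_rational_in_MZV)
    have "Re (zeta ^ 5) = - 1"
      by (simp add: zeta_powers)
    then show "zeta ^ 3 \<noteq> 1" "zeta ^ 4 \<noteq> 1" "zeta ^ 2 \<noteq> 1" "zeta ^ 5 \<noteq> 1"
      using Re_zeta_powers phi_bounds by force+
    show "zeta ^ 3 * zeta ^ 4 = zeta ^ 2 * zeta ^ 5"
      by (simp flip: power_add)
    have "(norm (2 * ?f - 2 - zeta))\<^sup>2 = (2 * phi - 2 - phi / 2)\<^sup>2 + (1 - phi\<^sup>2 / 4)"
      unfolding cmod_power2 Im_zeta[symmetric] by (simp add: Re_zeta)
    also have "\<dots> = 2 * phi\<^sup>2 - 6 * phi + 5"
      by (simp add: power2_eq_square field_simps)
    finally have k2: "(norm (2 * ?f - 2 - zeta))\<^sup>2 = 7 - 4 * phi"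
      by (simp add: phi_squared)
    have "7 - 4 * phi \<noteq> 0"
    proof
      assume "7 - 4 * phi = 0"
      then have "phi = 7 / 4"
        by simp
      with phi_squared show False
        by (simp add: power2_eq_square)
    qed
    then show "zeta ^ 2 + zeta ^ 5 - zeta ^ 3 - zeta ^ 4 \<noteq> 0"
      unfolding k using k2 by (metis norm_zero zero_power2)
    fix t :: real assume t: "0 \<le> t" "t \<le> 1"
    have "(norm (2 * ?f - 2 - zeta))\<^sup>2 < 1\<^sup>2"
      unfolding k2 using phi_bounds by simp
    then have "norm (2 * ?f - 2 - zeta) < 1"
      by (rule power2_less_imp_less) simp
    then have "norm ((2 * ?f - 2 - zeta) * of_real t) < 1"
      using t by (smt (verit) mult_left_le norm_ge_zero norm_mult norm_of_real)
    \<comment> \<open>zeta^3 and zeta^4 lie in the left half-plane, so both denominator factors have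
      norm at least 1, while the constant in the numerator has squared norm 7 - 4 phi < 1.\<close>
    moreover have "1 \<le> norm (1 - z * of_real t)" if "Re z \<le> 0" for z
    proof -
      have "1 \<le> Re (1 - z * of_real t)"
        using that t by (simp add: mult_nonpos_nonneg)
      also have "\<dots> \<le> norm (1 - z * of_real t)"
        by (rule complex_Re_le_cmod)
      finally show ?thesis .
    qed
    then have "1 * 1 \<le> norm (1 - zeta ^ 3 * of_real t) * norm (1 - zeta ^ 4 * of_real t)"
      using Re_zeta_powers phi_bounds by (intro mult_mono) auto
    ultimately show "norm ((zeta ^ 2 + zeta ^ 5 - zeta ^ 3 - zeta ^ 4) * of_real t)
        < norm ((1 - zeta ^ 3 * of_real t) * (1 - zeta ^ 4 * of_real t))"
      unfolding k by (simp add: norm_mult)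
  qed ((rule zeta_power_root assms | simp)+)
  moreover have "(zeta ^ 2 + zeta ^ 5 - zeta ^ 3 - zeta ^ 4) / ((1 - zeta ^ 3) * (1 - zeta ^ 4)) = of_real (2 * phi - 3)"
  proof -
    have "1 - zeta ^ 3 \<noteq> 0" "1 - zeta ^ 4 \<noteq> 0"
      using Re_zeta_powers phi_bounds by force+
    moreover have "2 * ?f - 2 - zeta = (2 * ?f - 3) * ((1 - zeta ^ 3) * (1 - zeta ^ 4))"
      unfolding zeta_powers using zeta_squared phi_squared_complex by algebra
    ultimately show ?thesis
      unfolding k by simp
  qed
  ultimately show ?thesis
    using Li_complex_of_real[OF Li_summable_less[of "2 * phi - 3" s]] phi_bounds by simp
qed

text \<open>Weight one at 1/phi: as 1 - 1/phi is phi^-2, Li_1(1/phi) is twice log phi.\<close>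

lemma ln_phi_in_MZV: "complex_of_real (ln phi) \<in> MZV_space 1 10"
proof -
  have e: "1 - 1 / phi = 1 / (phi * phi)"
    using phi_squared phi_bounds by (simp add: field_simps power2_eq_square)
  have "Li 1 (1 / phi) = - ln (1 - 1 / phi)"
    using phi_bounds by (intro Li_one) simp
  also have "\<dots> = 2 * ln phi"
    unfolding e using phi_bounds by (simp add: ln_div ln_mult)
  finally show ?thesis
    using MZV_scale[OF Li_inverse_phi_in_MZV[of 1], of "1 / 2"] by (simp add: of_rat_divide)
qed

end

theorem theorem2:
  fixes phi l lam :: real
  assumes "phi = (1 + sqrt 5) / 2" and "l = ln phi" and "lam = ln 2"
  shows "(\<Sum>n. (-1) ^ n / (real (2*n+1) ^ 3 * real ((2*n) choose n)))
           = - 4 * polylog 3 (phi powi (-3)) / 3 - 4 * polylog 2 (phi powi (-3)) * l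
             + polylog 3 (phi powi (-1)) - 25 * l ^ 3 / 3 + 6 * lam * l ^ 2
             + pi ^ 2 * l / 10 + 12 * zeta3 / 5 - pi ^ 2 * lam / 3
         \<and> complex_of_real (\<Sum>n. (-1) ^ n / (real (2*n+1) ^ 3 * real ((2*n) choose n)))
             \<in> MZV_space 3 10"
proof
  interpret golden phi
    by unfold_locales (rule assms(1))
  define S where "S = (\<Sum>n. (-1) ^ n / (real (2*n+1) ^ 3 * real ((2*n) choose n)))"
  have S: "S = - 4 * polylog 3 (phi powi (-3)) / 3 - 4 * polylog 2 (phi powi (-3)) * l
             + polylog 3 (phi powi (-1)) - 25 * l ^ 3 / 3 + 6 * lam * l ^ 2
             + pi ^ 2 * l / 10 + 12 * zeta3 / 5 - pi ^ 2 * lam / 3"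
    unfolding S_def central_binomial_series_eq polylog_eq_Li zeta3_eq_Li
    by (rule golden_series_eq[OF assms])
  then show "(\<Sum>n. (-1) ^ n / (real (2*n+1) ^ 3 * real ((2*n) choose n)))
           = - 4 * polylog 3 (phi powi (-3)) / 3 - 4 * polylog 2 (phi powi (-3)) * l
             + polylog 3 (phi powi (-1)) - 25 * l ^ 3 / 3 + 6 * lam * l ^ 2
             + pi ^ 2 * l / 10 + 12 * zeta3 / 5 - pi ^ 2 * lam / 3"
    unfolding S_def .
  have p1: "phi powi (-1) = 1 / phi"
    by (simp add: power_int_minus field_simps)
  have "(2 * phi - 3) * phi ^ 3 = 1"
    using phi_squared by (simp add: power2_eq_square power3_eq_cube) algebra
  then have p3: "phi powi (-3) = 2 * phi - 3"
    using phi_bounds by (simp add: power_int_minus field_simps)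
  define V W A L M P Z where "V = complex_of_real (Li 3 (2 * phi - 3))"
    and "W = complex_of_real (Li 2 (2 * phi - 3))" and "A = complex_of_real (Li 3 (1 / phi))"
    and "L = complex_of_real l" and "M = complex_of_real lam" and "P = complex_of_real (pi\<^sup>2)"
    and "Z = complex_of_real (Li 3 1)"
  note defs = V_def W_def A_def L_def M_def P_def Z_def
  have one: "L \<in> MZV_space 1 10" "M \<in> MZV_space 1 10"
    using ln_phi_in_MZV ln_2_in_MZV by (simp_all add: defs assms)
  have two: "W \<in> MZV_space 2 10" "P \<in> MZV_space 2 10" "L * L \<in> MZV_space 2 10"
    using Li_inverse_phi_cubed_in_MZV[of 2] pi_squared_in_MZV MZV_mult[OF one(1) one(1)]
    by (simp_all add: defs numeral_2_eq_2)
  have three: "V \<in> MZV_space 3 10" "A \<in> MZV_space 3 10" "Z \<in> MZV_space 3 10"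
    using Li_inverse_phi_cubed_in_MZV[of 3] Li_inverse_phi_in_MZV[of 3] zeta_3_in_MZV
    by (simp_all add: defs)
  have three': "W * L \<in> MZV_space 3 10" "L * L * L \<in> MZV_space 3 10" "L * L * M \<in> MZV_space 3 10"
    "P * L \<in> MZV_space 3 10" "P * M \<in> MZV_space 3 10"
    using MZV_mult[OF two(1) one(1)] MZV_mult[OF two(3) one(1)] MZV_mult[OF two(3) one(2)]
      MZV_mult[OF two(2) one(1)] MZV_mult[OF two(2) one(2)]
    by (simp_all add: numeral_3_eq_3)
  \<comment> \<open>The closed form is homogeneous of weight three: \<open>l\<close> and
    \<open>lam\<close> count 1, Li_2 and pi^2 count 2, Li_3 and zeta(3) count 3.\<close>
  have "complex_of_real S = of_rat (- 4 / 3) * V + of_rat (- 4) * (W * L) + A + of_rat (- 25 / 3) * (L * L * L)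
      + of_rat 6 * (L * L * M) + of_rat (1 / 10) * (P * L) + of_rat (12 / 5) * Z + of_rat (- 1 / 3) * (P * M)"
    unfolding S p1 p3 polylog_eq_Li zeta3_eq_Li defs
    by (simp add: of_rat_divide of_rat_minus power2_eq_square power3_eq_cube)
  also have "\<dots> \<in> MZV_space 3 10"
    by (intro MZV_add MZV_scale three three')
  finally show "complex_of_real (\<Sum>n. (-1) ^ n / (real (2*n+1) ^ 3 * real ((2*n) choose n))) \<in> MZV_space 3 10"
    unfolding S_def .
qed

end
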